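(* Let $d\ge1$, $r>d/2$, $s>d/2+r$, $0\le q<s$ and $0<s-q\le2$. Assume that the sampling measures satisfy $\|\nu_m\|_{H^{-r}}\le C_1\delta_m^{r}$ for all $m$, with $C_1$ independent of $m$. Let $\mathcal F_n$ be the heat filtered hyperinterpolation operator. Then: (i) There is a constant $C>0$, independent of $m$, $n$ and $f$, such that for all $m$, $n\ge1$ and $f\in H^s(\mathbb S^d)$, $$\|f-\mathcal F_nf\|_{H^q}\le C\left(n^{-(s-q)}+\delta_m^{r}n^{r+q}\right)\|f\|_{H^s}.$$ (ii) If $n=n(m)\ge1$ is chosen so that $c_1\delta_m^{-r/(s+r)}\le n\le c_2\delta_m^{-r/(s+r)}$ with constants $c_1,c_2>0$ independent of $m$, then, with $C'$ independent of $m$ and $f$, $$\|f-\mathcal F_nf\|_{H^q}\le C'\,\delta_m^{\frac{r(s-q)}{s+r}}\|f\|_{H^s}.$$ (iii) If, in addition, the sampling sets are quasi-uniform ($\delta_m\le C_0\gamma_m$ for all $m$, with $C_0$ independent of $m$) and $0<w_j\le C_2\delta_m^{d}$ for all $j$ and $m$ with $C_2$ independent of $j,m$, then for every $C_3>0$ there is a constant $C''>0$ independent of $m,n,f$ such that $\|\mathcal F_nf\|_{L^\infty}\le C''\|f\|_{L^\infty}$ for all $f\in C(\mathbb S^d)$ and all $m$ and $n\ge1$ with $n\le C_3\delta_m^{-1}$.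
   Context: $\mathbb S^d=\{x\in\mathbb R^{d+1}:|x|=1\}$ carries the normalized surface measure $\sigma$ ($\sigma(\mathbb S^d)=1$) and the geodesic distance $\rho(x,y)=\arccos(x\cdot y)$. For each $\ell\ge0$, $\{Y_{\ell,k}:1\le k\le Z(d,\ell)\}$ is an $L^2(\mathbb S^d,\sigma)$-orthonormal basis of the (real) spherical harmonics of degree $\ell$; $\lambda_\ell=\ell(\ell+d-1)$ is the corresponding eigenvalue of $-\Delta_{\mathbb S^d}$. For a distribution $u$ put $\widehat u_{\ell,k}=\langle u,Y_{\ell,k}\rangle$. For $s\in\mathbb R$, $H^s(\mathbb S^d)$ is the space of distributions with $\|u\|_{H^s}^2=\sum_{\ell\ge0}(1+\lambda_\ell)^s\sum_k|\widehat u_{\ell,k}|^2<\infty$; for $s>d/2$ its elements are identified with their continuous representatives. Sampling: for each $m$ (in an infinite set of positive integers, with $m\ge2$ whenever $\gamma_m$ is used) there are a point set $\mathcal X_m=\{x_j\}_{j=1}^m\subset\mathbb S^d$ and weights $w_j>0$ with $\sum_{j=1}^mw_j=1$ (points and weights may depend on $m$). The mesh norm is $\delta_m=\sup_{x\in\mathbb S^d}\min_{j}\rho(x,x_j)$ and the separation radius is $\gamma_m=\tfrac12\min_{i\ne j}\rho(x_i,x_j)$. Set $\nu_m=\sum_{j=1}^mw_j\delta_{x_j}-\sigma$, where $\delta_{x_j}$ is the Dirac mass at $x_j$. For $n\ge1$, the heat kernel is $\Phi_n(x,y)=\sum_{\ell\ge0}e^{-\lambda_\ell/n^2}\sum_kY_{\ell,k}(x)Y_{\ell,k}(y)$,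 i.e. the kernel of $e^{n^{-2}\Delta_{\mathbb S^d}}$, and the heat filtered hyperinterpolation operator is $\mathcal F_nf(x)=\sum_{j=1}^mw_jf(x_j)\Phi_n(x,x_j)$; it depends on $m$ as well as $n$. *)

theory Defs
  imports "HOL-Analysis.Analysis" "HOL-Probability.Essential_Supremum"
begin

text \<open>
  The ambient space of the sphere of dimension d is a Euclidean space \<^typ>\<open>'a\<close> of dimension
  d + 1, and the sphere itself is \<^term>\<open>sphere (0::'a::euclidean_space) 1\<close>. Functions on the
  sphere are represented by functions on the whole of \<^typ>\<open>'a\<close>; only their values on the
  sphere are ever used.
\<close>

section \<open>Surface measure and distances\<close>

text \<open>
  Normalized surface measure in polar coordinates: the measure of a set A on the sphere is the
  proportion of the unit ball occupied by the cone over A. Here \<^term>\<open>sgn x\<close> is x divided by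
  its norm.
\<close>

definition sphere_measure :: "'a::euclidean_space measure" where
  "sphere_measure =
     restrict_space (distr (uniform_measure lborel (ball 0 1)) borel sgn) (sphere 0 1)"

definition geodesic_dist :: "'a::euclidean_space \<Rightarrow> 'a \<Rightarrow> real" where
  "geodesic_dist x y = arccos (x \<bullet> y)"

definition mesh_norm :: "nat \<Rightarrow> (nat \<Rightarrow> 'a::euclidean_space) \<Rightarrow> real" where
  "mesh_norm m x = (SUP y\<in>sphere 0 1. Min ((\<lambda>j. geodesic_dist y (x j)) ` {1..m}))"

definition separation_radius :: "nat \<Rightarrow> (nat \<Rightarrow> 'a::euclidean_space) \<Rightarrow> real" where
  "separation_radius m x =
     Min {geodesic_dist (x i) (x j) | i j. i \<in> {1..m} \<and> j \<in> {1..m} \<and> i \<noteq> j} / 2"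

definition Linf_norm :: "('a::euclidean_space \<Rightarrow> real) \<Rightarrow> ereal" where
  "Linf_norm f = esssup sphere_measure (\<lambda>x. ereal \<bar>f x\<bar>)"


section \<open>Smooth functions and distributions on the sphere\<close>

definition partial_deriv :: "'a::euclidean_space \<Rightarrow> ('a \<Rightarrow> real) \<Rightarrow> 'a \<Rightarrow> real" where
  "partial_deriv b g x = frechet_derivative g (at x) b"

definition iter_partial :: "'a::euclidean_space list \<Rightarrow> ('a \<Rightarrow> real) \<Rightarrow> 'a \<Rightarrow> real" where
  "iter_partial bs g = foldr partial_deriv bs g"

text \<open>
  A function on the sphere is smooth iff its extension to the punctured space that is
  homogeneous of degree 0 is smooth, i.e. all iterated partial derivatives of the extension
  exist and are (totally) differentiable.
\<close>

definition smooth_on_sphere :: "('a::euclidean_space \<Rightarrow> real) \<Rightarrow> bool" where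
  "smooth_on_sphere \<phi> \<longleftrightarrow>
     (\<forall>bs. set bs \<subseteq> Basis \<longrightarrow> iter_partial bs (\<phi> \<circ> sgn) differentiable_on (- {0}))"

definition smooth_seminorm :: "nat \<Rightarrow> ('a::euclidean_space \<Rightarrow> real) \<Rightarrow> real" where
  "smooth_seminorm N \<phi> =
     (\<Sum>bs \<in> {bs. set bs \<subseteq> Basis \<and> length bs \<le> N}.
        SUP x\<in>sphere 0 1. \<bar>iter_partial bs (\<phi> \<circ> sgn) x\<bar>)"

text \<open>
  Distributions are the linear functionals on the smooth functions that are continuous in the
  topology generated by these seminorms. The bound forces the functional to depend only on
  the restriction of the test function to the sphere.
\<close>

definition sphere_distribution :: "(('a::euclidean_space \<Rightarrow> real) \<Rightarrow> real) \<Rightarrow> bool" where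
  "sphere_distribution u \<longleftrightarrow>
     (\<forall>\<phi> \<psi> a b. smooth_on_sphere \<phi> \<longrightarrow> smooth_on_sphere \<psi> \<longrightarrow>
        u (\<lambda>x. a * \<phi> x + b * \<psi> x) = a * u \<phi> + b * u \<psi>) \<and>
     (\<exists>N K. \<forall>\<phi>. smooth_on_sphere \<phi> \<longrightarrow> \<bar>u \<phi>\<bar> \<le> K * smooth_seminorm N \<phi>)"

definition dist_of_fun :: "('a::euclidean_space \<Rightarrow> real) \<Rightarrow> ('a \<Rightarrow> real) \<Rightarrow> real" where
  "dist_of_fun f \<phi> = (LINT x|sphere_measure. f x * \<phi> x)"

text \<open>
  The signed measure given by the weighted sum of the Dirac masses at the sampling points minus
  the surface measure, as a distribution.
\<close>

definition sampling_error ::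
    "nat \<Rightarrow> (nat \<Rightarrow> 'a::euclidean_space) \<Rightarrow> (nat \<Rightarrow> real) \<Rightarrow> ('a \<Rightarrow> real) \<Rightarrow> real" where
  "sampling_error m x w \<phi> = (\<Sum>j=1..m. w j * \<phi> (x j)) - (LINT y|sphere_measure. \<phi> y)"


section \<open>Spherical harmonics\<close>

definition laplacian :: "('a::euclidean_space \<Rightarrow> real) \<Rightarrow> 'a \<Rightarrow> real" where
  "laplacian g x = (\<Sum>b\<in>Basis. iter_partial [b, b] g x)"

definition spherical_harmonic :: "nat \<Rightarrow> ('a::euclidean_space \<Rightarrow> real) \<Rightarrow> bool" where
  "spherical_harmonic l h \<longleftrightarrow>
     (\<exists>p. real_polynomial_function p \<and>
          (\<forall>t x. p (t *\<^sub>R x) = t ^ l * p x) \<and>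
          (\<forall>x. laplacian p x = 0) \<and>
          (\<forall>x\<in>sphere 0 1. h x = p x))"

text \<open>
  An orthonormal basis of the harmonics of each degree l, indexed by 1, ..., Z l. Necessarily
  Z l is the dimension of that space.
\<close>

definition harmonic_orthonormal_basis ::
    "(nat \<Rightarrow> nat) \<Rightarrow> (nat \<Rightarrow> nat \<Rightarrow> 'a::euclidean_space \<Rightarrow> real) \<Rightarrow> bool" where
  "harmonic_orthonormal_basis Z Y \<longleftrightarrow>
     (\<forall>l. (\<forall>k\<in>{1..Z l}. spherical_harmonic l (Y l k)) \<and>
          (\<forall>k\<in>{1..Z l}. \<forall>k'\<in>{1..Z l}.
             (LINT x|sphere_measure. Y l k x * Y l k' x) = (if k = k' then 1 else 0)) \<and>
          (\<forall>h. spherical_harmonic l h \<longrightarrow>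
             (\<exists>c. \<forall>x\<in>sphere 0 1. h x = (\<Sum>k=1..Z l. c k * Y l k x))))"

text \<open>The eigenvalue of minus the Laplace--Beltrami operator on the harmonics of degree l.\<close>

definition sphere_eigenvalue :: "nat \<Rightarrow> nat \<Rightarrow> real" where
  "sphere_eigenvalue d l = real l * (real l + real d - 1)"


section \<open>Sobolev spaces\<close>

text \<open>Below, Z and Y are the chosen orthonormal basis of spherical harmonics.\<close>

definition sobolev_term :: "nat \<Rightarrow> (nat \<Rightarrow> nat) \<Rightarrow> (nat \<Rightarrow> nat \<Rightarrow> 'a::euclidean_space \<Rightarrow> real) \<Rightarrow>
    real \<Rightarrow> (('a \<Rightarrow> real) \<Rightarrow> real) \<Rightarrow> nat \<Rightarrow> real" where
  "sobolev_term d Z Y s u l =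
     (1 + sphere_eigenvalue d l) powr s * (\<Sum>k=1..Z l. \<bar>u (Y l k)\<bar>\<^sup>2)"

definition sobolev_space :: "nat \<Rightarrow> (nat \<Rightarrow> nat) \<Rightarrow> (nat \<Rightarrow> nat \<Rightarrow> 'a::euclidean_space \<Rightarrow> real) \<Rightarrow>
    real \<Rightarrow> (('a \<Rightarrow> real) \<Rightarrow> real) set" where
  "sobolev_space d Z Y s = {u. sphere_distribution u \<and> summable (sobolev_term d Z Y s u)}"

text \<open>Only meaningful for members of the corresponding space, where the series converges.\<close>

definition sobolev_norm :: "nat \<Rightarrow> (nat \<Rightarrow> nat) \<Rightarrow> (nat \<Rightarrow> nat \<Rightarrow> 'a::euclidean_space \<Rightarrow> real) \<Rightarrow>
    real \<Rightarrow> (('a \<Rightarrow> real) \<Rightarrow> real) \<Rightarrow> real" where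
  "sobolev_norm d Z Y s u = sqrt (\<Sum>l. sobolev_term d Z Y s u l)"


section \<open>Heat filtered hyperinterpolation\<close>

definition heat_kernel :: "nat \<Rightarrow> (nat \<Rightarrow> nat) \<Rightarrow> (nat \<Rightarrow> nat \<Rightarrow> 'a::euclidean_space \<Rightarrow> real) \<Rightarrow>
    real \<Rightarrow> 'a \<Rightarrow> 'a \<Rightarrow> real" where
  "heat_kernel d Z Y n x y =
     (\<Sum>l. exp (- sphere_eigenvalue d l / n\<^sup>2) * (\<Sum>k=1..Z l. Y l k x * Y l k y))"

definition heat_hyperinterpolation ::
    "nat \<Rightarrow> (nat \<Rightarrow> nat) \<Rightarrow> (nat \<Rightarrow> nat \<Rightarrow> 'a::euclidean_space \<Rightarrow> real) \<Rightarrow>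
     nat \<Rightarrow> (nat \<Rightarrow> 'a) \<Rightarrow> (nat \<Rightarrow> real) \<Rightarrow> real \<Rightarrow> ('a \<Rightarrow> real) \<Rightarrow> 'a \<Rightarrow> real" where
  "heat_hyperinterpolation d Z Y m x w n f y =
     (\<Sum>j=1..m. w j * f (x j) * heat_kernel d Z Y n y (x j))"

end

theory Submission
  imports Defs "HOL-Probability.Probability_Measure"
begin

text \<open>
  The error f - F f splits into the smoothing error, which is diagonal in the spherical harmonics,
  and the heat flow of the distribution \<open>f \<nu>\<close>. The latter is controlled by the norm of \<open>f \<nu>\<close> in
  \<open>H\<^sup>-\<^sup>r\<close>: multiplication by a harmonic of degree l raises degrees by at most l, so it is bounded
  on \<open>H\<^sup>r\<close> by a multiple of \<open>(1 + \<lambda>\<^sub>l)\<^sup>r\<^sup>/\<^sup>2\<close> times its supremum, and the harmonic components of f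
  can be summed because s exceeds r + d/2.

  For the uniform bound the heat kernel is nonnegative by the minimum principle for the resolvent.
  Its moments against powers of 1 - x \<bullet> y solve a system of differential inequalities in time;
  together with the semigroup property they give polynomial off-diagonal decay at scale 1/n, and
  the quasi-uniform sum is then compared with an integral over disjoint caps.
\<close>

section \<open>Surface measure\<close>

text \<open>All facts on spherical harmonics come from three sources: rotation invariance of the
  surface measure, density of polynomials, and the angular derivatives x_a d_b - x_b d_a, which are
  tangential and antisymmetric for that measure. The growth of the multiplicities comes from a
  dimension count. The exponent hypotheses act at fixed places. The condition s - r > d/2 makes the
  sum of (1 + \<lambda>_l)^(r-s) Z_l finite, the Cauchy-Schwarz price for summing over the harmonic
  components of f. The condition s - q <= 2 reflects the saturation of the heat filter, since 1 -
  exp (-u) is of order u near 0. The scale n = \<delta>^(-r/(s+r)) balances n^-(s-q) against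
  \<delta>^r n^(r+q). In (iii) the moments bound the kernel only in the mean; the semigroup identity
  at half the time makes the bound pointwise. The power d + 1 of n^2 (1 - x . y) outweighs the
  d-dimensional volume growth of shells of width 1/n, and n \<delta> <= C3 keeps the decay profile
  comparable across a cap of radius of order \<delta>.\<close>

lemma emeasure_lborel_ball_pos_finite:
  "emeasure lborel (ball (0::'a::euclidean_space) 1) \<noteq> 0"
  "emeasure lborel (ball (0::'a::euclidean_space) 1) \<noteq> \<infinity>"
  using unit_ball_vol_pos[of "DIM('a)"] by (simp_all add: emeasure_ball less_le)

lemma nn_integral_lborel_plus:
  fixes c :: "'a::euclidean_space"
  assumes [measurable]: "g \<in> borel_measurable borel"
  shows "(\<integral>\<^sup>+ x. g (c + x) \<partial>lborel) = (\<integral>\<^sup>+ x. g x \<partial>lborel)"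
  by (subst (2) lborel_distr_plus[of c, symmetric], subst nn_integral_distr) auto

lemma nn_integral_lborel_reflect:
  fixes c :: "'a::euclidean_space"
  assumes [measurable]: "g \<in> borel_measurable borel"
  shows "(\<integral>\<^sup>+ x. g (c - x) \<partial>lborel) = (\<integral>\<^sup>+ x. g x \<partial>lborel)"
proof -
  have "lborel = density (distr lborel borel (\<lambda>x::'a. c + (-1) *\<^sub>R x)) (\<lambda>_. ennreal (\<bar>-1\<bar> ^ DIM('a)))"
    by (rule lborel_affine) auto
  then have *: "lborel = distr lborel borel (\<lambda>x::'a. c - x)" by (simp add: density_1)
  show ?thesis by (subst (2) *, subst nn_integral_distr) auto
qed

text \<open>Uniqueness of the translation-invariant measure: a Fubini computation shows that the image
  of the Lebesgue measure is a multiple of it, and the unit ball has the same measure for both.\<close>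

lemma distr_lborel_orthogonal:
  fixes f :: "'a::euclidean_space \<Rightarrow> 'a"
  assumes f: "orthogonal_transformation f"
  shows "distr lborel borel f = lborel"
proof (rule measure_eqI)
  show "sets (distr lborel borel f) = sets lborel" by simp
next
  fix B assume "B \<in> sets (distr lborel borel f)"
  then have B[measurable]: "B \<in> sets borel" by simp
  have lf: "linear f" and nf: "\<And>x. norm (f x) = norm x"
    using f by (auto simp: orthogonal_transformation)
  have cf[measurable]: "f \<in> borel_measurable borel"
    using lf by (intro borel_measurable_continuous_onI linear_continuous_on linear_conv_bounded_linear[THEN iffD1])
  define g where "g = (indicator B :: 'a \<Rightarrow> ennreal)"
  define h where "h = (indicator (ball 0 1) :: 'a \<Rightarrow> ennreal)"
  have [measurable]: "g \<in> borel_measurable borel" "h \<in> borel_measurable borel"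
    unfolding g_def h_def by (auto intro!: borel_measurable_indicator)
  have [measurable]: "f \<in> borel_measurable lborel" using cf by simp
  have hf: "h (f x) = h x" for x by (auto simp: h_def indicator_def nf)
  have "(\<integral>\<^sup>+x. g (f x) \<partial>lborel) * (\<integral>\<^sup>+y. h y \<partial>lborel) = (\<integral>\<^sup>+x. g (f x) * (\<integral>\<^sup>+y. h y \<partial>lborel) \<partial>lborel)"
    by (subst nn_integral_multc) auto
  also have "\<dots> = (\<integral>\<^sup>+x. g (f x) * (\<integral>\<^sup>+y. h (f x + y) \<partial>lborel) \<partial>lborel)"
    by (subst nn_integral_lborel_plus) auto
  also have "\<dots> = (\<integral>\<^sup>+x. (\<integral>\<^sup>+y. g (f x) * h (f x + y) \<partial>lborel) \<partial>lborel)"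
    by (intro nn_integral_cong, subst nn_integral_cmult) auto
  also have "\<dots> = (\<integral>\<^sup>+y. (\<integral>\<^sup>+x. g (f x) * h (f x + y) \<partial>lborel) \<partial>lborel)"
    by (rule lborel_pair.Fubini'[symmetric]) auto
  also have "\<dots> = (\<integral>\<^sup>+y. (\<integral>\<^sup>+x. g (f x - y) * h (f x) \<partial>lborel) \<partial>lborel)"
  proof (rule nn_integral_cong)
    fix y :: 'a
    \<comment> \<open>Linearity turns the shift of f x by y into a shift of x by a preimage c of y,
      so translation invariance moves y from h onto g.\<close>
    obtain c where c: "f c = y" using orthogonal_transformation_surj[OF f] by (metis surjD)
    have "(\<integral>\<^sup>+x. g (f x) * h (f x + y) \<partial>lborel) = (\<integral>\<^sup>+x. g (f (- c + x)) * h (f (- c + x) + y) \<partial>lborel)"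
      by (rule nn_integral_lborel_plus[symmetric]) auto
    also have "\<dots> = (\<integral>\<^sup>+x. g (f x - y) * h (f x) \<partial>lborel)"
      by (simp add: linear_diff[OF lf] c)
    finally show "(\<integral>\<^sup>+x. g (f x) * h (f x + y) \<partial>lborel) = (\<integral>\<^sup>+x. g (f x - y) * h (f x) \<partial>lborel)" .
  qed
  also have "\<dots> = (\<integral>\<^sup>+x. (\<integral>\<^sup>+y. g (f x - y) * h (f x) \<partial>lborel) \<partial>lborel)"
    by (rule lborel_pair.Fubini') auto
  also have "\<dots> = (\<integral>\<^sup>+x. (\<integral>\<^sup>+y. g y \<partial>lborel) * h x \<partial>lborel)"
  proof (rule nn_integral_cong)
    fix x :: 'a
    have "(\<integral>\<^sup>+y. g (f x - y) * h (f x) \<partial>lborel) = (\<integral>\<^sup>+y. g (f x - y) \<partial>lborel) * h (f x)"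
      by (rule nn_integral_multc) auto
    then show "(\<integral>\<^sup>+y. g (f x - y) * h (f x) \<partial>lborel) = (\<integral>\<^sup>+y. g y \<partial>lborel) * h x"
      by (subst nn_integral_lborel_reflect[symmetric, of g "f x"]) (auto simp: hf)
  qed
  also have "\<dots> = (\<integral>\<^sup>+y. g y \<partial>lborel) * (\<integral>\<^sup>+y. h y \<partial>lborel)"
    by (rule nn_integral_cmult) auto
  finally have eq: "(\<integral>\<^sup>+x. g (f x) \<partial>lborel) * (\<integral>\<^sup>+y. h y \<partial>lborel) = (\<integral>\<^sup>+y. g y \<partial>lborel) * (\<integral>\<^sup>+y. h y \<partial>lborel)" .
  have hb: "(\<integral>\<^sup>+y. h y \<partial>lborel) = emeasure lborel (ball (0::'a) 1)"
    unfolding h_def by simp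
  have "(\<integral>\<^sup>+x. g (f x) \<partial>lborel) = (\<integral>\<^sup>+y. g y \<partial>lborel)"
    using eq emeasure_lborel_ball_pos_finite[where 'a='a] unfolding hb
    by (simp add: ennreal_mult_cancel_left mult.commute[of _ "emeasure lborel (ball (0::'a) 1)"])
  moreover have "(\<integral>\<^sup>+x. g (f x) \<partial>lborel) = (\<integral>\<^sup>+x. g x \<partial>(distr lborel borel f))"
    by (subst nn_integral_distr) auto
  ultimately show "emeasure (distr lborel borel f) B = emeasure lborel B"
    unfolding g_def by simp
qed

lemma space_sphere_measure [simp]: "space sphere_measure = sphere (0::'a::euclidean_space) 1"
  by (simp add: sphere_measure_def space_restrict_space)

lemma sets_sphere_measure: "sets sphere_measure = sets (restrict_space borel (sphere (0::'a::euclidean_space) 1))"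
  unfolding sphere_measure_def by (rule sets_restrict_space_cong) simp

lemma sets_sphere_measure_iff:
  "A \<in> sets sphere_measure \<longleftrightarrow> A \<in> sets borel \<and> A \<subseteq> sphere (0::'a::euclidean_space) 1"
  unfolding sets_sphere_measure by (subst sets_restrict_space_iff) auto

lemma emeasure_sphere_measure:
  assumes "A \<in> sets borel" "A \<subseteq> sphere (0::'a::euclidean_space) 1"
  shows "emeasure sphere_measure A = emeasure lborel (ball 0 1 \<inter> sgn -` A) / emeasure lborel (ball (0::'a) 1)"
proof -
  have "emeasure sphere_measure A = emeasure (distr (uniform_measure lborel (ball 0 1)) borel sgn) A"
    unfolding sphere_measure_def by (rule emeasure_restrict_space) (use assms in auto)
  also have "\<dots> = emeasure (uniform_measure lborel (ball 0 1)) (sgn -` A)"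
    using assms by (subst emeasure_distr) auto
  also have "\<dots> = emeasure lborel (ball 0 1 \<inter> sgn -` A) / emeasure lborel (ball (0::'a) 1)"
    using assms measurable_sets[OF borel_measurable_sgn, of A] by (subst emeasure_uniform_measure) auto
  finally show ?thesis .
qed

lemma prob_space_sphere_measure: "prob_space (sphere_measure :: 'a::euclidean_space measure)"
proof
  \<comment> \<open>\<open>sgn 0 = 0\<close> lies off the sphere, so the cone over the whole sphere
    is the ball without its centre, and the centre is a null set.\<close>
  have "ball (0::'a) 1 \<inter> sgn -` sphere 0 1 = ball 0 1 - {0}"
    by (auto simp: norm_sgn)
  moreover have "emeasure lborel (ball (0::'a) 1 - {0}) = emeasure lborel (ball (0::'a) 1)"
    by (rule emeasure_Diff_null_set) (auto intro: countable_imp_null_set_lborel)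
  ultimately show "emeasure sphere_measure (space (sphere_measure::'a measure)) = 1"
    using emeasure_lborel_ball_pos_finite[where 'a='a]
    by (simp add: emeasure_sphere_measure ennreal_divide_self less_top)
qed

lemma orthogonal_measurable_sphere:
  assumes "orthogonal_transformation (f::'a::euclidean_space \<Rightarrow> 'a)"
  shows "f \<in> measurable sphere_measure sphere_measure" "f \<in> borel_measurable borel"
proof -
  have lf: "linear f" and nf: "\<And>x. norm (f x) = norm x"
    using assms by (auto simp: orthogonal_transformation)
  show *: "f \<in> borel_measurable borel"
    using lf by (intro borel_measurable_continuous_onI linear_continuous_on linear_conv_bounded_linear[THEN iffD1])
  show "f \<in> measurable sphere_measure sphere_measure"
  proof (rule measurableI)
    fix A :: "'a set" assume "A \<in> sets sphere_measure"
    then show "f -` A \<inter> space sphere_measure \<in> sets sphere_measure"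
      using measurable_sets[OF *, of A] by (auto simp: sets_sphere_measure_iff)
  qed (auto simp: nf)
qed

text \<open>An orthogonal map commutes with \<open>sgn\<close>, so it maps cones to cones, and it
  preserves both the unit ball and the Lebesgue measure.\<close>

lemma distr_sphere_measure_orthogonal:
  assumes f: "orthogonal_transformation (f::'a::euclidean_space \<Rightarrow> 'a)"
  shows "distr sphere_measure sphere_measure f = sphere_measure"
proof (rule measure_eqI)
  fix A assume "A \<in> sets (distr sphere_measure sphere_measure f)"
  then have A: "A \<in> sets borel" "A \<subseteq> sphere 0 1" "A \<in> sets sphere_measure" by (auto simp: sets_sphere_measure_iff)
  have lf: "linear f" and nf: "\<And>x. norm (f x) = norm x"
    using f by (auto simp: orthogonal_transformation)
  note [measurable] = orthogonal_measurable_sphere[OF f] A(1)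
  have fs: "f (sgn x) = sgn (f x)" for x by (simp add: sgn_div_norm nf linear_cmul[OF lf])
  have sA[measurable]: "sgn -` A \<in> sets borel" using measurable_sets[OF borel_measurable_sgn A(1)] by simp
  have B: "f -` A \<inter> sphere 0 1 \<in> sets borel" using measurable_sets[OF orthogonal_measurable_sphere(2)[OF f] A(1)] by auto
  have "emeasure (distr sphere_measure sphere_measure f) A = emeasure sphere_measure (f -` A \<inter> sphere 0 1)"
    using A by (subst emeasure_distr) auto
  also have "\<dots> = emeasure lborel (ball 0 1 \<inter> sgn -` (f -` A \<inter> sphere 0 1)) / emeasure lborel (ball (0::'a) 1)"
    using B by (subst emeasure_sphere_measure) auto
  also have "ball 0 1 \<inter> sgn -` (f -` A \<inter> sphere 0 1) = f -` (ball 0 1 \<inter> sgn -` A) \<inter> space lborel"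
  proof -
    have "norm (f (sgn x)) = norm (sgn x)" for x by (simp add: nf)
    then show ?thesis using A(2) by (auto simp: fs nf)
  qed
  also have "emeasure lborel (f -` (ball 0 1 \<inter> sgn -` A) \<inter> space lborel) = emeasure (distr lborel borel f) (ball 0 1 \<inter> sgn -` A)"
    by (subst emeasure_distr) auto
  also have "\<dots> = emeasure lborel (ball 0 1 \<inter> sgn -` A)" by (simp add: distr_lborel_orthogonal[OF f])
  also have "\<dots> / emeasure lborel (ball (0::'a) 1) = emeasure sphere_measure A"
    using A by (subst emeasure_sphere_measure) auto
  finally show "emeasure (distr sphere_measure sphere_measure f) A = emeasure sphere_measure A" .
qed simp

lemma integral_sphere_orthogonal:
  fixes g :: "'a::euclidean_space \<Rightarrow> real"
  assumes f: "orthogonal_transformation (f::'a \<Rightarrow> 'a)" and g: "g \<in> borel_measurable sphere_measure"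
  shows "(LINT x|sphere_measure. g (f x)) = (LINT x|sphere_measure. g x)"
  by (subst (2) distr_sphere_measure_orthogonal[OF f, symmetric], subst integral_distr)
     (use orthogonal_measurable_sphere[OF f] g in auto)

lemma borel_measurable_sphere_continuous:
  fixes g :: "'a::euclidean_space \<Rightarrow> real"
  assumes "continuous_on (sphere 0 1) g"
  shows "g \<in> borel_measurable sphere_measure"
proof -
  have "g \<in> borel_measurable (restrict_space borel (sphere 0 1))"
    using assms by (rule borel_measurable_continuous_on_restrict)
  then show ?thesis by (simp cong: measurable_cong_sets[OF sets_sphere_measure])
qed

lemma bounded_sphere_continuous:
  fixes g :: "'a::euclidean_space \<Rightarrow> real"
  assumes "continuous_on (sphere 0 1) g"
  obtains B where "B > 0" "\<And>x. x \<in> sphere 0 1 \<Longrightarrow> \<bar>g x\<bar> \<le> B"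
proof -
  have "bounded (g ` sphere 0 1)"
    by (intro compact_imp_bounded compact_continuous_image assms) auto
  then show ?thesis unfolding bounded_pos using that by auto
qed

lemma integrable_sphere_continuous:
  fixes g :: "'a::euclidean_space \<Rightarrow> real"
  assumes "continuous_on (sphere 0 1) g"
  shows "integrable sphere_measure g"
proof -
  interpret prob_space "sphere_measure :: 'a measure" by (rule prob_space_sphere_measure)
  obtain B where "B > 0" "\<And>x. x \<in> sphere 0 1 \<Longrightarrow> \<bar>g x\<bar> \<le> B"
    using bounded_sphere_continuous[OF assms] by blast
  then show ?thesis
    by (intro integrable_const_bound[where B=B] borel_measurable_sphere_continuous assms AE_I2) auto
qed

lemma orthogonal_transformation_unit_vectors:
  fixes y e :: "'a::euclidean_space"
  assumes "norm y = 1" "norm e = 1"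
  obtains f where "orthogonal_transformation f" "f y = e"
proof (cases "y = e")
  case True then show ?thesis using that[of id] by (simp add: orthogonal_transformation_def linear_id)
next
  case False
  define v where "v = y - e"
  \<comment> \<open>Reflection in the hyperplane orthogonal to y - e, which swaps the unit vectors y
    and e.\<close>
  define R where "R = (\<lambda>z. z - (2 * (z \<bullet> v) / (v \<bullet> v)) *\<^sub>R v)"
  have v0: "v \<bullet> v \<noteq> 0" using False by (simp add: v_def)
  have l: "linear R" unfolding R_def
    by (rule linearI) (simp_all add: scaleR_add_left inner_add_left add_divide_distrib distrib_left scaleR_diff_right)
  have "R z \<bullet> R w = z \<bullet> w" for z w
  proof -
    have "R z \<bullet> R w = z \<bullet> w - 2 * (w \<bullet> v) / (v \<bullet> v) * (z \<bullet> v) - 2 * (z \<bullet> v) / (v \<bullet> v) * (w \<bullet> v)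
        + 2 * (z \<bullet> v) / (v \<bullet> v) * (2 * (w \<bullet> v) / (v \<bullet> v)) * (v \<bullet> v)"
      by (simp add: R_def inner_diff_left inner_diff_right inner_commute[of v w])
    also have "\<dots> = z \<bullet> w" using v0 by (simp add: field_simps)
    finally show ?thesis .
  qed
  moreover have "R y = e"
  proof -
    have yy: "y \<bullet> y = 1" "e \<bullet> e = 1" using assms by (simp_all add: dot_square_norm)
    have "v \<bullet> v = 2 * (y \<bullet> v)" unfolding v_def using yy by (simp add: inner_diff_left inner_diff_right inner_commute)
    then have "2 * (y \<bullet> v) / (v \<bullet> v) = 1" using v0 by (metis divide_self)
    then have "R y = y - 1 *\<^sub>R v" unfolding R_def by (simp only:)
    then show ?thesis by (simp add: v_def)
  qed
  ultimately show ?thesis using that[of R] l by (auto simp: orthogonal_transformation_def)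
qed


section \<open>Volume of spherical caps\<close>

lemma measure_sphere_cap_orthogonal:
  fixes y e :: "'a::euclidean_space"
  assumes "norm y = 1" "norm e = 1"
  shows "measure sphere_measure (sphere 0 1 \<inter> cball y R) = measure sphere_measure (sphere 0 1 \<inter> cball e R)"
proof -
  obtain f where f: "orthogonal_transformation f" "f y = e"
    using orthogonal_transformation_unit_vectors[OF assms] .
  have lf: "linear f" and nf: "\<And>x. norm (f x) = norm x"
    using f by (auto simp: orthogonal_transformation)
  have "dist e (f x) = dist y x" for x
    by (metis dist_norm f(2) lf linear_diff nf)
  then have "f -` (sphere 0 1 \<inter> cball e R) \<inter> space sphere_measure = sphere 0 1 \<inter> cball y R"
    by (auto simp: nf)
  moreover have "measure (distr sphere_measure sphere_measure f) (sphere 0 1 \<inter> cball e R)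
      = measure sphere_measure (f -` (sphere 0 1 \<inter> cball e R) \<inter> space sphere_measure)"
    by (rule measure_distr) (use orthogonal_measurable_sphere[OF f(1)] in \<open>auto simp: sets_sphere_measure_iff\<close>)
  ultimately show ?thesis by (simp add: distr_sphere_measure_orthogonal[OF f(1)])
qed

lemma measure_sphere_measure:
  assumes "A \<in> sets borel" "A \<subseteq> sphere (0::'a::euclidean_space) 1"
  shows "measure sphere_measure A = measure lborel (ball 0 1 \<inter> sgn -` A) / measure lborel (ball (0::'a) 1)"
proof -
  have A: "emeasure lborel (ball 0 1 \<inter> sgn -` A) \<noteq> \<infinity>"
    using emeasure_mono[of "ball 0 1 \<inter> sgn -` A" "ball 0 1" lborel] emeasure_lborel_ball_pos_finite(2)[where 'a='a]
    by (metis borel_open inf_le1 infinity_ennreal_def neq_top_trans open_ball sets_lborel)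
  show ?thesis
    by (subst measure_def, subst emeasure_sphere_measure[OF assms],
        subst (1 2) emeasure_eq_ennreal_measure)
       (use A emeasure_lborel_ball_pos_finite[where 'a='a] content_ball_pos[of 1 "0::'a"] in
         \<open>auto simp: divide_ennreal\<close>)
qed

text \<open>After a rotation the centre is a basis vector e. A point x of the cone has norm below 1,
  so its coordinates transversal to e are at most those of \<open>sgn x\<close>, hence at most R in
  absolute value; the cone fits into a box with one side 2 and all others 2 R.\<close>

lemma sphere_cap_measure_upper:
  "\<exists>K>0. \<forall>y\<in>sphere (0::'a::euclidean_space) 1. \<forall>R>0.
     measure sphere_measure (sphere 0 1 \<inter> cball y R) \<le> K * R ^ (DIM('a) - 1)"
proof -
  obtain e :: 'a where e: "e \<in> Basis" using nonempty_Basis by blast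
  define B where "B = measure lborel (ball (0::'a) 1)"
  have B: "B > 0" unfolding B_def by (simp add: content_ball_pos)
  have "measure sphere_measure (sphere 0 1 \<inter> cball y R) \<le> 2 ^ DIM('a) / B * R ^ (DIM('a) - 1)"
    if y: "y \<in> sphere (0::'a) 1" and R: "R > 0" for y R
  proof -
    define v where "v = (\<Sum>b\<in>Basis. (if b = e then 1 else R) *\<^sub>R b)"
    have vb: "v \<bullet> b = (if b = e then 1 else R)" if "b \<in> Basis" for b
      using that by (simp add: v_def)
    have sub: "ball 0 1 \<inter> sgn -` (sphere 0 1 \<inter> cball e R) \<subseteq> cbox (- v) v"
    proof
      fix x assume "x \<in> ball 0 1 \<inter> sgn -` (sphere 0 1 \<inter> cball e R)"
      then have x: "norm x < 1" "norm (e - sgn x) \<le> R" by (auto simp: dist_norm)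
      have "\<bar>x \<bullet> b\<bar> \<le> v \<bullet> b" if b: "b \<in> Basis" for b
      proof (cases "b = e")
        case True
        have "\<bar>x \<bullet> b\<bar> \<le> norm x" using b by (rule Basis_le_norm)
        then show ?thesis using True x vb[OF b] by simp
      next
        case False
        have "\<bar>(e - sgn x) \<bullet> b\<bar> \<le> R" using Basis_le_norm[OF b, of "e - sgn x"] x by simp
        moreover have "(e - sgn x) \<bullet> b = - (x \<bullet> b) / norm x"
          using False e b by (simp add: inner_diff_left inner_Basis sgn_div_norm divide_inverse)
        ultimately have "\<bar>x \<bullet> b\<bar> / norm x \<le> R" by simp
        moreover have "\<bar>x \<bullet> b\<bar> \<le> \<bar>x \<bullet> b\<bar> / norm x" if "x \<noteq> 0"
          using x that mult_right_mono[of "norm x" 1 "\<bar>x \<bullet> b\<bar>"] by (simp add: field_simps)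
        ultimately show ?thesis using vb[OF b] False R by (cases "x = 0") auto
      qed
      then show "x \<in> cbox (- v) v" by (force simp: mem_box abs_le_iff)
    qed
    have "measure lborel (ball 0 1 \<inter> sgn -` (sphere 0 1 \<inter> cball e R)) \<le> measure lborel (cbox (- v) v)"
      by (rule measure_mono_fmeasurable[OF sub])
         (use measurable_sets_borel[OF borel_measurable_sgn, of "sphere 0 1 \<inter> cball e R"] in auto)
    also have "\<dots> = (\<Prod>b\<in>Basis. 2 * (if b = e then 1 else R))"
    proof -
      have "\<forall>b\<in>Basis. (- v) \<bullet> b \<le> v \<bullet> b" using vb R by auto
      then show ?thesis by (subst measure_lborel_cbox_eq) (auto simp: vb inner_diff_left inner_add_left intro!: prod.cong)
    qed
    also have "\<dots> = 2 ^ DIM('a) * R ^ (DIM('a) - 1)"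
      using e by (subst prod.distrib, subst (2) prod.remove[of _ e]) (auto simp: prod.If_cases card_Diff_singleton)
    finally have "measure lborel (ball 0 1 \<inter> sgn -` (sphere 0 1 \<inter> cball e R)) / B \<le> 2 ^ DIM('a) * R ^ (DIM('a) - 1) / B"
      using B by (simp add: divide_right_mono)
    then show ?thesis using y e unfolding B_def
      by (subst measure_sphere_cap_orthogonal[of y e]) (auto simp: measure_sphere_measure)
  qed
  then show ?thesis using B by (intro exI[of _ "2 ^ DIM('a) / B"]) auto
qed

text \<open>The cone over the cap contains a box whose side along e is [1/4, 1/2] and whose other
  sides are proportional to R.\<close>

lemma sphere_cap_measure_lower:
  "\<exists>c>0. \<forall>y\<in>sphere (0::'a::euclidean_space) 1. \<forall>R. 0 < R \<and> R \<le> 1 \<longrightarrow>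
     c * R ^ (DIM('a) - 1) \<le> measure sphere_measure (sphere 0 1 \<inter> cball y R)"
proof -
  obtain e :: 'a where e: "e \<in> Basis" using nonempty_Basis by blast
  define B where "B = measure lborel (ball (0::'a) 1)"
  have B: "B > 0" unfolding B_def by (simp add: content_ball_pos)
  define D where "D = real DIM('a)"
  have D: "D \<ge> 1" unfolding D_def using DIM_positive[where 'a='a] by linarith
  have "(1/4) * (1 / (4 * D)) ^ (DIM('a) - 1) / B * R ^ (DIM('a) - 1) \<le> measure sphere_measure (sphere 0 1 \<inter> cball y R)"
    if y: "y \<in> sphere (0::'a) 1" and R: "0 < R" "R \<le> 1" for y R
  proof -
    \<comment> \<open>With D coordinates the transversal part z of x has norm at most D \<rho> =
      R/8. The vector |x| e - x then has norm at most 2 |z| <= R/4, and division by |x| >= 1/4 puts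
      \<open>sgn x\<close> within distance R of e.\<close>
    define \<rho> where "\<rho> = R / (8 * D)"
    have \<rho>: "\<rho> > 0" "D * \<rho> = R / 8" using R D by (auto simp: \<rho>_def)
    define u where "u = (\<Sum>b\<in>Basis. (if b = e then 1/4 else - \<rho>) *\<^sub>R b)"
    define v where "v = (\<Sum>b\<in>Basis. (if b = e then 1/2 else \<rho>) *\<^sub>R b)"
    have ub: "u \<bullet> b = (if b = e then 1/4 else - \<rho>)" if "b \<in> Basis" for b
      using that by (simp add: u_def)
    have vb: "v \<bullet> b = (if b = e then 1/2 else \<rho>)" if "b \<in> Basis" for b
      using that by (simp add: v_def)
    have sub: "cbox u v \<subseteq> ball 0 1 \<inter> sgn -` (sphere 0 1 \<inter> cball e R)"
    proof
      fix x assume x: "x \<in> cbox u v"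
      define t where "t = x \<bullet> e"
      define z where "z = x - t *\<^sub>R e"
      have t: "1/4 \<le> t" "t \<le> 1/2" using x e ub[OF e] vb[OF e] by (auto simp: mem_box t_def)
      have "norm z \<le> (\<Sum>b\<in>Basis. \<bar>z \<bullet> b\<bar>)" by (rule norm_le_l1)
      also have "\<dots> \<le> (\<Sum>b\<in>(Basis::'a set). \<rho>)"
      proof (rule sum_mono)
        fix b :: 'a assume b: "b \<in> Basis"
        show "\<bar>z \<bullet> b\<bar> \<le> \<rho>"
        proof (cases "b = e")
          case True then show ?thesis using \<rho> e by (simp add: z_def t_def inner_diff_left)
        next
          case False then show ?thesis using b e x ub[OF b] vb[OF b]
            by (auto simp: z_def inner_diff_left inner_Basis mem_box abs_le_iff dest!: bspec[OF _ b])
        qed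
      qed
      also have "\<dots> = R / 8" using \<rho> by (simp add: D_def)
      finally have z: "norm z \<le> R / 8" .
      have xz: "x = t *\<^sub>R e + z" by (simp add: z_def)
      have ne: "norm e = 1" using e by simp
      have "norm x \<le> t + norm z" using norm_triangle_ineq[of "t *\<^sub>R e" z] t ne by (simp add: xz[symmetric])
      then have n1: "norm x < 1" using t z R by linarith
      have n2: "1/4 \<le> norm x" using Basis_le_norm[OF e, of x] t by (simp add: t_def)
      then have x0: "x \<noteq> 0" by auto
      have tn: "\<bar>t - norm x\<bar> \<le> norm z"
        using norm_triangle_ineq3[of "t *\<^sub>R e" x] t ne by (simp add: z_def norm_minus_commute)
      have "norm x * norm (e - sgn x) = norm (norm x *\<^sub>R e - x)"
      proof -
        have "norm x *\<^sub>R (e - sgn x) = norm x *\<^sub>R e - x" using x0 by (simp add: scaleR_diff_right sgn_div_norm)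
        then show ?thesis by (metis norm_scaleR abs_norm_cancel)
      qed
      also have "\<dots> = norm ((norm x - t) *\<^sub>R e - z)" by (simp add: z_def algebra_simps)
      also have "\<dots> \<le> \<bar>norm x - t\<bar> + norm z" using norm_triangle_ineq4[of "(norm x - t) *\<^sub>R e" z] ne by simp
      also have "\<dots> \<le> R / 4" using tn z by linarith
      finally have "norm x * norm (e - sgn x) \<le> R / 4" .
      moreover have "1/4 * norm (e - sgn x) \<le> norm x * norm (e - sgn x)"
        using n2 by (intro mult_right_mono) auto
      ultimately have "norm (e - sgn x) \<le> R" by linarith
      then show "x \<in> ball 0 1 \<inter> sgn -` (sphere 0 1 \<inter> cball e R)"
        using n1 x0 by (auto simp: dist_norm norm_sgn)
    qed
    have "(1/4) * (R / (4 * D)) ^ (DIM('a) - 1) = (\<Prod>b\<in>Basis. (if b = e then 1/4 else 2 * \<rho>))"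
      using e by (subst prod.remove[of _ e]) (auto simp: prod.If_cases card_Diff_singleton \<rho>_def)
    also have "\<dots> = measure lborel (cbox u v)"
    proof -
      have "\<forall>b\<in>Basis. u \<bullet> b \<le> v \<bullet> b" using vb ub \<rho> by auto
      then show ?thesis by (subst measure_lborel_cbox_eq) (auto simp: vb ub inner_diff_left intro!: prod.cong)
    qed
    also have "\<dots> \<le> measure lborel (ball 0 1 \<inter> sgn -` (sphere 0 1 \<inter> cball e R))"
    proof (rule measure_mono_fmeasurable[OF sub])
      have "sgn -` (sphere 0 1 \<inter> cball e R) \<in> sets borel"
        by (rule measurable_sets_borel[OF borel_measurable_sgn]) auto
      then have S: "ball 0 1 \<inter> sgn -` (sphere 0 1 \<inter> cball e R) \<in> sets lborel" by simp
      have "ball (0::'a) 1 \<in> fmeasurable lborel"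
        using emeasure_lborel_ball_finite[of "0::'a" 1] by (intro fmeasurableI) simp_all
      then show "ball 0 1 \<inter> sgn -` (sphere 0 1 \<inter> cball e R) \<in> fmeasurable lborel"
        by (rule fmeasurableI2[OF _ Int_lower1 S])
    qed simp
    finally have "(1/4) * (R / (4 * D)) ^ (DIM('a) - 1) / B \<le> measure lborel (ball 0 1 \<inter> sgn -` (sphere 0 1 \<inter> cball e R)) / B"
      by (rule divide_right_mono) (use B in simp)
    then show ?thesis using y e unfolding B_def
      by (subst measure_sphere_cap_orthogonal[of y e]) (auto simp: measure_sphere_measure power_divide)
  qed
  moreover have "(1/4) * (1 / (4 * D)) ^ (DIM('a) - 1) / B > 0" using B D by simp
  ultimately show ?thesis by blast
qed

text \<open>If f y were positive, f would exceed f y / 2 on a small cap around y, and caps have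
  positive measure.\<close>

lemma continuous_nonneg_integral_0:
  fixes f :: "'a::euclidean_space \<Rightarrow> real"
  assumes f: "continuous_on (sphere 0 1) f" and pos: "\<And>x. x \<in> sphere 0 1 \<Longrightarrow> f x \<ge> 0"
    and int: "(LINT x|sphere_measure. f x) \<le> 0" and y: "y \<in> sphere 0 1"
  shows "f y = 0"
proof (rule ccontr)
  interpret prob_space "sphere_measure :: 'a measure" by (rule prob_space_sphere_measure)
  assume "f y \<noteq> 0"
  then have fy: "f y > 0" using pos[OF y] by simp
  obtain r where r: "r > 0" "\<And>x. x \<in> sphere 0 1 \<Longrightarrow> dist x y < r \<Longrightarrow> dist (f x) (f y) < f y / 2"
    using f y fy unfolding continuous_on_iff by (meson half_gt_zero)
  define R where "R = min 1 (r / 2)"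
  have R: "0 < R" "R \<le> 1" "R < r" using r by (auto simp: R_def)
  obtain c where c: "c > 0" "c * R ^ (DIM('a) - 1) \<le> measure sphere_measure (sphere 0 1 \<inter> cball y R)"
    using sphere_cap_measure_lower[where 'a='a] R y by blast
  let ?C = "sphere 0 1 \<inter> cball y R"
  have C: "?C \<in> sets sphere_measure" by (auto simp: sets_sphere_measure_iff)
  have "f y / 2 * measure sphere_measure ?C = (LINT x|sphere_measure. f y / 2 * indicator ?C x)"
    using C by (simp add: Int_ac)
  also have "\<dots> \<le> (LINT x|sphere_measure. f x)"
  proof (rule integral_mono)
    show "integrable sphere_measure (\<lambda>x. f y / 2 * indicator ?C x)"
      using C by (auto intro!: integrable_mult_right integrable_real_indicator simp: less_top[symmetric])
    show "integrable sphere_measure f" using f by (rule integrable_sphere_continuous)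
    fix x assume "x \<in> space (sphere_measure :: 'a measure)"
    then have x: "x \<in> sphere 0 1" by simp
    have "f y / 2 \<le> f x" if "x \<in> cball y R"
    proof -
      have "dist x y < r" using that R by (simp add: dist_commute)
      then have "\<bar>f x - f y\<bar> < f y / 2" using r(2)[OF x] by (simp add: dist_real_def)
      then show ?thesis by linarith
    qed
    then show "f y / 2 * indicator ?C x \<le> f x"
      using pos[OF x] by (auto simp: indicator_def)
  qed
  finally have "f y / 2 * measure sphere_measure ?C \<le> 0" using int by linarith
  then have "measure sphere_measure ?C \<le> 0" using fy by (simp add: mult_le_0_iff)
  moreover have "c * R ^ (DIM('a) - 1) > 0" using c R by simp
  ultimately show False using c by linarith
qed

section \<open>Polynomials and spherical harmonics\<close>

lemma rp_linear: "bounded_linear f \<Longrightarrow> real_polynomial_function f"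
  and rp_const: "real_polynomial_function (\<lambda>x. c)"
  and rp_add: "real_polynomial_function f \<Longrightarrow> real_polynomial_function g \<Longrightarrow> real_polynomial_function (\<lambda>x. f x + g x)"
  and rp_mult: "real_polynomial_function f \<Longrightarrow> real_polynomial_function g \<Longrightarrow> real_polynomial_function (\<lambda>x. f x * g x)"
  by (fact real_polynomial_function.intros)+

lemma rp_differentiable: "real_polynomial_function p \<Longrightarrow> p differentiable at x"
  by (rule differentiable_at_real_polynomial_function)

lemma rp_has_derivative:
  "real_polynomial_function p \<Longrightarrow> (p has_derivative frechet_derivative p (at x)) (at x)"
  using rp_differentiable frechet_derivative_works by blast

lemma partial_deriv_unique:
  "(\<And>x. (p has_derivative D x) (at x)) \<Longrightarrow> partial_deriv b p = (\<lambda>x. D x b)"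
  unfolding partial_deriv_def by (rule ext) (metis frechet_derivative_at)

lemma partial_deriv_const [simp]: "partial_deriv b (\<lambda>x. c) = (\<lambda>x. 0)"
  by (rule partial_deriv_unique) (rule has_derivative_const)

lemma partial_deriv_linear: "bounded_linear f \<Longrightarrow> partial_deriv b f = (\<lambda>x. f b)"
  by (rule partial_deriv_unique) (rule bounded_linear_imp_has_derivative)

lemma partial_deriv_inner [simp]: "partial_deriv b (\<lambda>x. x \<bullet> c) = (\<lambda>x. b \<bullet> c)"
  by (rule partial_deriv_linear) (rule bounded_linear_inner_left)

lemma partial_deriv_add:
  assumes "real_polynomial_function p" "real_polynomial_function q"
  shows "partial_deriv b (\<lambda>x. p x + q x) = (\<lambda>x. partial_deriv b p x + partial_deriv b q x)"
proof -
  have "partial_deriv b (\<lambda>x. p x + q x) = (\<lambda>x. frechet_derivative p (at x) b + frechet_derivative q (at x) b)"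
    using assms by (intro partial_deriv_unique has_derivative_add rp_has_derivative)
  then show ?thesis by (simp add: partial_deriv_def)
qed

lemma partial_deriv_diff:
  assumes "real_polynomial_function p" "real_polynomial_function q"
  shows "partial_deriv b (\<lambda>x. p x - q x) = (\<lambda>x. partial_deriv b p x - partial_deriv b q x)"
proof -
  have "partial_deriv b (\<lambda>x. p x - q x) = (\<lambda>x. frechet_derivative p (at x) b - frechet_derivative q (at x) b)"
    using assms by (intro partial_deriv_unique has_derivative_diff rp_has_derivative)
  then show ?thesis by (simp add: partial_deriv_def)
qed

lemma partial_deriv_mult:
  assumes "real_polynomial_function p" "real_polynomial_function q"
  shows "partial_deriv b (\<lambda>x. p x * q x) = (\<lambda>x. p x * partial_deriv b q x + partial_deriv b p x * q x)"
proof -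
  have "partial_deriv b (\<lambda>x. p x * q x) = (\<lambda>x. p x * frechet_derivative q (at x) b + frechet_derivative p (at x) b * q x)"
    using assms by (intro partial_deriv_unique has_derivative_mult rp_has_derivative)
  then show ?thesis by (simp add: partial_deriv_def)
qed

lemma partial_deriv_cmult:
  assumes "real_polynomial_function p"
  shows "partial_deriv b (\<lambda>x. c * p x) = (\<lambda>x. c * partial_deriv b p x)"
  using partial_deriv_mult[OF rp_const assms, of b c] by simp

lemma rp_partial_deriv:
  "real_polynomial_function p \<Longrightarrow> real_polynomial_function (partial_deriv b p)"
proof (induction rule: real_polynomial_function.induct)
  case (linear f) then show ?case by (simp add: partial_deriv_linear rp_const)
next
  case (const c) then show ?case by (simp add: rp_const)
next
  case (add f g) then show ?case by (simp add: partial_deriv_add rp_add)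
next
  case (mult f g) then show ?case
    by (simp add: partial_deriv_mult rp_add rp_mult)
qed

lemma rp_inner: "real_polynomial_function (\<lambda>x. x \<bullet> c)"
  by (rule rp_linear) (rule bounded_linear_inner_left)

lemma rp_cmult: "real_polynomial_function p \<Longrightarrow> real_polynomial_function (\<lambda>x. c * p x)"
  by (rule rp_mult[OF rp_const])

lemma rp_sum: "(\<And>i. i \<in> I \<Longrightarrow> real_polynomial_function (f i)) \<Longrightarrow> real_polynomial_function (\<lambda>x. \<Sum>i\<in>I. f i x)"
  by (induction I rule: infinite_finite_induct) (auto intro: real_polynomial_function.intros)

lemma rp_continuous: "real_polynomial_function p \<Longrightarrow> continuous_on S p"
  by (simp add: differentiable_imp_continuous_on differentiable_on_real_polynomial_function)

lemmas rp_intros = rp_add rp_mult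
  rp_const rp_inner rp_partial_deriv real_polynomial_function_diff
  real_polynomial_function_power real_polynomial_function_minus

lemma partial_deriv_sum:
  "(\<And>i. i \<in> I \<Longrightarrow> real_polynomial_function (f i)) \<Longrightarrow>
    partial_deriv b (\<lambda>x. \<Sum>i\<in>I. f i x) = (\<lambda>x. \<Sum>i\<in>I. partial_deriv b (f i) x)"
proof (induction I rule: infinite_finite_induct)
  case (insert i I)
  then have "partial_deriv b (\<lambda>x. f i x + (\<Sum>i\<in>I. f i x)) = (\<lambda>x. partial_deriv b (f i) x + partial_deriv b (\<lambda>x. \<Sum>i\<in>I. f i x) x)"
    by (intro partial_deriv_add rp_sum) auto
  with insert show ?case by simp
qed auto

lemma laplacian_eq: "laplacian p x = (\<Sum>b\<in>Basis. partial_deriv b (partial_deriv b p) x)"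
  by (simp add: laplacian_def iter_partial_def)

lemma laplacian_add:
  "real_polynomial_function p \<Longrightarrow> real_polynomial_function q \<Longrightarrow>
    laplacian (\<lambda>x. p x + q x) x = laplacian p x + laplacian q x"
  by (simp add: laplacian_eq partial_deriv_add rp_partial_deriv sum.distrib)

lemma laplacian_cmult:
  "real_polynomial_function p \<Longrightarrow> laplacian (\<lambda>x. c * p x) x = c * laplacian p x"
  by (simp add: laplacian_eq partial_deriv_cmult rp_partial_deriv sum_distrib_left)

lemma laplacian_diff:
  assumes "real_polynomial_function p" "real_polynomial_function q"
  shows "laplacian (\<lambda>x. p x - q x) x = laplacian p x - laplacian q x"
  using laplacian_add[OF assms(1) rp_cmult[OF assms(2), of "-1"]] laplacian_cmult[OF assms(2), of "-1" x]
  by simp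

lemma laplacian_sum:
  assumes "\<And>i. i \<in> I \<Longrightarrow> real_polynomial_function (f i)"
  shows "laplacian (\<lambda>x. \<Sum>i\<in>I. f i x) x = (\<Sum>i\<in>I. laplacian (f i) x)"
  using assms by (simp add: laplacian_eq partial_deriv_sum rp_partial_deriv) (rule sum.swap)

lemma laplacian_mult:
  assumes "real_polynomial_function p" "real_polynomial_function q"
  shows "laplacian (\<lambda>x. p x * q x) x
    = p x * laplacian q x + laplacian p x * q x + 2 * (\<Sum>b\<in>Basis. partial_deriv b p x * partial_deriv b q x)"
  using assms
  by (simp add: laplacian_eq partial_deriv_mult partial_deriv_add rp_intros sum.distrib sum_distrib_left
      sum_distrib_right algebra_simps)

text \<open>Rule induction on this form gives Euler's identity and the behaviour under derivatives
  and products. The vectors b are arbitrary rather than basis vectors, so composition with a linear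
  map only replaces b by its image under the adjoint.\<close>

inductive homog_poly :: "nat \<Rightarrow> ('a::euclidean_space \<Rightarrow> real) \<Rightarrow> bool" where
  homog_const: "homog_poly 0 (\<lambda>x. c)"
| homog_inner: "homog_poly n p \<Longrightarrow> homog_poly (Suc n) (\<lambda>x. (x \<bullet> b) * p x)"
| homog_add: "homog_poly n p \<Longrightarrow> homog_poly n q \<Longrightarrow> homog_poly n (\<lambda>x. p x + q x)"

lemma homog_rp: "homog_poly n p \<Longrightarrow> real_polynomial_function p"
  by (induction rule: homog_poly.induct) (auto intro: rp_intros)

lemma homog_scale: "homog_poly n p \<Longrightarrow> p (t *\<^sub>R x) = t ^ n * p x"
  by (induction rule: homog_poly.induct) (auto simp: algebra_simps)

lemma homog_zero: "homog_poly n (\<lambda>x. 0)"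
  by (induction n) (use homog_const[of 0] homog_inner in force)+

lemma homog_cmult: "homog_poly n p \<Longrightarrow> homog_poly n (\<lambda>x. c * p x)"
proof (induction rule: homog_poly.induct)
  case (homog_const c') show ?case by (rule homog_poly.homog_const)
next
  case (homog_inner n p b)
  from homog_poly.homog_inner[OF homog_inner.IH, of b] show ?case by (simp add: ac_simps)
next
  case (homog_add n p q)
  from homog_poly.homog_add[OF homog_add.IH] show ?case by (simp add: algebra_simps)
qed

lemma homog_diff: "homog_poly n p \<Longrightarrow> homog_poly n q \<Longrightarrow> homog_poly n (\<lambda>x. p x - q x)"
  using homog_add[of n p "\<lambda>x. -1 * q x"] homog_cmult[of n q "-1"] by simp

lemma homog_sum: "(\<And>i. i \<in> I \<Longrightarrow> homog_poly n (f i)) \<Longrightarrow> homog_poly n (\<lambda>x. \<Sum>i\<in>I. f i x)"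
  by (induction I rule: infinite_finite_induct) (auto intro: homog_add homog_zero)

lemma homog_mult: "homog_poly n p \<Longrightarrow> homog_poly m q \<Longrightarrow> homog_poly (n + m) (\<lambda>x. p x * q x)"
proof (induction rule: homog_poly.induct)
  case (homog_const c) then show ?case by (simp add: homog_cmult)
next
  case (homog_inner n p b)
  from homog_poly.homog_inner[OF homog_inner.IH, OF homog_inner.prems, of b] show ?case by (simp add: ac_simps)
next
  case (homog_add n p q')
  from homog_poly.homog_add[OF homog_add.IH(1)[OF homog_add.prems] homog_add.IH(2)[OF homog_add.prems]]
  show ?case by (simp add: algebra_simps)
qed

lemma homog_0_const:
  assumes "homog_poly n p" "n = 0" shows "\<exists>k. p = (\<lambda>x. k)"
  using assms by (induction rule: homog_poly.induct) auto

lemma homog_partial_deriv: "homog_poly n p \<Longrightarrow> homog_poly (n - 1) (partial_deriv b p)"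
proof (induction rule: homog_poly.induct)
  case (homog_const c) show ?case by (simp add: homog_zero)
next
  case (homog_inner n p c)
  have eq: "partial_deriv b (\<lambda>x. (x \<bullet> c) * p x) = (\<lambda>x. (x \<bullet> c) * partial_deriv b p x + (b \<bullet> c) * p x)"
    by (subst partial_deriv_mult[OF rp_inner homog_rp[OF homog_inner.hyps]]) simp
  show ?case
  proof (cases n)
    \<comment> \<open>Truncated subtraction: for n = 0 the summand with
      \<open>partial_deriv b p\<close> would nominally have degree 1, but p is constant and the
      summand vanishes.\<close>
    case 0
    then obtain k where "p = (\<lambda>x. k)" using homog_0_const[OF homog_inner.hyps] by blast
    then show ?thesis using 0 unfolding eq by (simp add: homog_poly.homog_const)
  next
    case (Suc m)
    then have "homog_poly n (\<lambda>x. (x \<bullet> c) * partial_deriv b p x)"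
      using homog_poly.homog_inner[OF homog_inner.IH, of c] by simp
    then show ?thesis unfolding eq using homog_cmult[OF homog_inner.hyps] by (simp add: homog_poly.homog_add)
  qed
next
  case (homog_add n p q)
  then show ?case by (simp add: partial_deriv_add homog_rp homog_poly.homog_add)
qed

lemma homog_laplacian: "homog_poly n p \<Longrightarrow> homog_poly (n - 2) (laplacian p)"
  unfolding laplacian_eq[abs_def]
  using homog_partial_deriv[OF homog_partial_deriv] by (intro homog_sum) (simp add: numeral_2_eq_2)

lemma homog_laplacian_0: "homog_poly n p \<Longrightarrow> n < 2 \<Longrightarrow> laplacian p x = 0"
proof -
  assume h: "homog_poly n p" and n: "n < 2"
  have "partial_deriv b (partial_deriv b p) = (\<lambda>x. 0)" for b
    using homog_0_const[OF homog_partial_deriv[OF h, of b]] n by auto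
  then show ?thesis unfolding laplacian_eq by simp
qed

lemma homog_euler:
  "homog_poly n p \<Longrightarrow> (\<Sum>b\<in>Basis. (x \<bullet> b) * partial_deriv b p x) = real n * p x"
proof (induction rule: homog_poly.induct)
  case (homog_inner n p c)
  have "(\<Sum>b\<in>Basis. (x \<bullet> b) * partial_deriv b (\<lambda>x. (x \<bullet> c) * p x) x)
     = (\<Sum>b\<in>Basis. (x \<bullet> c) * ((x \<bullet> b) * partial_deriv b p x) + ((x \<bullet> b) * (c \<bullet> b)) * p x)"
  proof (intro sum.cong refl)
    fix b :: 'a
    have "partial_deriv b (\<lambda>x. (x \<bullet> c) * p x) x = (x \<bullet> c) * partial_deriv b p x + (b \<bullet> c) * p x"
      using partial_deriv_mult[OF rp_inner homog_rp[OF homog_inner.hyps]] by simp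
    then show "(x \<bullet> b) * partial_deriv b (\<lambda>x. (x \<bullet> c) * p x) x
        = (x \<bullet> c) * ((x \<bullet> b) * partial_deriv b p x) + ((x \<bullet> b) * (c \<bullet> b)) * p x"
      by (simp add: inner_commute[of c b] algebra_simps)
  qed
  also have "\<dots> = (x \<bullet> c) * (real n * p x) + (x \<bullet> c) * p x"
    by (simp add: sum.distrib sum_distrib_left[symmetric] sum_distrib_right[symmetric] homog_inner.IH
        euclidean_inner[of x c])
  finally show ?case by (simp add: algebra_simps)
next
  case (homog_add n p q)
  then show ?case by (simp add: partial_deriv_add homog_rp distrib_left sum.distrib)
qed simp

inductive homog_sums :: "('a::euclidean_space \<Rightarrow> real) \<Rightarrow> bool" where
  hs_zero: "homog_sums (\<lambda>x. 0)"
| hs_add: "homog_poly n h \<Longrightarrow> homog_sums p \<Longrightarrow> homog_sums (\<lambda>x. h x + p x)"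

lemma homog_sums_add: "homog_sums p \<Longrightarrow> homog_sums q \<Longrightarrow> homog_sums (\<lambda>x. p x + q x)"
proof (induction rule: homog_sums.induct)
  case (hs_add n h p)
  from homog_sums.hs_add[OF hs_add.hyps(1) hs_add.IH[OF hs_add.prems]] show ?case by (simp add: add.assoc)
qed simp

lemma homog_sums_homog: "homog_poly n p \<Longrightarrow> homog_sums p"
  using hs_add[OF _ hs_zero] by fastforce

lemma homog_sums_mult: "homog_sums p \<Longrightarrow> homog_sums q \<Longrightarrow> homog_sums (\<lambda>x. p x * q x)"
proof (induction rule: homog_sums.induct)
  case hs_zero show ?case by (simp add: homog_sums.hs_zero)
next
  case (hs_add n h p)
  from \<open>homog_sums q\<close> have "homog_sums (\<lambda>x. h x * q x)"
  proof (induction rule: homog_sums.induct)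
    case hs_zero show ?case by (simp add: homog_sums.hs_zero)
  next
    case (hs_add m g q)
    from homog_sums.hs_add[OF homog_mult[OF \<open>homog_poly n h\<close> hs_add.hyps(1)] hs_add.IH] show ?case
      by (simp add: distrib_left)
  qed
  from homog_sums_add[OF this hs_add.IH[OF hs_add.prems]] show ?case by (simp add: distrib_right)
qed

lemma rp_homog_sums: "real_polynomial_function p \<Longrightarrow> homog_sums p"
proof (induction rule: real_polynomial_function.induct)
  case (linear f)
  then interpret bounded_linear f .
  have "f x = (\<Sum>b\<in>Basis. (x \<bullet> b) * f b)" for x
    by (subst euclidean_representation[of x, symmetric]) (simp add: sum scaleR del: euclidean_representation)
  moreover have "homog_poly (Suc 0) (\<lambda>x. \<Sum>b\<in>Basis. (x \<bullet> b) * f b)"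
    by (intro homog_sum homog_inner homog_const)
  ultimately show ?case by (metis (no_types, lifting) homog_sums_homog ext)
next
  case (const c) show ?case by (rule homog_sums_homog[OF homog_const])
qed (simp_all add: homog_sums_add homog_sums_mult)

lemma homog_sums_components:
  "homog_sums p \<Longrightarrow> \<exists>N h. (\<forall>i. homog_poly i (h i)) \<and> (\<forall>x. p x = (\<Sum>i\<le>N. h i x))"
proof (induction rule: homog_sums.induct)
  case hs_zero show ?case by (rule exI[of _ 0], rule exI[of _ "\<lambda>i x. 0"]) (simp add: homog_zero)
next
  case (hs_add n g p)
  then obtain N h where h: "\<And>i. homog_poly i (h i)" "\<And>x. p x = (\<Sum>i\<le>N. h i x)" by auto
  define h' where "h' = (\<lambda>i x. (if i = n then g x else 0) + (if i \<le> N then h i x else 0))"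
  have "homog_poly i (h' i)" for i
  proof -
    have "homog_poly i (\<lambda>x. if i = n then g x else 0)"
      using hs_add.hyps homog_zero by (cases "i = n") auto
    moreover have "homog_poly i (\<lambda>x. if i \<le> N then h i x else 0)"
      using h homog_zero by (cases "i \<le> N") auto
    ultimately show ?thesis unfolding h'_def by (rule homog_add)
  qed
  moreover have "g x + p x = (\<Sum>i\<le>N+n. h' i x)" for x
  proof -
    have "(\<Sum>i\<le>N+n. if i \<le> N then h i x else 0) = (\<Sum>i\<le>N. h i x)"
      by (rule sum.mono_neutral_cong_right) auto
    then show ?thesis by (simp add: h'_def sum.distrib h)
  qed
  ultimately show ?case by blast
qed

text \<open>For fixed x, p (t x) is a polynomial in t. Its coefficients are known both from the
  homogeneous components of p and from the scaling hypothesis, and comparing them leaves only the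
  component of degree l.\<close>

lemma homog_polyI:
  assumes p: "real_polynomial_function p" and hom: "\<And>t x. p (t *\<^sub>R x) = t ^ l * p x"
  shows "homog_poly l p"
proof -
  obtain N h where h: "\<And>i. homog_poly i (h i)" "\<And>x. p x = (\<Sum>i\<le>N. h i x)"
    using homog_sums_components[OF rp_homog_sums[OF p]] by auto
  define h' where "h' = (\<lambda>i x. if i \<le> N then h i x else 0)"
  have h': "homog_poly i (h' i)" for i
    unfolding h'_def using h(1)[of i] homog_zero[of i] by (cases "i \<le> N") auto
  have ph: "p x = (\<Sum>i\<le>N+l. h' i x)" for x
    unfolding h(2) h'_def by (rule sum.mono_neutral_cong_left) auto
  have "p x = h' l x" for x
  proof -
    have "(\<Sum>i\<le>N+l. h' i x * t ^ i) = (\<Sum>i\<le>N+l. (if i = l then p x else 0) * t ^ i)" for t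
    proof -
      have "(\<Sum>i\<le>N+l. h' i x * t ^ i) = p (t *\<^sub>R x)"
        unfolding ph by (intro sum.cong) (auto simp: homog_scale[OF h'])
      also have "\<dots> = (\<Sum>i\<le>N+l. (if i = l then p x else 0) * t ^ i)"
        by (simp add: hom if_distrib[of "\<lambda>u. u * _"] cong: if_cong)
      finally show ?thesis .
    qed
    then have "\<forall>i\<le>N+l. h' i x = (if i = l then p x else 0)"
      using polyfun_eq_coeffs[of "\<lambda>i. h' i x" "N+l" "\<lambda>i. if i = l then p x else 0"] by blast
    then show ?thesis by simp
  qed
  then have "p = h' l" by (rule ext)
  then show ?thesis using h' by simp
qed

section \<open>Solid harmonics and the Fischer decomposition\<close>

definition harmonic_poly :: "nat \<Rightarrow> ('a::euclidean_space \<Rightarrow> real) \<Rightarrow> bool" where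
  "harmonic_poly l h \<longleftrightarrow> homog_poly l h \<and> (\<forall>x. laplacian h x = 0)"

lemma spherical_harmonic_iff:
  "spherical_harmonic l f \<longleftrightarrow> (\<exists>h. harmonic_poly l h \<and> (\<forall>x\<in>sphere 0 1. f x = h x))"
  unfolding spherical_harmonic_def harmonic_poly_def
  using homog_polyI homog_rp homog_scale by metis

lemma homog_norm2: "homog_poly 2 (\<lambda>x::'a::euclidean_space. x \<bullet> x)"
proof -
  have "homog_poly (Suc (Suc 0)) (\<lambda>x::'a. \<Sum>b\<in>Basis. (x \<bullet> b) * ((x \<bullet> b) * 1))"
    by (intro homog_sum homog_inner homog_const)
  moreover have "(\<lambda>x::'a. \<Sum>b\<in>Basis. (x \<bullet> b) * ((x \<bullet> b) * 1)) = (\<lambda>x. x \<bullet> x)"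
    by (simp add: euclidean_inner[symmetric])
  ultimately show ?thesis by (simp add: numeral_2_eq_2)
qed

lemma partial_deriv_norm2: "partial_deriv b (\<lambda>x::'a::euclidean_space. x \<bullet> x) = (\<lambda>x. 2 * (x \<bullet> b))"
  by (subst partial_deriv_unique[where D="\<lambda>x h. x \<bullet> h + h \<bullet> x"])
     (auto intro!: derivative_eq_intros simp: inner_commute)

text \<open>Product rule for |x|^2, whose Laplacian is \<open>2 * DIM('a)\<close> and whose gradient
  is 2 x; Euler's identity evaluates the cross term 2 (2 x . grad u) as 4 n u.\<close>

lemma laplacian_norm2_mult:
  fixes u :: "'a::euclidean_space \<Rightarrow> real"
  assumes u: "homog_poly n u"
  shows "laplacian (\<lambda>x. (x \<bullet> x) * u x) x = (2 * DIM('a) + 4 * n) * u x + (x \<bullet> x) * laplacian u x"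
proof -
  have "laplacian (\<lambda>x::'a. x \<bullet> x) x = 2 * DIM('a)"
    by (simp add: laplacian_eq partial_deriv_norm2 partial_deriv_cmult rp_inner)
  moreover have "(\<Sum>b\<in>Basis. partial_deriv b (\<lambda>x. x \<bullet> x) x * partial_deriv b u x) = 2 * (n * u x)"
    by (simp add: partial_deriv_norm2 homog_euler[OF u, symmetric] sum_distrib_left mult.assoc)
  ultimately show ?thesis
    using laplacian_mult[OF homog_rp[OF homog_norm2] homog_rp[OF u], of x] by (simp add: algebra_simps)
qed

lemma homog_norm2_power: "homog_poly m h \<Longrightarrow> homog_poly (2 * j + m) (\<lambda>x. (x \<bullet> x) ^ j * h x)"
proof (induction j)
  case (Suc j)
  from homog_mult[OF homog_norm2 Suc.IH[OF Suc.prems]] show ?case by (simp add: mult.assoc)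
qed simp

lemma laplacian_norm2_power:
  fixes h :: "'a::euclidean_space \<Rightarrow> real"
  assumes h: "harmonic_poly m h"
  shows "laplacian (\<lambda>x. (x \<bullet> x) ^ Suc j * h x) x
    = (real j + 1) * (2 * DIM('a) + 4 * m + 4 * j) * ((x \<bullet> x) ^ j * h x)"
proof (induction j)
  case 0
  show ?case using laplacian_norm2_mult[of m h x] h by (simp add: harmonic_poly_def)
next
  case (Suc j)
  have "laplacian (\<lambda>x. (x \<bullet> x) ^ Suc (Suc j) * h x) x = laplacian (\<lambda>x. (x \<bullet> x) * ((x \<bullet> x) ^ Suc j * h x)) x"
    by (simp add: mult.assoc)
  also have "\<dots> = (2 * DIM('a) + 4 * real (2 * Suc j + m)) * ((x \<bullet> x) ^ Suc j * h x)
      + (x \<bullet> x) * ((real j + 1) * (2 * DIM('a) + 4 * m + 4 * j) * ((x \<bullet> x) ^ j * h x))"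
    using laplacian_norm2_mult[OF homog_norm2_power[of m h "Suc j"], of x] h
    by (simp only: Suc.IH harmonic_poly_def) simp
  also have "\<dots> = (real (Suc j) + 1) * (2 * DIM('a) + 4 * m + 4 * Suc j) * ((x \<bullet> x) ^ Suc j * h x)"
    by (simp add: algebra_simps)
  finally show ?case .
qed

text \<open>Fischer decomposition: a polynomial q with \<open>\<Delta>(|x|\<^sup>2 q) = \<Delta>p\<close> is found by expanding
  \<open>\<Delta>p\<close> inductively, because \<open>\<Delta>\<close> acts on \<open>|x|\<^sup>2\<^sup>j\<^sup>+\<^sup>2 h\<close> with a positive factor.\<close>

lemma fischer_decomposition:
  fixes p :: "'a::euclidean_space \<Rightarrow> real"
  shows "homog_poly n p \<Longrightarrow> \<exists>h. (\<forall>j\<le>n div 2. harmonic_poly (n - 2 * j) (h j)) \<and>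
    (\<forall>x. p x = (\<Sum>j\<le>n div 2. (x \<bullet> x) ^ j * h j x))"
proof (induction n arbitrary: p rule: less_induct)
  case (less n)
  show ?case
  proof (cases "n < 2")
    case True
    then show ?thesis using less.prems homog_laplacian_0[OF less.prems]
      by (intro exI[of _ "\<lambda>j. p"]) (auto simp: harmonic_poly_def)
  next
    case False
    define m where "m = n - 2"
    have n: "n = Suc (Suc m)" "n div 2 = Suc (m div 2)" using False by (auto simp: m_def)
    have "homog_poly m (laplacian p)" using homog_laplacian[OF less.prems] by (simp add: m_def)
    from less.IH[OF _ this] n obtain g where
      g: "\<And>j. j \<le> m div 2 \<Longrightarrow> harmonic_poly (m - 2 * j) (g j)"
      and lp: "\<And>x. laplacian p x = (\<Sum>j\<le>m div 2. (x \<bullet> x) ^ j * g j x)" by auto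
    \<comment> \<open>The factors of \<open>laplacian_norm2_power\<close> in degree m - 2 j.
      Dividing the components of \<Delta>p by them produces Q with \<Delta>Q = \<Delta>p, so that p
      - Q is the harmonic leading component and the others move up by one power of |x|^2.\<close>
    define c where "c = (\<lambda>j. (real j + 1) * (2 * real DIM('a) + 4 * real (m - 2 * j) + 4 * real j))"
    have c: "c j > 0" for j
    proof -
      have "2 * real DIM('a) > 0" by simp
      then have "2 * real DIM('a) + 4 * real (m - 2 * j) + 4 * real j > 0" by linarith
      then show ?thesis unfolding c_def by (intro mult_pos_pos) auto
    qed
    define h where "h = (\<lambda>j x. 1 / c j * g j x)"
    have h: "harmonic_poly (m - 2 * j) (h j)" if "j \<le> m div 2" for j
    proof -
      have gj: "homog_poly (m - 2 * j) (g j)" "\<And>x. laplacian (g j) x = 0"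
        using g[OF that] by (simp_all add: harmonic_poly_def)
      show ?thesis unfolding h_def harmonic_poly_def
        using homog_cmult[OF gj(1)] laplacian_cmult[OF homog_rp[OF gj(1)]] gj(2) by (metis mult_zero_right)
    qed
    define Q where "Q = (\<lambda>x. \<Sum>j\<le>m div 2. (x \<bullet> x) ^ Suc j * h j x)"
    have hQ: "homog_poly n (\<lambda>x. (x \<bullet> x) ^ Suc j * h j x)" if "j \<le> m div 2" for j
    proof -
      have "homog_poly (2 * Suc j + (m - 2 * j)) (\<lambda>x. (x \<bullet> x) ^ Suc j * h j x)"
        using h[OF that] by (intro homog_norm2_power) (simp add: harmonic_poly_def)
      moreover have "2 * j \<le> m" using that by presburger
      then have "2 * Suc j + (m - 2 * j) = n" using n(1) by simp
      ultimately show ?thesis by simp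
    qed
    have Q: "homog_poly n Q" unfolding Q_def using hQ by (intro homog_sum) auto
    have lQ: "laplacian Q x = laplacian p x" for x
    proof -
      have "laplacian Q x = (\<Sum>j\<le>m div 2. laplacian (\<lambda>x. (x \<bullet> x) ^ Suc j * h j x) x)"
        unfolding Q_def by (rule laplacian_sum) (use homog_rp[OF hQ] in auto)
      also have "\<dots> = (\<Sum>j\<le>m div 2. c j * ((x \<bullet> x) ^ j * h j x))"
        using laplacian_norm2_power[OF h, of _ _ x] by (intro sum.cong) (auto simp: c_def)
      also have "\<dots> = (\<Sum>j\<le>m div 2. (x \<bullet> x) ^ j * g j x)"
        using c by (intro sum.cong) (auto simp: h_def less_imp_neq[symmetric] field_simps)
      finally show ?thesis by (simp add: lp)
    qed
    define h' where "h' = (\<lambda>j. case j of 0 \<Rightarrow> (\<lambda>x. p x - Q x) | Suc i \<Rightarrow> h i)"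
    have "harmonic_poly (n - 2 * j) (h' j)" if "j \<le> n div 2" for j
    proof (cases j)
      case 0
      then show ?thesis using homog_diff[OF less.prems Q] lQ laplacian_diff[OF homog_rp homog_rp, OF less.prems Q]
        by (simp add: h'_def harmonic_poly_def)
    next
      case (Suc i)
      then show ?thesis using h[of i] that n by (simp add: h'_def)
    qed
    moreover have "p x = (\<Sum>j\<le>n div 2. (x \<bullet> x) ^ j * h' j x)" for x
    proof -
      have "(\<Sum>j\<le>n div 2. (x \<bullet> x) ^ j * h' j x) = h' 0 x + (\<Sum>j\<le>m div 2. (x \<bullet> x) ^ Suc j * h' (Suc j) x)"
        unfolding n(2) by (subst sum.atMost_Suc_shift) simp
      also have "\<dots> = p x" by (simp add: h'_def Q_def)
      finally show ?thesis by simp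
    qed
    ultimately show ?thesis by blast
  qed
qed

section \<open>Rotations in coordinate planes\<close>

text \<open>Rotation by the angle t in the plane of a and b, written as the identity plus a
  correction inside that plane, so that linearity in x and the derivative in t can be read off
  directly.\<close>

definition plane_rotation :: "'a::euclidean_space \<Rightarrow> 'a \<Rightarrow> real \<Rightarrow> 'a \<Rightarrow> 'a" where
  "plane_rotation a b t x = x + (cos t - 1) *\<^sub>R ((x \<bullet> a) *\<^sub>R a + (x \<bullet> b) *\<^sub>R b)
     + sin t *\<^sub>R ((x \<bullet> a) *\<^sub>R b - (x \<bullet> b) *\<^sub>R a)"

text \<open>The infinitesimal generator of \<open>plane_rotation a b\<close>, tangential to every
  sphere around the origin.\<close>

definition angular_deriv :: "'a::euclidean_space \<Rightarrow> 'a \<Rightarrow> ('a \<Rightarrow> real) \<Rightarrow> 'a \<Rightarrow> real" where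
  "angular_deriv a b p x = (x \<bullet> a) * partial_deriv b p x - (x \<bullet> b) * partial_deriv a p x"

lemma plane_rotation_0 [simp]: "plane_rotation a b 0 x = x"
  by (simp add: plane_rotation_def)

lemma plane_rotation_inner:
  assumes "a \<in> Basis" "b \<in> Basis" "a \<noteq> b"
  shows "plane_rotation a b t x \<bullet> a = cos t * (x \<bullet> a) - sin t * (x \<bullet> b)"
    "plane_rotation a b t x \<bullet> b = sin t * (x \<bullet> a) + cos t * (x \<bullet> b)"
  using assms by (simp_all add: plane_rotation_def inner_simps inner_Basis algebra_simps)

lemma plane_rotation_orthogonal:
  assumes ab: "a \<in> Basis" "b \<in> Basis" "a \<noteq> b"
  shows "orthogonal_transformation (plane_rotation a b t)"
proof -
  have "linear (plane_rotation a b t)"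
    unfolding plane_rotation_def[abs_def]
    by (rule linearI) (simp_all add: inner_add_left algebra_simps)
  moreover have "plane_rotation a b t x \<bullet> plane_rotation a b t y = x \<bullet> y" for x y
  proof -
    define X Y U V c s where "X = x \<bullet> a" and "Y = x \<bullet> b" and "U = y \<bullet> a" and "V = y \<bullet> b"
      and "c = cos t" and "s = sin t"
    have cs: "s * s = 1 - c * c" using sin_cos_squared_add[of t] by (simp add: c_def s_def power2_eq_square)
    have *: "a \<bullet> a = 1" "b \<bullet> b = 1" "a \<bullet> b = 0" "b \<bullet> a = 0" "a \<bullet> x = X" "b \<bullet> x = Y" "a \<bullet> y = U" "b \<bullet> y = V"
      using ab by (auto simp: inner_Basis X_def Y_def U_def V_def inner_commute)
    have "plane_rotation a b t x \<bullet> plane_rotation a b t y = x \<bullet> y + 2 * (c - 1) * (X * U + Y * V)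
       + (c - 1) * (c - 1) * (X * U + Y * V) + s * s * (X * U + Y * V)"
      unfolding plane_rotation_def X_def[symmetric] Y_def[symmetric] U_def[symmetric] V_def[symmetric]
        c_def[symmetric] s_def[symmetric]
      by (simp add: inner_simps * X_def[symmetric] Y_def[symmetric] U_def[symmetric] V_def[symmetric]
            algebra_simps)
    also have "\<dots> = x \<bullet> y" unfolding cs by (simp add: algebra_simps)
    finally show ?thesis .
  qed
  ultimately show ?thesis by (simp add: orthogonal_transformation_def)
qed

lemma plane_rotation_sphere:
  assumes "a \<in> Basis" "b \<in> Basis" "a \<noteq> b" "x \<in> sphere 0 1"
  shows "plane_rotation a b t x \<in> sphere 0 1"
  using plane_rotation_orthogonal[OF assms(1-3), of t] assms(4)
  by (simp add: orthogonal_transformation)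

lemma plane_rotation_has_vector_derivative:
  assumes ab: "a \<in> Basis" "b \<in> Basis" "a \<noteq> b"
  shows "((\<lambda>t. plane_rotation a b t x) has_vector_derivative
    ((plane_rotation a b t x \<bullet> a) *\<^sub>R b - (plane_rotation a b t x \<bullet> b) *\<^sub>R a)) (at t)"
  unfolding plane_rotation_inner[OF ab] unfolding plane_rotation_def
  by (auto intro!: derivative_eq_intros simp: algebra_simps)

text \<open>Valid at every t and not just at t = 0, so it can be iterated along an orbit to reach
  second derivatives.\<close>

lemma angular_deriv_chain:
  assumes ab: "a \<in> Basis" "b \<in> Basis" "a \<noteq> b" and p: "real_polynomial_function p"
  shows "((\<lambda>t. p (plane_rotation a b t x)) has_real_derivative
    angular_deriv a b p (plane_rotation a b t x)) (at t)"
proof -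
  let ?y = "plane_rotation a b t x"
  have l: "linear (frechet_derivative p (at ?y))"
    using rp_has_derivative[OF p] by (rule has_derivative_linear)
  have "((p \<circ> (\<lambda>t. plane_rotation a b t x)) has_vector_derivative
     frechet_derivative p (at ?y) ((?y \<bullet> a) *\<^sub>R b - (?y \<bullet> b) *\<^sub>R a)) (at t)"
    by (rule vector_derivative_diff_chain_within[OF plane_rotation_has_vector_derivative[OF ab]])
       (use rp_has_derivative[OF p, of ?y] has_derivative_at_withinI in blast)
  moreover have "frechet_derivative p (at ?y) ((?y \<bullet> a) *\<^sub>R b - (?y \<bullet> b) *\<^sub>R a) = angular_deriv a b p ?y"
    by (simp add: linear_diff[OF l] linear_cmul[OF l] angular_deriv_def partial_deriv_def)
  ultimately show ?thesis by (simp add: o_def has_real_derivative_iff_has_vector_derivative)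
qed

lemma rp_angular_deriv: "real_polynomial_function p \<Longrightarrow> real_polynomial_function (angular_deriv a b p)"
  unfolding angular_deriv_def[abs_def] by (intro rp_intros)

lemma angular_deriv_self [simp]: "angular_deriv a a p x = 0"
  by (simp add: angular_deriv_def)

lemma angular_deriv_mult:
  assumes "real_polynomial_function p" "real_polynomial_function q"
  shows "angular_deriv a b (\<lambda>x. p x * q x) x = p x * angular_deriv a b q x + angular_deriv a b p x * q x"
  using assms by (simp add: angular_deriv_def partial_deriv_mult algebra_simps)

text \<open>The integral of p composed with the rotation by t does not depend on t, and the claim is
  that its derivative at t = 0 vanishes. The exchange of derivative and integral is replaced by a
  second-order Taylor bound that is uniform on the sphere.\<close>

lemma integral_angular_deriv:
  assumes ab: "a \<in> Basis" "b \<in> Basis" and p: "real_polynomial_function (p :: 'a::euclidean_space \<Rightarrow> real)"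
  shows "(LINT x|sphere_measure. angular_deriv a b p x) = 0"
proof (cases "a = b")
  case False
  note ab = ab False
  interpret prob_space "sphere_measure :: 'a measure" by (rule prob_space_sphere_measure)
  let ?L = "angular_deriv a b"
  let ?R = "plane_rotation a b"
  have rpL: "real_polynomial_function (?L p)" and rpLL: "real_polynomial_function (?L (?L p))"
    using p by (auto intro: rp_angular_deriv)
  obtain B where B: "B > 0" "\<And>x. x \<in> sphere 0 1 \<Longrightarrow> \<bar>?L (?L p) x\<bar> \<le> B"
    using bounded_sphere_continuous[OF rp_continuous[OF rpLL]] by blast
  have R: "?R t x \<in> sphere 0 1" if "x \<in> sphere 0 1" for t x
    by (rule plane_rotation_sphere[OF ab that])
  \<comment> \<open>Two applications of the mean value theorem along the orbit of x; B bounds the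
    second angular derivative on the whole sphere, which contains the orbit.\<close>
  have key: "\<bar>p (?R t x) - p x - t * ?L p x\<bar> \<le> B * t ^ 2" if x: "x \<in> sphere 0 1" and t: "t > 0" for t x
  proof -
    obtain u where u: "0 < u" "u < t" "p (?R t x) - p (?R 0 x) = (t - 0) * ?L p (?R u x)"
      using MVT2[OF t, of "\<lambda>t. p (?R t x)" "\<lambda>t. ?L p (?R t x)"] angular_deriv_chain[OF ab p] by blast
    obtain v where v: "0 < v" "v < u" "?L p (?R u x) - ?L p (?R 0 x) = (u - 0) * ?L (?L p) (?R v x)"
      using MVT2[OF u(1), of "\<lambda>t. ?L p (?R t x)" "\<lambda>t. ?L (?L p) (?R t x)"] angular_deriv_chain[OF ab rpL] by blast
    have "p (?R t x) - p x - t * ?L p x = t * u * ?L (?L p) (?R v x)"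
      using u(3) v(3) by (simp add: algebra_simps)
    also have "\<bar>\<dots>\<bar> = t * u * \<bar>?L (?L p) (?R v x)\<bar>" using t u by (simp add: abs_mult)
    also have "\<dots> \<le> t * t * B" using t u B(2)[OF R[OF x, of v]] B(1) by (intro mult_mono) auto
    finally show ?thesis by (simp add: power2_eq_square mult.commute)
  qed
  have ip: "integrable sphere_measure q" if "real_polynomial_function q" for q :: "'a \<Rightarrow> real"
    by (intro integrable_sphere_continuous rp_continuous that)
  have "\<bar>LINT x|sphere_measure. ?L p x\<bar> \<le> 0 + t" if t: "t > 0" for t
  proof -
    \<comment> \<open>Chosen so that the Taylor error divided by the angle, B \<tau>, equals the
      prescribed t.\<close>
    define \<tau> where "\<tau> = t / B"
    have \<tau>: "\<tau> > 0" using t B by (simp add: \<tau>_def)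
    have cR: "continuous_on (sphere 0 1) (\<lambda>x. p (?R \<tau> x))"
      by (rule continuous_on_compose2[OF rp_continuous[OF p, of UNIV]])
         (auto intro!: linear_continuous_on linear_conv_bounded_linear[THEN iffD1] orthogonal_transformation_linear plane_rotation_orthogonal ab)
    have eq: "(LINT x|sphere_measure. p (?R \<tau> x)) = (LINT x|sphere_measure. p x)"
      by (rule integral_sphere_orthogonal[OF plane_rotation_orthogonal[OF ab]])
         (intro borel_measurable_sphere_continuous rp_continuous p)
    have "\<tau> * \<bar>LINT x|sphere_measure. ?L p x\<bar> = \<bar>LINT x|sphere_measure. (p (?R \<tau> x) - p x - \<tau> * ?L p x)\<bar>"
      using \<tau> eq ip[OF p] ip[OF rpL] integrable_sphere_continuous[OF cR]
      by (simp add: abs_mult)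
    also have "\<dots> \<le> (LINT x|sphere_measure. \<bar>p (?R \<tau> x) - p x - \<tau> * ?L p x\<bar>)"
      by (rule integral_abs_bound)
    also have "\<dots> \<le> (LINT (x::'a)|sphere_measure. B * \<tau> ^ 2)"
      using key \<tau> ip[OF p] ip[OF rpL] integrable_sphere_continuous[OF cR]
      by (intro integral_mono integrable_abs Bochner_Integration.integrable_diff integrable_mult_right) auto
    also have "\<dots> = \<tau> * (B * \<tau>)" by (simp add: prob_space power2_eq_square space_sphere_measure[symmetric] del: space_sphere_measure)
    finally have "\<bar>LINT x|sphere_measure. ?L p x\<bar> \<le> B * \<tau>" using \<tau> by simp
    then show ?thesis using B by (simp add: \<tau>_def)
  qed
  then have "\<bar>LINT x|sphere_measure. ?L p x\<bar> \<le> 0" by (rule field_le_epsilon)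
  then show ?thesis by simp
qed simp

text \<open>Integration by parts: the angular derivative of the product p q integrates to
  zero.\<close>

lemma angular_deriv_antisym:
  assumes ab: "a \<in> Basis" "b \<in> Basis" and p: "real_polynomial_function (p :: 'a::euclidean_space \<Rightarrow> real)"
    and q: "real_polynomial_function q"
  shows "(LINT x|sphere_measure. angular_deriv a b p x * q x) = - (LINT x|sphere_measure. p x * angular_deriv a b q x)"
proof -
  have "0 = (LINT x|sphere_measure. p x * angular_deriv a b q x + angular_deriv a b p x * q x)"
    using integral_angular_deriv[OF ab rp_mult[OF p q]] angular_deriv_mult[OF p q] by simp
  also have "\<dots> = (LINT x|sphere_measure. p x * angular_deriv a b q x) + (LINT x|sphere_measure. angular_deriv a b p x * q x)"
    by (intro Bochner_Integration.integral_add integrable_sphere_continuous rp_continuous rp_mult rp_angular_deriv p q)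
  finally show ?thesis by simp
qed

text \<open>On the sphere this is the Laplace--Beltrami operator.\<close>

definition sphere_laplacian :: "('a::euclidean_space \<Rightarrow> real) \<Rightarrow> 'a \<Rightarrow> real" where
  "sphere_laplacian p x = (\<Sum>a\<in>Basis. \<Sum>b\<in>Basis. angular_deriv a b (angular_deriv a b p) x) / 2"

lemma rp_sphere_laplacian:
  "real_polynomial_function p \<Longrightarrow> real_polynomial_function (sphere_laplacian p)"
  unfolding sphere_laplacian_def[abs_def] by (intro real_polynomial_function_divide rp_sum rp_angular_deriv)

lemma sphere_laplacian_symmetric:
  assumes p: "real_polynomial_function (p :: 'a::euclidean_space \<Rightarrow> real)"
    and q: "real_polynomial_function q"
  shows "(LINT x|sphere_measure. sphere_laplacian p x * q x) = (LINT x|sphere_measure. p x * sphere_laplacian q x)"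
proof -
  have ip: "integrable sphere_measure q" if "real_polynomial_function q" for q :: "'a \<Rightarrow> real"
    by (intro integrable_sphere_continuous rp_continuous that)
  have "(LINT x|sphere_measure. angular_deriv a b (angular_deriv a b p) x * q x) =
     (LINT x|sphere_measure. p x * angular_deriv a b (angular_deriv a b q) x)"
    if ab: "a \<in> Basis" "b \<in> Basis" for a b
    by (simp add: angular_deriv_antisym[OF ab rp_angular_deriv[OF p] q] angular_deriv_antisym[OF ab p rp_angular_deriv[OF q]])
  then have "(\<Sum>a\<in>Basis. \<Sum>b\<in>Basis. (LINT x|sphere_measure. angular_deriv a b (angular_deriv a b p) x * q x)) =
     (\<Sum>a\<in>Basis. \<Sum>b\<in>Basis. (LINT x|sphere_measure. p x * angular_deriv a b (angular_deriv a b q) x))"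
    by (intro sum.cong) auto
  moreover have "(LINT x|sphere_measure. sphere_laplacian p x * q x) =
      (\<Sum>a\<in>Basis. \<Sum>b\<in>Basis. (LINT x|sphere_measure. angular_deriv a b (angular_deriv a b p) x * q x)) / 2"
  proof -
    have "(LINT x|sphere_measure. sphere_laplacian p x * q x) =
       (LINT x|sphere_measure. (\<Sum>a\<in>Basis. \<Sum>b\<in>Basis. angular_deriv a b (angular_deriv a b p) x * q x) / 2)"
      by (simp add: sphere_laplacian_def sum_distrib_right)
    then show ?thesis
      by (simp add: Bochner_Integration.integral_sum ip rp_mult rp_sum rp_angular_deriv p q)
  qed
  moreover have "(LINT x|sphere_measure. p x * sphere_laplacian q x) =
      (\<Sum>a\<in>Basis. \<Sum>b\<in>Basis. (LINT x|sphere_measure. p x * angular_deriv a b (angular_deriv a b q) x)) / 2"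
  proof -
    have "(LINT x|sphere_measure. p x * sphere_laplacian q x) =
       (LINT x|sphere_measure. (\<Sum>a\<in>Basis. \<Sum>b\<in>Basis. p x * angular_deriv a b (angular_deriv a b q) x) / 2)"
      by (simp add: sphere_laplacian_def sum_distrib_left)
    then show ?thesis
      by (simp add: Bochner_Integration.integral_sum ip rp_mult rp_sum rp_angular_deriv p q)
  qed
  ultimately show ?thesis by simp
qed

text \<open>Writing E for the Euler operator and D for \<open>DIM('a)\<close>, the last double sum
  is E^2 - E, so this is the polar form |x|^2 \<Delta> - (D - 2) E - E^2. The terms
  \<open>if a = b\<close> in the proof are the derivatives of one coordinate in the direction of
  another.\<close>

lemma sphere_laplacian_eq:
  assumes p: "real_polynomial_function (p :: 'a::euclidean_space \<Rightarrow> real)"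
  shows "sphere_laplacian p x = (x \<bullet> x) * laplacian p x
    - (real DIM('a) - 1) * (\<Sum>b\<in>Basis. (x \<bullet> b) * partial_deriv b p x)
    - (\<Sum>a\<in>Basis. (x \<bullet> a) * (\<Sum>b\<in>Basis. (x \<bullet> b) * partial_deriv b (partial_deriv a p) x))"
proof -
  let ?d = "\<lambda>b. partial_deriv b p x" and ?dd = "\<lambda>a b. partial_deriv a (partial_deriv b p) x"
  let ?E = "\<Sum>b\<in>Basis. (x \<bullet> b) * ?d b"
  let ?Q = "\<Sum>a\<in>Basis. (x \<bullet> a) * (\<Sum>b\<in>Basis. (x \<bullet> b) * ?dd b a)"
  have 1: "angular_deriv a b (angular_deriv a b p) x =
     (if a = b then (x \<bullet> a) * ?d a else 0) + (x \<bullet> a) * (x \<bullet> a) * ?dd b b - (x \<bullet> a) * ?d a - (x \<bullet> a) * ((x \<bullet> b) * ?dd b a)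
     - (x \<bullet> b) * ?d b - (x \<bullet> b) * ((x \<bullet> a) * ?dd a b) + (if a = b then (x \<bullet> a) * ?d a else 0) + (x \<bullet> b) * (x \<bullet> b) * ?dd a a"
    if ab: "a \<in> Basis" "b \<in> Basis" for a b
  proof -
    have D: "partial_deriv c (angular_deriv a b p) x
       = (c \<bullet> a) * ?d b + (x \<bullet> a) * ?dd c b - ((c \<bullet> b) * ?d a + (x \<bullet> b) * ?dd c a)" for c
    proof -
      show ?thesis unfolding angular_deriv_def[abs_def]
        by (simp add: partial_deriv_diff partial_deriv_mult rp_intros p)
    qed
    show ?thesis
      unfolding angular_deriv_def[of a b "angular_deriv a b p"] D
      using ab by (cases "a = b") (simp_all add: inner_Basis algebra_simps)
  qed
  have n2: "(\<Sum>a\<in>Basis. (x \<bullet> a) * (x \<bullet> a)) = x \<bullet> x" by (rule euclidean_inner[symmetric])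
  have S1: "(\<Sum>a\<in>Basis. \<Sum>b\<in>Basis. (x \<bullet> a) * (x \<bullet> a) * ?dd b b) = (x \<bullet> x) * laplacian p x"
    by (simp add: laplacian_eq sum_distrib_left[symmetric] sum_distrib_right[symmetric] n2)
  have S2: "(\<Sum>a\<in>Basis. \<Sum>b\<in>Basis. (x \<bullet> b) * (x \<bullet> b) * ?dd a a) = (x \<bullet> x) * laplacian p x"
    using S1 by (subst sum.swap) simp
  have S3: "(\<Sum>a\<in>Basis. \<Sum>b\<in>Basis. (x \<bullet> a) * ((x \<bullet> b) * ?dd b a)) = ?Q"
    by (simp add: sum_distrib_left)
  have S4: "(\<Sum>a\<in>Basis. \<Sum>b\<in>Basis. (x \<bullet> b) * ((x \<bullet> a) * ?dd a b)) = ?Q"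
    unfolding S3[symmetric] by (rule sum.swap)
  have S5: "(\<Sum>a\<in>Basis. \<Sum>b\<in>(Basis::'a set). (x \<bullet> a) * ?d a) = DIM('a) * ?E"
    by (simp add: sum_distrib_left)
  have S6: "(\<Sum>a\<in>(Basis::'a set). \<Sum>b\<in>Basis. (x \<bullet> b) * ?d b) = DIM('a) * ?E"
    by simp
  have S7: "(\<Sum>a\<in>Basis. \<Sum>b\<in>Basis. (if a = b then (x \<bullet> a) * ?d a else 0)) = ?E"
    by simp
  have "(\<Sum>a\<in>Basis. \<Sum>b\<in>Basis. angular_deriv a b (angular_deriv a b p) x)
     = ?E + (x \<bullet> x) * laplacian p x - DIM('a) * ?E - ?Q - DIM('a) * ?E - ?Q + ?E + (x \<bullet> x) * laplacian p x"
  proof -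
    have "(\<Sum>a\<in>Basis. \<Sum>b\<in>Basis. angular_deriv a b (angular_deriv a b p) x)
      = (\<Sum>a\<in>Basis. \<Sum>b\<in>Basis. (if a = b then (x \<bullet> a) * ?d a else 0) + (x \<bullet> a) * (x \<bullet> a) * ?dd b b
          - (x \<bullet> a) * ?d a - (x \<bullet> a) * ((x \<bullet> b) * ?dd b a) - (x \<bullet> b) * ?d b - (x \<bullet> b) * ((x \<bullet> a) * ?dd a b)
          + (if a = b then (x \<bullet> a) * ?d a else 0) + (x \<bullet> b) * (x \<bullet> b) * ?dd a a)"
      by (intro sum.cong refl 1)
    then show ?thesis by (simp only: sum.distrib sum_subtractf S1 S2 S3 S4 S5 S6 S7)
  qed
  then show ?thesis unfolding sphere_laplacian_def by (simp add: algebra_simps)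
qed

text \<open>By Euler's identity the first-order term contributes d l and the second-order term l (l
  - 1), which add up to l (l + d - 1). The case split on l deals with the truncated l - 1.\<close>

lemma sphere_laplacian_harmonic:
  assumes h: "harmonic_poly l (h :: 'a::euclidean_space \<Rightarrow> real)" and D: "DIM('a) = d + 1"
  shows "sphere_laplacian h x = - sphere_eigenvalue d l * h x"
proof -
  have hl: "homog_poly l h" and lap: "laplacian h x = 0" using h by (auto simp: harmonic_poly_def)
  have "(\<Sum>a\<in>Basis. (x \<bullet> a) * (\<Sum>b\<in>Basis. (x \<bullet> b) * partial_deriv b (partial_deriv a h) x))
     = real (l - 1) * (real l * h x)"
    by (simp add: homog_euler[OF homog_partial_deriv[OF hl]] homog_euler[OF hl, symmetric] sum_distrib_left ac_simps)
  then show ?thesis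
    by (cases l) (simp_all add: sphere_laplacian_eq[OF homog_rp[OF hl]] lap homog_euler[OF hl] D sphere_eigenvalue_def algebra_simps)
qed

text \<open>Eigenfunctions of a symmetric operator for distinct eigenvalues. The difference of the
  eigenvalues is (l - m)(l + m + d - 1), whose second factor is positive because d >= 1 and l, m are
  not both 0.\<close>

lemma harmonic_orthogonal:
  assumes h: "harmonic_poly l (h :: 'a::euclidean_space \<Rightarrow> real)" and g: "harmonic_poly m g" and "l \<noteq> m"
    and D: "DIM('a) = d + 1" "d \<ge> 1"
  shows "(LINT x|sphere_measure. h x * g x) = 0"
proof -
  have "(LINT x|sphere_measure. sphere_laplacian h x * g x) = (LINT x|sphere_measure. h x * sphere_laplacian g x)"
    using h g by (intro sphere_laplacian_symmetric homog_rp) (auto simp: harmonic_poly_def)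
  moreover have "(LINT x|sphere_measure. sphere_laplacian h x * g x) = - sphere_eigenvalue d l * (LINT x|sphere_measure. h x * g x)"
    by (subst integral_mult_right_zero[symmetric]) (simp add: sphere_laplacian_harmonic[OF h D(1)] mult.assoc)
  moreover have "(LINT x|sphere_measure. h x * sphere_laplacian g x) = - sphere_eigenvalue d m * (LINT x|sphere_measure. h x * g x)"
    by (subst integral_mult_right_zero[symmetric]) (simp add: sphere_laplacian_harmonic[OF g D(1)] ac_simps)
  ultimately have "sphere_eigenvalue d l * (LINT x|sphere_measure. h x * g x) = sphere_eigenvalue d m * (LINT x|sphere_measure. h x * g x)"
    by simp
  moreover have "sphere_eigenvalue d l \<noteq> sphere_eigenvalue d m"
  proof
    assume "sphere_eigenvalue d l = sphere_eigenvalue d m"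
    then have "(real l - real m) * (real l + real m + real d - 1) = 0"
      by (simp add: sphere_eigenvalue_def algebra_simps)
    moreover have "real l + real m + real d - 1 > 0"
      using \<open>l \<noteq> m\<close> D(2) by linarith
    ultimately show False using \<open>l \<noteq> m\<close> by simp
  qed
  ultimately show ?thesis by simp
qed

text \<open>Rotations preserve the sphere, so p and q agree along the whole orbit of x and have the
  same derivative there. This lets the basis functions, which are prescribed only on the sphere, be
  exchanged for polynomials.\<close>

lemma angular_deriv_sphere_cong:
  assumes ab: "a \<in> Basis" "b \<in> Basis"
    and pq: "real_polynomial_function p" "real_polynomial_function q" "\<And>x. x \<in> sphere 0 1 \<Longrightarrow> p x = q x"
    and x: "x \<in> sphere 0 1"
  shows "angular_deriv a b p x = angular_deriv a b q x"
proof (cases "a = b")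
  case False
  have "(\<lambda>t. p (plane_rotation a b t x)) = (\<lambda>t. q (plane_rotation a b t x))"
    using pq(3) plane_rotation_sphere[OF ab False x] by blast
  with angular_deriv_chain[OF ab False pq(1), of x 0] angular_deriv_chain[OF ab False pq(2), of x 0]
  show ?thesis by (auto dest: DERIV_unique)
qed simp

lemma sphere_laplacian_sphere_cong:
  assumes pq: "real_polynomial_function p" "real_polynomial_function q" "\<And>x. x \<in> sphere 0 1 \<Longrightarrow> p x = q x"
    and x: "x \<in> sphere 0 1"
  shows "sphere_laplacian p x = sphere_laplacian q x"
proof -
  have "angular_deriv a b (angular_deriv a b p) x = angular_deriv a b (angular_deriv a b q) x"
    if ab: "a \<in> Basis" "b \<in> Basis" for a b
    by (rule angular_deriv_sphere_cong[OF ab rp_angular_deriv[OF pq(1)] rp_angular_deriv[OF pq(2)] _ x])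
       (rule angular_deriv_sphere_cong[OF ab pq])
  then show ?thesis unfolding sphere_laplacian_def by simp
qed

lemma angular_deriv_lincomb:
  assumes "\<And>i. i \<in> I \<Longrightarrow> real_polynomial_function (f i)"
  shows "angular_deriv a b (\<lambda>x. \<Sum>i\<in>I. c i * f i x) = (\<lambda>x. \<Sum>i\<in>I. c i * angular_deriv a b (f i) x)"
  using assms by (simp add: angular_deriv_def[abs_def] partial_deriv_sum partial_deriv_cmult rp_cmult
      sum_distrib_left sum_subtractf[symmetric] algebra_simps)

lemma sphere_laplacian_lincomb:
  assumes "\<And>i. i \<in> I \<Longrightarrow> real_polynomial_function (f i)"
  shows "sphere_laplacian (\<lambda>x. \<Sum>i\<in>I. c i * f i x) x = (\<Sum>i\<in>I. c i * sphere_laplacian (f i) x)"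
proof -
  have "sphere_laplacian (\<lambda>x. \<Sum>i\<in>I. c i * f i x) x
    = (\<Sum>a\<in>Basis. \<Sum>b\<in>Basis. \<Sum>i\<in>I. c i * angular_deriv a b (angular_deriv a b (f i)) x) / 2"
    using assms by (simp add: sphere_laplacian_def angular_deriv_lincomb rp_angular_deriv)
  also have "\<dots> = (\<Sum>a\<in>Basis. \<Sum>i\<in>I. \<Sum>b\<in>Basis. c i * angular_deriv a b (angular_deriv a b (f i)) x) / 2"
    by (subst sum.swap) simp
  also have "\<dots> = (\<Sum>i\<in>I. \<Sum>a\<in>Basis. \<Sum>b\<in>Basis. c i * angular_deriv a b (angular_deriv a b (f i)) x) / 2"
    by (subst sum.swap) simp
  also have "\<dots> = (\<Sum>i\<in>I. c i * sphere_laplacian (f i) x)"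
    by (simp add: sphere_laplacian_def sum_distrib_left sum_divide_distrib)
  finally show ?thesis .
qed

section \<open>Minimum principle on the sphere\<close>

lemma second_deriv_nonneg_at_min:
  fixes f f' :: "real \<Rightarrow> real"
  assumes f: "\<And>t. (f has_real_derivative f' t) (at t)" and f': "(f' has_real_derivative D) (at 0)"
    and min: "\<And>t. f 0 \<le> f t"
  shows "D \<ge> 0"
proof (rule ccontr)
  assume "\<not> D \<ge> 0"
  then have D: "D < 0" by simp
  \<comment> \<open>At the minimum f' vanishes; a negative D would make f' negative just to the
    right of 0 and push f below its minimum.\<close>
  have "f' 0 = 0" using DERIV_local_min[OF f[of 0], of 1] min by auto
  obtain d where d: "d > 0" "\<And>h. h > 0 \<Longrightarrow> h < d \<Longrightarrow> f' h < f' 0"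
    using DERIV_neg_dec_right[OF f' D] by auto
  have "0 < d / 2" using d by simp
  then obtain z where z: "0 < z" "z < d / 2" "f (d / 2) - f 0 = (d / 2 - 0) * f' z"
    using MVT2[of 0 "d/2" f f'] f by blast
  then have "f' z < 0" using d(2)[of z] \<open>f' 0 = 0\<close> by simp
  then have "(d / 2 - 0) * f' z < 0" using d(1) by (simp add: mult_pos_neg)
  then have "f (d / 2) < f 0" using z(3) by linarith
  then show False using min[of "d / 2"] by simp
qed

text \<open>Each squared angular derivative is the second derivative at t = 0 of p along a rotation
  orbit that starts at the minimum x.\<close>

lemma sphere_laplacian_nonneg_at_min:
  assumes p: "real_polynomial_function p" and x: "x \<in> sphere 0 1"
    and min: "\<And>y. y \<in> sphere 0 1 \<Longrightarrow> p x \<le> p y"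
  shows "sphere_laplacian p x \<ge> 0"
proof -
  have "angular_deriv a b (angular_deriv a b p) x \<ge> 0" if ab: "a \<in> Basis" "b \<in> Basis" for a b
  proof (cases "a = b")
    case False
    show ?thesis
    proof (rule second_deriv_nonneg_at_min)
      show "((\<lambda>t. p (plane_rotation a b t x)) has_real_derivative angular_deriv a b p (plane_rotation a b t x)) (at t)" for t
        by (rule angular_deriv_chain[OF ab False p])
      show "((\<lambda>t. angular_deriv a b p (plane_rotation a b t x)) has_real_derivative angular_deriv a b (angular_deriv a b p) x) (at 0)"
        using angular_deriv_chain[OF ab False rp_angular_deriv[OF p, of a b], of x 0] by simp
      show "p (plane_rotation a b 0 x) \<le> p (plane_rotation a b t x)" for t
        using min plane_rotation_sphere[OF ab False x] by simp
    qed
  qed simp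
  then show ?thesis unfolding sphere_laplacian_def by (intro divide_nonneg_nonneg sum_nonneg) auto
qed

section \<open>Finite-dimensional function spaces on the sphere\<close>

text \<open>Equality is tested only on the sphere, because functions there are represented by
  arbitrary extensions to the whole space.\<close>

definition lin_span :: "'i set \<Rightarrow> ('i \<Rightarrow> 'a::euclidean_space \<Rightarrow> real) \<Rightarrow> ('a \<Rightarrow> real) \<Rightarrow> bool" where
  "lin_span J g f \<longleftrightarrow> (\<exists>c. \<forall>x\<in>sphere 0 1. f x = (\<Sum>j\<in>J. c j * g j x))"

lemma lin_span_base: "finite J \<Longrightarrow> j \<in> J \<Longrightarrow> lin_span J g (g j)"
  unfolding lin_span_def
  by (rule exI[of _ "\<lambda>i. if i = j then 1 else 0"]) (simp add: if_distrib[of "\<lambda>u. u * _"] cong: if_cong)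

lemma lin_span_zero: "lin_span J g (\<lambda>x. 0)"
  unfolding lin_span_def by (rule exI[of _ "\<lambda>i. 0"]) simp

lemma lin_span_add: "lin_span J g f \<Longrightarrow> lin_span J g h \<Longrightarrow> lin_span J g (\<lambda>x. f x + h x)"
  unfolding lin_span_def
proof (elim exE)
  fix c c' assume "\<forall>x\<in>sphere 0 1. f x = (\<Sum>j\<in>J. c j * g j x)" "\<forall>x\<in>sphere 0 1. h x = (\<Sum>j\<in>J. c' j * g j x)"
  then show "\<exists>c. \<forall>x\<in>sphere 0 1. f x + h x = (\<Sum>j\<in>J. c j * g j x)"
    by (intro exI[of _ "\<lambda>j. c j + c' j"]) (simp add: distrib_right sum.distrib)
qed

lemma lin_span_cmult: "lin_span J g f \<Longrightarrow> lin_span J g (\<lambda>x. k * f x)"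
  unfolding lin_span_def
proof (elim exE)
  fix c assume "\<forall>x\<in>sphere 0 1. f x = (\<Sum>j\<in>J. c j * g j x)"
  then show "\<exists>c. \<forall>x\<in>sphere 0 1. k * f x = (\<Sum>j\<in>J. c j * g j x)"
    by (intro exI[of _ "\<lambda>j. k * c j"]) (simp add: sum_distrib_left mult.assoc)
qed

lemma lin_span_sum: "(\<And>i. i \<in> I \<Longrightarrow> lin_span J g (f i)) \<Longrightarrow> lin_span J g (\<lambda>x. \<Sum>i\<in>I. f i x)"
  by (induction I rule: infinite_finite_induct) (auto intro: lin_span_add lin_span_zero)

lemma lin_span_cong: "lin_span J g f \<Longrightarrow> (\<And>x. x \<in> sphere 0 1 \<Longrightarrow> f x = h x) \<Longrightarrow> lin_span J g h"
  unfolding lin_span_def by metis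

lemma lin_span_mono:
  assumes "finite K" "J \<subseteq> K" "lin_span J g f"
  shows "lin_span K g f"
proof -
  obtain c where c: "\<And>x. x \<in> sphere 0 1 \<Longrightarrow> f x = (\<Sum>j\<in>J. c j * g j x)"
    using assms(3) unfolding lin_span_def by blast
  have "lin_span K g (\<lambda>x. \<Sum>j\<in>J. c j * g j x)"
    using assms(1,2) by (intro lin_span_sum lin_span_cmult lin_span_base) auto
  then show ?thesis by (rule lin_span_cong) (simp add: c)
qed

text \<open>Gaussian elimination: the unknown i0 with pivot \<open>A i0 j0\<close> is removed
  together with the equation j0, which leaves more unknowns than equations.\<close>

lemma homogeneous_system_solution:
  fixes A :: "'i \<Rightarrow> 'j \<Rightarrow> real"
  assumes "finite J"
  shows "finite I \<Longrightarrow> card J < card I \<Longrightarrow> \<exists>c. (\<exists>i\<in>I. c i \<noteq> 0) \<and> (\<forall>j\<in>J. (\<Sum>i\<in>I. c i * A i j) = 0)"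
  using assms
proof (induction J arbitrary: I A rule: finite_induct)
  case empty
  then have "I \<noteq> {}" by auto
  then show ?case by (intro exI[of _ "\<lambda>_. 1"]) auto
next
  case (insert j0 J)
  show ?case
  proof (cases "\<forall>i\<in>I. A i j0 = 0")
    case True
    obtain c where "\<exists>i\<in>I. c i \<noteq> 0" "\<forall>j\<in>J. (\<Sum>i\<in>I. c i * A i j) = 0"
      using insert.IH[of I A] insert.prems insert.hyps by auto
    then show ?thesis using True by (intro exI[of _ c]) auto
  next
    case False
    then obtain i0 where i0: "i0 \<in> I" "A i0 j0 \<noteq> 0" by auto
    define I' where "I' = I - {i0}"
    have I': "finite I'" "i0 \<notin> I'" "I = insert i0 I'" "card J < card I'"
      using insert.prems insert.hyps i0 by (auto simp: I'_def)
    obtain c where c: "\<exists>i\<in>I'. c i \<noteq> 0" "\<And>j. j \<in> J \<Longrightarrow> (\<Sum>i\<in>I'. c i * (A i j - A i j0 / A i0 j0 * A i0 j)) = 0"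
      using insert.IH[of I' "\<lambda>i j. A i j - A i j0 / A i0 j0 * A i0 j"] I' by auto
    \<comment> \<open>Value of the eliminated unknown that solves equation j0; the reduced system
      says that it also fits the remaining equations.\<close>
    define k where "k = - (\<Sum>i\<in>I'. c i * A i j0) / A i0 j0"
    define c' where "c' = c(i0 := k)"
    have S: "(\<Sum>i\<in>I. c' i * A i j) = k * A i0 j + (\<Sum>i\<in>I'. c i * A i j)" for j
    proof -
      have "(\<Sum>i\<in>I'. c' i * A i j) = (\<Sum>i\<in>I'. c i * A i j)"
        using I'(2) by (intro sum.cong) (auto simp: c'_def)
      then show ?thesis using I' by (simp add: c'_def)
    qed
    have "(\<Sum>i\<in>I. c' i * A i j) = 0" if "j \<in> insert j0 J" for j
    proof (cases "j = j0")
      case True then show ?thesis unfolding S using i0 by (simp add: k_def)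
    next
      case False
      then have j: "j \<in> J" using that by simp
      have "0 = (\<Sum>i\<in>I'. c i * A i j) - (\<Sum>i\<in>I'. c i * A i j0) / A i0 j0 * A i0 j"
        using c(2)[OF j] by (simp add: right_diff_distrib sum_subtractf sum_divide_distrib sum_distrib_right mult.assoc)
      then show ?thesis unfolding S by (simp add: k_def)
    qed
    moreover have "\<exists>i\<in>I. c' i \<noteq> 0" using c(1) I' by (auto simp: c'_def)
    ultimately show ?thesis by blast
  qed
qed

text \<open>With fewer spanning functions than members, some nontrivial combination of the functions
  y i vanishes on the sphere; integrating it against a member with nonzero coefficient contradicts
  orthonormality.\<close>

lemma orthonormal_card_le:
  fixes y :: "'i \<Rightarrow> 'a::euclidean_space \<Rightarrow> real"
  assumes fin: "finite I" "finite J" and cont: "\<And>i. i \<in> I \<Longrightarrow> continuous_on (sphere 0 1) (y i)"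
    and orth: "\<And>i j. i \<in> I \<Longrightarrow> j \<in> I \<Longrightarrow> (LINT x|sphere_measure. y i x * y j x) = (if i = j then 1 else 0)"
    and span: "\<And>i. i \<in> I \<Longrightarrow> lin_span J g (y i)"
  shows "card I \<le> card J"
proof (rule ccontr)
  assume "\<not> card I \<le> card J"
  obtain A where A: "\<And>i x. i \<in> I \<Longrightarrow> x \<in> sphere 0 1 \<Longrightarrow> y i x = (\<Sum>j\<in>J. A i j * g j x)"
    using span unfolding lin_span_def by metis
  obtain c i0 where c: "i0 \<in> I" "c i0 \<noteq> 0" "\<And>j. j \<in> J \<Longrightarrow> (\<Sum>i\<in>I. c i * A i j) = 0"
    using homogeneous_system_solution[OF fin(2) fin(1), of A] \<open>\<not> card I \<le> card J\<close> by auto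
  have 0: "(\<Sum>i\<in>I. c i * y i x) = 0" if x: "x \<in> sphere 0 1" for x
  proof -
    have "(\<Sum>i\<in>I. c i * y i x) = (\<Sum>i\<in>I. \<Sum>j\<in>J. c i * A i j * g j x)"
      by (intro sum.cong) (auto simp: A[OF _ x] sum_distrib_left mult.assoc)
    also have "\<dots> = (\<Sum>j\<in>J. (\<Sum>i\<in>I. c i * A i j) * g j x)"
      by (subst sum.swap) (simp add: sum_distrib_right)
    finally show ?thesis by (simp add: c(3))
  qed
  have "0 = (LINT x|sphere_measure. (\<Sum>i\<in>I. c i * y i x) * y i0 x)"
    by (subst Bochner_Integration.integral_cong[where g="\<lambda>x. 0"]) (auto simp: 0)
  also have "\<dots> = (LINT x|sphere_measure. (\<Sum>i\<in>I. c i * (y i x * y i0 x)))"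
    by (simp add: sum_distrib_right mult.assoc)
  also have "\<dots> = (\<Sum>i\<in>I. c i * (LINT x|sphere_measure. y i x * y i0 x))"
    using cont c(1) by (subst Bochner_Integration.integral_sum)
      (auto intro!: integrable_mult_right integrable_sphere_continuous continuous_on_mult)
  also have "\<dots> = (\<Sum>i\<in>I. if i = i0 then c i0 else 0)"
    using orth c(1) by (intro sum.cong) auto
  also have "\<dots> = c i0" using c(1) fin by simp
  finally show False using c(2) by simp
qed

text \<open>On the sphere, even powers of one distinguished coordinate can be eliminated, which brings
  the dimension of the space of polynomials of degree n down from order \<open>n\<^sup>d\<^sup>+\<^sup>1\<close> to \<open>n\<^sup>d\<close>.\<close>

definition sphere_monomial :: "'a::euclidean_space \<Rightarrow> nat \<times> ('a \<Rightarrow> nat) \<Rightarrow> 'a \<Rightarrow> real" where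
  "sphere_monomial e j x = (x \<bullet> e) ^ fst j * (\<Prod>b\<in>Basis - {e}. (x \<bullet> b) ^ snd j b)"

text \<open>The extensional function space keeps this set finite: two choices for the exponent of e
  and n + 1 for every other coordinate.\<close>

definition monomial_index :: "'a::euclidean_space \<Rightarrow> nat \<Rightarrow> (nat \<times> ('a \<Rightarrow> nat)) set" where
  "monomial_index e n = {j \<in> {..1} \<times> (Basis - {e} \<rightarrow>\<^sub>E {..n}). fst j + sum (snd j) (Basis - {e}) \<le> n}"

lemma monomial_index_card:
  fixes e :: "'a::euclidean_space"
  assumes "e \<in> Basis"
  shows "finite (monomial_index e n)" "card (monomial_index e n) \<le> 2 * (n + 1) ^ (DIM('a) - 1)"
proof -
  let ?S = "{..1::nat} \<times> (Basis - {e} \<rightarrow>\<^sub>E {..n})"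
  have fin: "finite ?S" by (intro finite_cartesian_product finite_PiE) auto
  have sub: "monomial_index e n \<subseteq> ?S" by (auto simp: monomial_index_def)
  show "finite (monomial_index e n)" using finite_subset[OF sub fin] .
  have "card (monomial_index e n) \<le> card ?S" by (rule card_mono[OF fin sub])
  also have "\<dots> = 2 * (n + 1) ^ (DIM('a) - 1)"
    using assms by (simp add: card_cartesian_product card_PiE card_Diff_singleton)
  finally show "card (monomial_index e n) \<le> 2 * (n + 1) ^ (DIM('a) - 1)" .
qed

lemma sphere_monomial_upd:
  assumes b: "b \<in> Basis - {e}"
  shows "sphere_monomial e (\<epsilon>, \<alpha>(b := \<alpha> b + k)) x = (x \<bullet> b) ^ k * sphere_monomial e (\<epsilon>, \<alpha>) x"
proof -
  have "(\<Prod>b'\<in>Basis - {e} - {b}. (x \<bullet> b') ^ (\<alpha>(b := \<alpha> b + k)) b') = (\<Prod>b'\<in>Basis - {e} - {b}. (x \<bullet> b') ^ \<alpha> b')"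
    by (intro prod.cong) auto
  then show ?thesis unfolding sphere_monomial_def
    using b by (simp add: prod.remove[of "Basis - {e}" b] power_add)
qed

text \<open>Covers both ways of absorbing a factor: k = 1 with \<epsilon>' = \<epsilon> for
  multiplication by another coordinate, and \<epsilon> = 1, \<epsilon>' = 0, k = 2 for replacing the
  square of the coordinate e. In both the total degree grows by at most one.\<close>

lemma monomial_index_upd:
  assumes b: "b \<in> Basis - {e}" and j: "(\<epsilon>, \<alpha>) \<in> monomial_index e n"
    and le: "\<epsilon>' \<le> 1" "\<epsilon>' + k \<le> \<epsilon> + 1"
  shows "(\<epsilon>', \<alpha>(b := \<alpha> b + k)) \<in> monomial_index e (Suc n)"
proof -
  let ?\<beta> = "\<alpha>(b := \<alpha> b + k)"
  have fin: "finite (Basis - {e})" by simp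
  have "sum ?\<beta> (Basis - {e} - {b}) = sum \<alpha> (Basis - {e} - {b})" by (intro sum.cong) auto
  then have S: "sum ?\<beta> (Basis - {e}) = sum \<alpha> (Basis - {e}) + k"
    using b by (simp add: sum.remove[of "Basis - {e}" b])
  have tot: "\<epsilon>' + sum ?\<beta> (Basis - {e}) \<le> Suc n" using j le S by (auto simp: monomial_index_def)
  have "?\<beta> b' \<le> Suc n" if "b' \<in> Basis - {e}" for b'
    using member_le_sum[OF that, of ?\<beta>] tot fin by simp
  then have "?\<beta> \<in> Basis - {e} \<rightarrow>\<^sub>E {..Suc n}"
    using j b by (auto simp: monomial_index_def PiE_iff extensional_def)
  then show ?thesis using tot le by (simp add: monomial_index_def)
qed

lemma monomial_index_Suc: "(\<epsilon>, \<alpha>) \<in> monomial_index e n \<Longrightarrow> \<epsilon>' \<le> 1 \<Longrightarrow> \<epsilon>' \<le> \<epsilon> + 1 \<Longrightarrow> (\<epsilon>', \<alpha>) \<in> monomial_index e (Suc n)"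
  by (auto simp: monomial_index_def PiE_iff) (metis le_SucI DiffI singletonD)+

lemma lin_span_monomial_inner:
  fixes e :: "'a::euclidean_space"
  assumes e: "e \<in> Basis" and f: "lin_span (monomial_index e n) (sphere_monomial e) f" and b: "b \<in> Basis"
  shows "lin_span (monomial_index e (Suc n)) (sphere_monomial e) (\<lambda>x. (x \<bullet> b) * f x)"
proof -
  note fin = monomial_index_card(1)[OF e]
  let ?L = "lin_span (monomial_index e (Suc n)) (sphere_monomial e)"
  have step: "?L (\<lambda>x. (x \<bullet> b) * sphere_monomial e j x)" if j: "j \<in> monomial_index e n" for j
  proof -
    obtain \<epsilon> \<alpha> where j': "j = (\<epsilon>, \<alpha>)" by force
    have j: "(\<epsilon>, \<alpha>) \<in> monomial_index e n" using that j' by simp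
    have "\<epsilon> \<le> 1" using j unfolding monomial_index_def by simp
    then have eps: "\<epsilon> = 0 \<or> \<epsilon> = 1" by linarith
    show ?thesis
    proof (cases "b = e")
      case False
      then have b': "b \<in> Basis - {e}" using b by simp
      have "?L (sphere_monomial e (\<epsilon>, \<alpha>(b := \<alpha> b + 1)))"
        using monomial_index_upd[OF b' j, of \<epsilon> 1] eps by (intro lin_span_base fin) auto
      then show ?thesis by (rule lin_span_cong) (simp only: j' sphere_monomial_upd[OF b'] power_one_right)
    next
      case True
      show ?thesis
      proof (cases "\<epsilon> = 0")
        case e0: True
        have "?L (sphere_monomial e (1, \<alpha>))"
          using monomial_index_Suc[OF j, of 1] by (intro lin_span_base fin) auto
        then show ?thesis
          by (rule lin_span_cong) (simp add: j' e0 True sphere_monomial_def)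
      next
        case False
        \<comment> \<open>Second factor of the coordinate e: on the sphere its square is 1 minus the
          squares of the other coordinates, so the exponent of e drops to 0 and the total degree
          stays within n + 1.\<close>
        then have e1: "\<epsilon> = 1" using eps by simp
        have "?L (\<lambda>x. sphere_monomial e (0, \<alpha>) x + (-1) * (\<Sum>b\<in>Basis - {e}. sphere_monomial e (0, \<alpha>(b := \<alpha> b + 2)) x))"
          using monomial_index_Suc[OF j, of 0] monomial_index_upd[OF _ j, of _ 0 2] e1
          by (intro lin_span_add lin_span_cmult lin_span_sum lin_span_base fin) auto
        then show ?thesis
        proof (rule lin_span_cong)
          fix x :: 'a assume x: "x \<in> sphere 0 1"
          have "1 = x \<bullet> x" using x by (simp add: dot_square_norm)
          also have "\<dots> = (x \<bullet> e) ^ 2 + (\<Sum>b\<in>Basis - {e}. (x \<bullet> b) ^ 2)"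
            using e by (subst euclidean_inner) (simp add: sum.remove power2_eq_square)
          finally have *: "(x \<bullet> e) ^ 2 = 1 - (\<Sum>b\<in>Basis - {e}. (x \<bullet> b) ^ 2)" by simp
          have "(x \<bullet> b) * sphere_monomial e j x = (x \<bullet> e) ^ 2 * sphere_monomial e (0, \<alpha>) x"
            by (simp add: j' e1 True sphere_monomial_def power2_eq_square)
          also have "\<dots> = sphere_monomial e (0, \<alpha>) x + (-1) * (\<Sum>b\<in>Basis - {e}. (x \<bullet> b) ^ 2 * sphere_monomial e (0, \<alpha>) x)"
            unfolding * by (simp add: left_diff_distrib sum_distrib_right)
          also have "(\<Sum>b\<in>Basis - {e}. (x \<bullet> b) ^ 2 * sphere_monomial e (0, \<alpha>) x)
              = (\<Sum>b\<in>Basis - {e}. sphere_monomial e (0, \<alpha>(b := \<alpha> b + 2)) x)"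
            by (intro sum.cong refl sphere_monomial_upd[symmetric])
          finally show "sphere_monomial e (0, \<alpha>) x + (-1) * (\<Sum>b\<in>Basis - {e}. sphere_monomial e (0, \<alpha>(b := \<alpha> b + 2)) x)
             = (x \<bullet> b) * sphere_monomial e j x" by simp
        qed
      qed
    qed
  qed
  obtain c where c: "\<And>x. x \<in> sphere 0 1 \<Longrightarrow> f x = (\<Sum>j\<in>monomial_index e n. c j * sphere_monomial e j x)"
    using f unfolding lin_span_def by blast
  have "?L (\<lambda>x. \<Sum>j\<in>monomial_index e n. c j * ((x \<bullet> b) * sphere_monomial e j x))"
    using step by (intro lin_span_sum lin_span_cmult)
  then show ?thesis by (rule lin_span_cong) (simp add: c sum_distrib_left ac_simps)
qed

lemma lin_span_monomial:
  fixes e :: "'a::euclidean_space"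
  assumes e: "e \<in> Basis"
  shows "homog_poly n p \<Longrightarrow> lin_span (monomial_index e n) (sphere_monomial e) p"
proof (induction rule: homog_poly.induct)
  case (homog_const c)
  \<comment> \<open>Zero exponents on \<open>Basis - {e}\<close>, and \<open>undefined\<close>
    elsewhere as the extensional function space demands.\<close>
  define \<alpha> where "\<alpha> = (\<lambda>b. if b \<in> Basis - {e} then 0 else undefined :: nat)"
  have "(0, \<alpha>) \<in> monomial_index e 0" by (auto simp: monomial_index_def \<alpha>_def)
  then have "lin_span (monomial_index e 0) (sphere_monomial e) (\<lambda>x. c * sphere_monomial e (0, \<alpha>) x)"
    by (intro lin_span_cmult lin_span_base monomial_index_card(1)[OF e])
  then show ?case by (rule lin_span_cong) (simp add: sphere_monomial_def \<alpha>_def)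
next
  case (homog_inner n p b)
  have "lin_span (monomial_index e (Suc n)) (sphere_monomial e) (\<lambda>x. \<Sum>b'\<in>Basis. (b \<bullet> b') * ((x \<bullet> b') * p x))"
    using homog_inner.IH by (intro lin_span_sum lin_span_cmult lin_span_monomial_inner e) auto
  then show ?case
    by (rule lin_span_cong) (simp add: euclidean_inner[of _ b] sum_distrib_left ac_simps)
next
  case (homog_add n p q) then show ?case by (intro lin_span_add)
qed

lemma lin_span_monomial_mono:
  assumes "e \<in> Basis" "n \<le> m" "lin_span (monomial_index e n) (sphere_monomial e) f"
  shows "lin_span (monomial_index e m) (sphere_monomial e) f"
proof (rule lin_span_mono[OF monomial_index_card(1)[OF assms(1)] _ assms(3)])
  show "monomial_index e n \<subseteq> monomial_index e m"
  proof
    fix j assume "j \<in> monomial_index e n"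
    moreover from this have "snd j b \<le> m" if "b \<in> Basis - {e}" for b
    proof -
      have "snd j \<in> Basis - {e} \<rightarrow>\<^sub>E {..n}"
        using \<open>j \<in> monomial_index e n\<close> unfolding monomial_index_def mem_Times_iff by blast
      from PiE_mem[OF this that] have "snd j b \<le> n" by simp
      then show ?thesis using assms(2) by simp
    qed
    ultimately show "j \<in> monomial_index e m"
      using assms(2) unfolding monomial_index_def mem_Times_iff PiE_iff by auto
  qed
qed

lemma homog_orthogonal_transformation:
  fixes R :: "'a::euclidean_space \<Rightarrow> 'a"
  assumes R: "linear R"
  shows "homog_poly n p \<Longrightarrow> homog_poly n (\<lambda>x. p (R x))"
proof (induction rule: homog_poly.induct)
  case (homog_const c) show ?case by (rule homog_poly.homog_const)
next
  case (homog_inner n p b)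
  from homog_poly.homog_inner[OF homog_inner.IH, of "adjoint R b"] show ?case
    by (simp add: adjoint_works[OF R])
next
  case (homog_add n p q) then show ?case by (intro homog_poly.homog_add)
qed

section \<open>Harmonic expansions\<close>

locale harmonic_basis =
  fixes d :: nat and Z :: "nat \<Rightarrow> nat" and Y :: "nat \<Rightarrow> nat \<Rightarrow> 'a::euclidean_space \<Rightarrow> real"
  assumes dim: "DIM('a) = d + 1" and d_pos: "d \<ge> 1" and basis: "harmonic_orthonormal_basis Z Y"
begin

definition idx :: "nat \<Rightarrow> (nat \<times> nat) set" where
  "idx N = (SIGMA l:{..N}. {1..Z l})"

definition harm :: "nat \<times> nat \<Rightarrow> 'a \<Rightarrow> real" where
  "harm i = Y (fst i) (snd i)"

definition eig :: "nat \<times> nat \<Rightarrow> real" where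
  "eig i = sphere_eigenvalue d (fst i)"

definition coeff :: "('a \<Rightarrow> real) \<Rightarrow> nat \<times> nat \<Rightarrow> real" where
  "coeff f i = (LINT x|sphere_measure. f x * harm i x)"

definition valid_idx :: "nat \<times> nat \<Rightarrow> bool" where
  "valid_idx i \<longleftrightarrow> snd i \<in> {1..Z (fst i)}"

abbreviation poly_space :: "nat \<Rightarrow> ('a \<Rightarrow> real) \<Rightarrow> bool" where
  "poly_space N \<equiv> lin_span (idx N) harm"

lemma finite_idx [simp]: "finite (idx N)"
  by (simp add: idx_def)

lemma idx_iff: "i \<in> idx N \<longleftrightarrow> valid_idx i \<and> fst i \<le> N"
  by (cases i) (auto simp: idx_def valid_idx_def)

lemma idx_mono: "N \<le> M \<Longrightarrow> idx N \<subseteq> idx M"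
  by (auto simp: idx_iff)

lemma idx_valid: "i \<in> idx N \<Longrightarrow> valid_idx i"
  by (simp add: idx_iff)

lemma sum_idx: "(\<Sum>i\<in>idx N. g i) = (\<Sum>l\<le>N. \<Sum>k=1..Z l. g (l, k))"
  unfolding idx_def by (subst sum.Sigma) auto

lemma eig_nonneg: "eig i \<ge> 0"
  using d_pos by (simp add: eig_def sphere_eigenvalue_def)

lemma harm_poly:
  assumes "valid_idx i"
  obtains h where "harmonic_poly (fst i) h" "\<And>x. x \<in> sphere 0 1 \<Longrightarrow> harm i x = h x"
proof -
  have "spherical_harmonic (fst i) (harm i)"
    using basis assms unfolding harmonic_orthonormal_basis_def valid_idx_def harm_def by blast
  then show ?thesis using that unfolding spherical_harmonic_iff by blast
qed

lemma harm_continuous: "valid_idx i \<Longrightarrow> continuous_on (sphere 0 1) (harm i)"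
proof -
  assume "valid_idx i"
  then obtain h where h: "harmonic_poly (fst i) h" "\<And>x. x \<in> sphere 0 1 \<Longrightarrow> harm i x = h x"
    using harm_poly by blast
  then have "continuous_on (sphere 0 1) h"
    by (intro rp_continuous homog_rp) (auto simp: harmonic_poly_def)
  then show ?thesis by (rule continuous_on_eq) (simp only: h(2))
qed

lemma LINT_sphere_cong:
  "(\<And>x. x \<in> sphere (0::'a) 1 \<Longrightarrow> f x = g x) \<Longrightarrow> (LINT x|sphere_measure. f x) = (LINT x|sphere_measure. g x :: real)"
  by (intro Bochner_Integration.integral_cong) auto

lemma harm_orthonormal:
  assumes i: "valid_idx i" and j: "valid_idx j"
  shows "(LINT x|sphere_measure. harm i x * harm j x) = (if i = j then 1 else 0)"
proof (cases "fst i = fst j")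
  case True
  then show ?thesis using basis i j unfolding harmonic_orthonormal_basis_def valid_idx_def harm_def
    by (cases i; cases j) auto
next
  case False
  obtain h g where h: "harmonic_poly (fst i) h" "\<And>x. x \<in> sphere 0 1 \<Longrightarrow> harm i x = h x"
    and g: "harmonic_poly (fst j) g" "\<And>x. x \<in> sphere 0 1 \<Longrightarrow> harm j x = g x"
    using harm_poly[OF i] harm_poly[OF j] by metis
  have "(LINT x|sphere_measure. harm i x * harm j x) = (LINT x|sphere_measure. h x * g x)"
    by (rule LINT_sphere_cong) (simp only: h g)
  also have "\<dots> = 0" by (rule harmonic_orthogonal[OF h(1) g(1) False dim d_pos])
  finally show ?thesis using False by auto
qed

lemma poly_space_mono: "N \<le> M \<Longrightarrow> poly_space N f \<Longrightarrow> poly_space M f"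
  by (rule lin_span_mono[OF finite_idx idx_mono])

lemma poly_space_continuous:
  assumes "poly_space N f" shows "continuous_on (sphere 0 1) f"
proof -
  obtain c where c: "\<And>x. x \<in> sphere 0 1 \<Longrightarrow> f x = (\<Sum>i\<in>idx N. c i * harm i x)"
    using assms unfolding lin_span_def by blast
  have "continuous_on (sphere 0 1) (\<lambda>x. \<Sum>i\<in>idx N. c i * harm i x)"
    by (intro continuous_on_sum continuous_on_mult continuous_on_const harm_continuous) (simp add: idx_iff)
  then show ?thesis by (rule continuous_on_eq) (simp add: c)
qed

lemma poly_space_harmonic:
  assumes "harmonic_poly l h" "l \<le> N" shows "poly_space N h"
proof -
  have "spherical_harmonic l h" using assms(1) spherical_harmonic_iff by blast
  then obtain c where c: "\<And>x. x \<in> sphere 0 1 \<Longrightarrow> h x = (\<Sum>k=1..Z l. c k * Y l k x)"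
    using basis unfolding harmonic_orthonormal_basis_def by blast
  have "poly_space N (\<lambda>x. \<Sum>k=1..Z l. c k * harm (l, k) x)"
    by (intro lin_span_sum lin_span_cmult lin_span_base finite_idx) (use assms in \<open>auto simp: idx_iff valid_idx_def\<close>)
  then show ?thesis by (rule lin_span_cong) (simp add: c harm_def)
qed

text \<open>Restrict the Fischer decomposition to the sphere, where every factor |x|^2 becomes
  1.\<close>

lemma poly_space_homog:
  assumes "homog_poly n p" "n \<le> N" shows "poly_space N p"
proof -
  obtain h where h: "\<And>j. j \<le> n div 2 \<Longrightarrow> harmonic_poly (n - 2 * j) (h j)"
    "\<And>x. p x = (\<Sum>j\<le>n div 2. (x \<bullet> x) ^ j * h j x)"
    using fischer_decomposition[OF assms(1)] by blast
  have "poly_space N (\<lambda>x. \<Sum>j\<le>n div 2. h j x)"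
    by (intro lin_span_sum poly_space_harmonic[OF h(1)]) (use assms(2) in auto)
  then show ?thesis by (rule lin_span_cong) (simp add: h(2) dot_square_norm)
qed

lemma poly_space_poly:
  assumes "real_polynomial_function p" shows "\<exists>N. poly_space N p"
proof -
  obtain N h where h: "\<And>i. homog_poly i (h i)" "\<And>x. p x = (\<Sum>i\<le>N. h i x)"
    using homog_sums_components[OF rp_homog_sums[OF assms]] by auto
  have "poly_space N (\<lambda>x. \<Sum>i\<le>N. h i x)"
    by (intro lin_span_sum poly_space_homog[OF h(1)]) auto
  then show ?thesis using lin_span_cong[of "idx N" harm _ p] h(2) by auto
qed

lemma poly_space_const: "poly_space N (\<lambda>x. c)"
  by (rule poly_space_homog[OF homog_const]) simp

text \<open>The product of homogeneous representatives is homogeneous of the sum of the degrees, and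
  the Fischer decomposition re-expands it in harmonics of at most that degree.\<close>

lemma poly_space_mult:
  assumes "poly_space N f" "poly_space M g" shows "poly_space (N + M) (\<lambda>x. f x * g x)"
proof -
  obtain c where c: "\<And>x. x \<in> sphere 0 1 \<Longrightarrow> f x = (\<Sum>i\<in>idx N. c i * harm i x)"
    using assms(1) unfolding lin_span_def by blast
  obtain c' where c': "\<And>x. x \<in> sphere 0 1 \<Longrightarrow> g x = (\<Sum>i\<in>idx M. c' i * harm i x)"
    using assms(2) unfolding lin_span_def by blast
  have hh: "poly_space (N + M) (\<lambda>x. harm i x * harm j x)" if i: "i \<in> idx N" and j: "j \<in> idx M" for i j
  proof -
    obtain h g where h: "harmonic_poly (fst i) h" "\<And>x. x \<in> sphere 0 1 \<Longrightarrow> harm i x = h x"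
      and g: "harmonic_poly (fst j) g" "\<And>x. x \<in> sphere 0 1 \<Longrightarrow> harm j x = g x"
      using harm_poly[OF idx_valid[OF i]] harm_poly[OF idx_valid[OF j]] by metis
    have "poly_space (N + M) (\<lambda>x. h x * g x)"
      using h(1) g(1) i j by (intro poly_space_homog[OF homog_mult]) (auto simp: harmonic_poly_def idx_iff)
    then show ?thesis by (rule lin_span_cong) (simp add: h g)
  qed
  have "poly_space (N + M) (\<lambda>x. \<Sum>i\<in>idx N. \<Sum>j\<in>idx M. c i * (c' j * (harm i x * harm j x)))"
    using hh by (intro lin_span_sum lin_span_cmult)
  then show ?thesis by (rule lin_span_cong) (simp only: c c' sum_product, simp add: mult.assoc mult.left_commute)
qed

lemma poly_space_orthogonal_transformation:
  assumes R: "orthogonal_transformation (R :: 'a \<Rightarrow> 'a)" and f: "poly_space N f"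
  shows "poly_space N (\<lambda>x. f (R x))"
proof -
  have lR: "linear R" and sR: "\<And>x. x \<in> sphere 0 1 \<Longrightarrow> R x \<in> sphere 0 1"
    using R by (auto simp: orthogonal_transformation)
  obtain c where c: "\<And>x. x \<in> sphere 0 1 \<Longrightarrow> f x = (\<Sum>i\<in>idx N. c i * harm i x)"
    using f unfolding lin_span_def by blast
  have hh: "poly_space N (\<lambda>x. harm i (R x))" if i: "i \<in> idx N" for i
  proof -
    obtain h where h: "harmonic_poly (fst i) h" "\<And>x. x \<in> sphere 0 1 \<Longrightarrow> harm i x = h x"
      using harm_poly[OF idx_valid[OF i]] by metis
    have "poly_space N (\<lambda>x. h (R x))"
      using h(1) i by (intro poly_space_homog[OF homog_orthogonal_transformation[OF lR]]) (auto simp: harmonic_poly_def idx_iff)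
    then show ?thesis by (rule lin_span_cong) (simp add: h(2)[OF sR])
  qed
  have "poly_space N (\<lambda>x. \<Sum>i\<in>idx N. c i * harm i (R x))"
    using hh by (intro lin_span_sum lin_span_cmult)
  then show ?thesis by (rule lin_span_cong) (simp add: c[OF sR])
qed

lemma coeff_lincomb:
  assumes "\<And>i. i \<in> J \<Longrightarrow> valid_idx i" "valid_idx j" "finite J"
    "\<And>x. x \<in> sphere 0 1 \<Longrightarrow> f x = (\<Sum>i\<in>J. c i * harm i x)"
  shows "coeff f j = (if j \<in> J then c j else 0)"
proof -
  have "coeff f j = (LINT x|sphere_measure. (\<Sum>i\<in>J. c i * (harm i x * harm j x)))"
    unfolding coeff_def by (rule LINT_sphere_cong) (simp only: assms(4) sum_distrib_right mult.assoc)
  also have "\<dots> = (\<Sum>i\<in>J. c i * (LINT x|sphere_measure. harm i x * harm j x))"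
    using assms by (subst Bochner_Integration.integral_sum)
      (auto intro!: integrable_mult_right integrable_sphere_continuous continuous_on_mult harm_continuous)
  also have "\<dots> = (\<Sum>i\<in>J. if i = j then c j else 0)"
    using assms by (intro sum.cong) (auto simp: harm_orthonormal)
  finally show ?thesis using assms(3) by simp
qed

lemma poly_space_expand:
  assumes "poly_space N f" "x \<in> sphere 0 1"
  shows "f x = (\<Sum>i\<in>idx N. coeff f i * harm i x)"
proof -
  obtain c where c: "\<And>x. x \<in> sphere 0 1 \<Longrightarrow> f x = (\<Sum>i\<in>idx N. c i * harm i x)"
    using assms(1) unfolding lin_span_def by blast
  have "coeff f i = c i" if "i \<in> idx N" for i
    using coeff_lincomb[OF idx_valid idx_valid[OF that] finite_idx c] that by simp
  then show ?thesis using c[OF assms(2)] by simp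
qed

lemma poly_space_coeff_0:
  assumes "poly_space N f" "valid_idx j" "fst j > N" shows "coeff f j = 0"
proof -
  have "coeff f j = (if j \<in> idx N then coeff f j else 0)"
    by (rule coeff_lincomb[OF idx_valid assms(2) finite_idx poly_space_expand[OF assms(1)]])
  then show ?thesis using assms(3) by (simp add: idx_iff split: if_splits)
qed

lemma parseval:
  assumes f: "poly_space N f" and g: "continuous_on (sphere 0 1) g"
  shows "(LINT x|sphere_measure. f x * g x) = (\<Sum>i\<in>idx N. coeff f i * coeff g i)"
proof -
  have "(LINT x|sphere_measure. f x * g x) = (LINT x|sphere_measure. (\<Sum>i\<in>idx N. coeff f i * (g x * harm i x)))"
    by (rule LINT_sphere_cong) (simp only: poly_space_expand[OF f], simp add: sum_distrib_left ac_simps)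
  also have "\<dots> = (\<Sum>i\<in>idx N. coeff f i * coeff g i)"
    unfolding coeff_def using g by (subst Bochner_Integration.integral_sum)
      (auto intro!: integrable_mult_right integrable_sphere_continuous continuous_on_mult harm_continuous idx_valid)
  finally show ?thesis .
qed

lemma poly_space_partial_sum: "poly_space N (\<lambda>x. \<Sum>i\<in>idx N. c i * harm i x)"
  by (intro lin_span_sum lin_span_cmult lin_span_base finite_idx)

lemma coeff_partial_sum:
  "valid_idx j \<Longrightarrow> coeff (\<lambda>x. \<Sum>i\<in>idx N. c i * harm i x) j = (if j \<in> idx N then c j else 0)"
  by (rule coeff_lincomb) (auto simp: idx_valid)

lemma bessel:
  assumes g: "continuous_on (sphere 0 1) g"
  shows "(\<Sum>i\<in>idx N. (coeff g i)\<^sup>2) \<le> (LINT x|sphere_measure. (g x)\<^sup>2)"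
proof -
  define f where "f = (\<lambda>x. \<Sum>i\<in>idx N. coeff g i * harm i x)"
  have f: "poly_space N f" unfolding f_def by (rule poly_space_partial_sum)
  have cf: "coeff f i = coeff g i" if "i \<in> idx N" for i
    using coeff_partial_sum[OF idx_valid[OF that], of "coeff g"] that by (simp add: f_def)
  note fc = poly_space_continuous[OF f]
  let ?S = "\<Sum>i\<in>idx N. (coeff g i)\<^sup>2"
  have 1: "(LINT x|sphere_measure. f x * g x) = ?S" "(LINT x|sphere_measure. f x * f x) = ?S"
    using parseval[OF f g] parseval[OF f fc] by (simp_all add: cf power2_eq_square)
  have "0 \<le> (LINT x|sphere_measure. (g x - f x)\<^sup>2)" by (rule integral_nonneg_AE) simp
  also have "\<dots> = (LINT x|sphere_measure. (g x)\<^sup>2 - 2 * (f x * g x) + f x * f x)"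
    by (simp add: power2_eq_square algebra_simps)
  also have "\<dots> = (LINT x|sphere_measure. (g x)\<^sup>2) - 2 * ?S + ?S"
    using 1 fc g
    by (simp add: integrable_sphere_continuous continuous_intros)
  finally show ?thesis by simp
qed

text \<open>Such an f is orthogonal to all polynomials. If p approximates f uniformly, the integral
  of f^2 equals that of f (f - p), which is arbitrarily small.\<close>

lemma completeness:
  assumes f: "continuous_on (sphere 0 1) f" and 0: "\<And>i. valid_idx i \<Longrightarrow> coeff f i = 0"
    and x: "x \<in> sphere 0 1"
  shows "f x = 0"
proof -
  interpret prob_space "sphere_measure :: 'a measure" by (rule prob_space_sphere_measure)
  obtain B where B: "B > 0" "\<And>x. x \<in> sphere 0 1 \<Longrightarrow> \<bar>f x\<bar> \<le> B"
    using bounded_sphere_continuous[OF f] by blast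
  have "(LINT x|sphere_measure. (f x)\<^sup>2) \<le> 0 + \<epsilon>" if e: "\<epsilon> > 0" for \<epsilon>
  proof -
    obtain p where p: "real_polynomial_function p" "\<And>x. x \<in> sphere 0 1 \<Longrightarrow> \<bar>f x - p x\<bar> < \<epsilon> / B"
      using Stone_Weierstrass_real_polynomial_function[of "sphere 0 1" f "\<epsilon> / B"] f e B by auto
    obtain N where N: "poly_space N p" using poly_space_poly[OF p(1)] by blast
    have pf: "(LINT x|sphere_measure. p x * f x) = 0"
      using parseval[OF N f] 0 by (simp add: idx_valid)
    have ip: "integrable sphere_measure (\<lambda>x. p x * f x)" "integrable sphere_measure (\<lambda>x. (f x)\<^sup>2)"
      using f rp_continuous[OF p(1)] by (auto intro!: integrable_sphere_continuous continuous_intros)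
    have "(LINT x|sphere_measure. (f x)\<^sup>2) = (LINT x|sphere_measure. (f x)\<^sup>2 - p x * f x)"
      using ip pf by simp
    also have "\<dots> \<le> (LINT (x::'a)|sphere_measure. \<epsilon>)"
    proof (rule integral_mono)
      fix x :: 'a assume "x \<in> space sphere_measure"
      then have x: "x \<in> sphere 0 1" by simp
      have "(f x)\<^sup>2 - p x * f x \<le> \<bar>f x - p x\<bar> * \<bar>f x\<bar>"
        by (simp add: power2_eq_square flip: left_diff_distrib abs_mult)
      also have "\<dots> \<le> (\<epsilon> / B) * B" using p(2)[OF x] B(2)[OF x] B(1) e by (intro mult_mono) auto
      finally show "(f x)\<^sup>2 - p x * f x \<le> \<epsilon>" using B(1) by simp
    qed (use ip in auto)
    also have "\<dots> = \<epsilon>" using prob_space by simp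
    finally show ?thesis by simp
  qed
  then have "(LINT x|sphere_measure. (f x)\<^sup>2) \<le> 0" by (rule field_le_epsilon)
  then have "(f x)\<^sup>2 = 0"
    using f x by (intro continuous_nonneg_integral_0[of "\<lambda>x. (f x)\<^sup>2"]) (auto intro!: continuous_intros)
  then show ?thesis by simp
qed

lemma poly_space_bound:
  assumes f: "poly_space N f" and x: "x \<in> sphere 0 1"
  shows "(f x)\<^sup>2 \<le> (\<Sum>i\<in>idx N. (coeff f i)\<^sup>2) * (\<Sum>i\<in>idx N. (harm i x)\<^sup>2)"
  unfolding poly_space_expand[OF f x] by (rule Cauchy_Schwarz_ineq_sum)

text \<open>The diagonal of the reproducing kernel is constant because the space of polynomials of
  degree at most N is invariant under rotations.\<close>

lemma christoffel_le:
  assumes x: "x \<in> sphere 0 1" and y: "y \<in> sphere 0 1"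
  shows "(\<Sum>i\<in>idx N. (harm i y)\<^sup>2) \<le> (\<Sum>i\<in>idx N. (harm i x)\<^sup>2)"
proof -
  obtain R where R: "orthogonal_transformation R" "R x = y"
    using orthogonal_transformation_unit_vectors[of x y] x y by auto
  define S where "S = (\<lambda>x. \<Sum>i\<in>idx N. (harm i x)\<^sup>2)"
  \<comment> \<open>The reproducing kernel of degree N centred at y. Composed with R it takes the
    value S y at x and keeps its squared L2 norm S y, so the pointwise bound at x bounds (S y)^2 by
    the product of S y and S x.\<close>
  define p where "p = (\<lambda>z. \<Sum>i\<in>idx N. harm i y * harm i z)"
  have p: "poly_space N p" unfolding p_def by (rule poly_space_partial_sum)
  have q: "poly_space N (\<lambda>z. p (R z))" by (rule poly_space_orthogonal_transformation[OF R(1) p])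
  note pc = poly_space_continuous[OF p] and qc = poly_space_continuous[OF q]
  have cp: "coeff p i = harm i y" if "i \<in> idx N" for i
    using coeff_partial_sum[OF idx_valid[OF that], of "\<lambda>i. harm i y"] that by (simp add: p_def)
  have "(\<Sum>i\<in>idx N. (coeff (\<lambda>z. p (R z)) i)\<^sup>2) = (LINT z|sphere_measure. p (R z) * p (R z))"
    using parseval[OF q qc] by (simp add: power2_eq_square)
  also have "\<dots> = (LINT z|sphere_measure. p z * p z)"
    using pc by (intro integral_sphere_orthogonal[OF R(1), of "\<lambda>z. p z * p z"] borel_measurable_sphere_continuous continuous_on_mult)
  also have "\<dots> = S y"
    using parseval[OF p pc] by (simp add: cp S_def power2_eq_square)
  finally have nq: "(\<Sum>i\<in>idx N. (coeff (\<lambda>z. p (R z)) i)\<^sup>2) = S y" .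
  have "S y = p (R x)" by (simp add: p_def S_def R(2) power2_eq_square)
  then have "(S y)\<^sup>2 \<le> S y * S x" using poly_space_bound[OF q x] nq by (simp add: S_def)
  moreover have "S y \<ge> 0" "S x \<ge> 0" by (simp_all add: S_def sum_nonneg)
  ultimately have "S y \<le> S x"
    by (cases "S y = 0") (auto simp: power2_eq_square mult_le_cancel_left)
  then show ?thesis by (simp add: S_def)
qed

text \<open>A constant equals its mean over the sphere, and orthonormality evaluates the
  mean.\<close>

lemma christoffel_eq:
  assumes x: "x \<in> sphere 0 1"
  shows "(\<Sum>i\<in>idx N. (harm i x)\<^sup>2) = card (idx N)"
proof -
  interpret prob_space "sphere_measure :: 'a measure" by (rule prob_space_sphere_measure)
  let ?S = "\<lambda>x. \<Sum>i\<in>idx N. (harm i x)\<^sup>2"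
  have "?S x = (LINT (y::'a)|sphere_measure. ?S x)" using prob_space by simp
  also have "\<dots> = (LINT y|sphere_measure. ?S y)"
    by (intro LINT_sphere_cong antisym christoffel_le x)
  also have "\<dots> = (\<Sum>i\<in>idx N. (LINT y|sphere_measure. harm i y * harm i y))"
    by (subst Bochner_Integration.integral_sum)
       (auto simp: power2_eq_square intro!: integrable_sphere_continuous continuous_on_mult harm_continuous idx_valid)
  also have "\<dots> = card (idx N)" by (simp add: harm_orthonormal idx_valid)
  finally show ?thesis .
qed

text \<open>Subtract \<open>christoffel_eq\<close> for l - 1 from the one for l.\<close>

lemma addition_theorem_diagonal:
  assumes x: "x \<in> sphere 0 1"
  shows "(\<Sum>k=1..Z l. (Y l k x)\<^sup>2) = Z l"
proof -
  have S: "(\<Sum>l\<le>N. \<Sum>k=1..Z l. (Y l k x)\<^sup>2) = (\<Sum>l\<le>N. real (Z l))" for N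
    using christoffel_eq[OF x, of N] by (simp add: sum_idx harm_def) (simp add: idx_def)
  show ?thesis
  proof (cases l)
    case 0 then show ?thesis using S[of 0] by simp
  next
    case (Suc n) then show ?thesis using S[of l] S[of n] by simp
  qed
qed

text \<open>The harmonics up to degree N are an orthonormal family inside the span of the reduced
  monomials, so counting the latter suffices.\<close>

lemma card_idx_le: "card (idx N) \<le> 2 * (N + 1) ^ d"
proof -
  obtain e :: 'a where e: "e \<in> Basis" using nonempty_Basis by blast
  have sp: "lin_span (monomial_index e N) (sphere_monomial e) (harm i)" if i: "i \<in> idx N" for i
  proof -
    obtain h where h: "harmonic_poly (fst i) h" "\<And>x. x \<in> sphere 0 1 \<Longrightarrow> harm i x = h x"
      using harm_poly[OF idx_valid[OF i]] by metis
    have "lin_span (monomial_index e N) (sphere_monomial e) h"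
    proof (rule lin_span_monomial_mono[OF e])
      show "fst i \<le> N" using i by (simp add: idx_iff)
      show "lin_span (monomial_index e (fst i)) (sphere_monomial e) h"
        using h(1) by (intro lin_span_monomial e) (simp add: harmonic_poly_def)
    qed
    then show ?thesis by (rule lin_span_cong) (simp add: h)
  qed
  have "card (idx N) \<le> card (monomial_index e N)"
    by (rule orthonormal_card_le[OF finite_idx monomial_index_card(1)[OF e] harm_continuous[OF idx_valid]
        harm_orthonormal[OF idx_valid idx_valid] sp])
  also have "\<dots> \<le> 2 * (N + 1) ^ d" using monomial_index_card(2)[OF e, of N] dim by simp
  finally show ?thesis .
qed

end

section \<open>Sums over the spectrum\<close>

text \<open>Only the partial sums of the multiplicities are controlled; Abel summation turns this into
  bounds for sums against decreasing weights.\<close>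

lemma abel_majorization:
  fixes a b z :: "nat \<Rightarrow> real"
  assumes a: "\<And>l. a (Suc l) \<le> a l" "\<And>l. a l \<ge> 0"
    and le: "\<And>N. (\<Sum>l\<le>N. z l) \<le> (\<Sum>l\<le>N. b l)"
  shows "(\<Sum>l\<le>N. z l * a l) \<le> (\<Sum>l\<le>N. b l * a l)"
proof -
  define u where "u = (\<lambda>l. b l - z l)"
  have U: "(\<Sum>l\<le>N. u l) \<ge> 0" for N using le[of N] by (simp add: u_def sum_subtractf)
  have "(\<Sum>l\<le>N. u l) * a N \<le> (\<Sum>l\<le>N. u l * a l)"
  proof (induction N)
    case (Suc N)
    have "(\<Sum>l\<le>N. u l) * a (Suc N) \<le> (\<Sum>l\<le>N. u l) * a N"
      by (rule mult_left_mono[OF a(1) U])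
    then show ?case using Suc.IH by (simp add: algebra_simps)
  qed simp
  then have "0 \<le> (\<Sum>l\<le>N. u l * a l)" using U[of N] a(2)[of N] by (meson mult_nonneg_nonneg order_trans)
  then show ?thesis by (simp add: u_def left_diff_distrib sum_subtractf)
qed

lemma power_Suc_diff_le:
  fixes x :: real
  assumes "x \<ge> 0"
  shows "(x + 1) ^ n - x ^ n \<le> real n * (x + 1) ^ (n - 1)"
proof (induction n)
  case (Suc n)
  have "(x + 1) ^ Suc n - x ^ Suc n = (x + 1) * ((x + 1) ^ n - x ^ n) + x ^ n"
    by (simp add: algebra_simps)
  also have "\<dots> \<le> (x + 1) * (real n * (x + 1) ^ (n - 1)) + (x + 1) ^ n"
    using assms Suc.IH by (intro add_mono mult_left_mono power_mono) auto
  also have "\<dots> = real (Suc n) * (x + 1) ^ (Suc n - 1)"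
    by (cases n) (simp_all add: algebra_simps)
  finally show ?case .
qed simp

text \<open>Telescoping: for consecutive values p and q of 1 + u l, 1/q^2 <= 1/(p q) = (1/p -
  1/q)/u.\<close>

lemma sum_inverse_square_le:
  fixes u :: real
  assumes u: "u > 0"
  shows "(\<Sum>l\<le>N. 1 / (1 + u * real l)\<^sup>2) \<le> 1 + 1 / u"
proof -
  have "(\<Sum>l\<le>N. 1 / (1 + u * real l)\<^sup>2) \<le> 1 + 1 / u * (1 - 1 / (1 + u * real N))"
  proof (induction N)
    case (Suc N)
    let ?p = "1 + u * real N" and ?q = "1 + u * real (Suc N)"
    have p: "?p > 0" "?q > 0" "?p \<le> ?q" using u by (auto intro: add_pos_nonneg mult_left_mono)
    have "1 / ?q\<^sup>2 \<le> 1 / (?p * ?q)"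
      using p by (intro divide_left_mono) (auto simp: power2_eq_square intro: mult_right_mono)
    also have "\<dots> = 1 / u * (1 / ?p - 1 / ?q)"
    proof -
      have "1 / ?p - 1 / ?q = (?q - ?p) / (?p * ?q)" using p by (simp add: diff_frac_eq)
      also have "?q - ?p = u" by (simp add: algebra_simps)
      finally show ?thesis using u by simp
    qed
    finally show ?case using Suc.IH by (simp add: right_diff_distrib)
  qed simp
  also have "1 / u * (1 - 1 / (1 + u * real N)) \<le> 1 / u * 1"
    using u by (intro mult_left_mono) auto
  finally show ?thesis by simp
qed

text \<open>From 1 + x <= exp x and k x - x^2 <= k^2.\<close>

lemma power_le_exp_square:
  fixes x :: real
  assumes "x \<ge> 0"
  shows "(1 + x) ^ k * exp (- (x\<^sup>2)) \<le> exp ((real k)\<^sup>2)"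
proof -
  have "(1 + x) ^ k \<le> exp x ^ k" using assms by (intro power_mono) auto
  also have "\<dots> = exp (real k * x)" by (simp add: exp_of_nat_mult)
  finally have "(1 + x) ^ k * exp (- (x\<^sup>2)) \<le> exp (real k * x) * exp (- (x\<^sup>2))"
    by (intro mult_right_mono) auto
  also have "\<dots> = exp (real k * x - x\<^sup>2)" by (simp add: exp_add[symmetric])
  also have "\<dots> \<le> exp ((real k)\<^sup>2)"
  proof -
    have "0 \<le> (real k - x)\<^sup>2 + real k * x" using assms by (intro add_nonneg_nonneg) auto
    then have "real k * x - x\<^sup>2 \<le> (real k)\<^sup>2" by (simp add: power2_diff mult.commute)
    then show ?thesis by simp
  qed
  finally show ?thesis .
qed

lemma nonneg_sums_bounded:
  fixes f :: "nat \<Rightarrow> real"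
  assumes "\<And>l. f l \<ge> 0" "\<And>N. (\<Sum>l\<le>N. f l) \<le> B"
  shows "summable f" "suminf f \<le> B"
proof -
  have *: "(\<Sum>l<n. f l) \<le> B" for n
  proof -
    have "(\<Sum>l<n. f l) \<le> (\<Sum>l\<le>n. f l)" by (rule sum_mono2) (auto simp: assms)
    then show ?thesis using assms(2)[of n] by simp
  qed
  show "summable f" by (rule summableI_nonneg_bounded[OF assms(1) *])
  then show "suminf f \<le> B" by (rule suminf_le_const) (rule *)
qed

lemma sum_le_suminf_atMost:
  fixes f :: "nat \<Rightarrow> real"
  assumes "summable f" "\<And>l. f l \<ge> 0"
  shows "(\<Sum>l\<le>N. f l) \<le> suminf f"
  using assms by (intro sum_le_suminf) auto

lemma suminf_cauchy_schwarz:
  fixes a b :: "nat \<Rightarrow> real"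
  assumes a: "summable a" "\<And>l. a l \<ge> 0" and b: "summable b" "\<And>l. b l \<ge> 0"
  shows "summable (\<lambda>l. sqrt (a l) * sqrt (b l))" "(\<Sum>l. sqrt (a l) * sqrt (b l)) \<le> sqrt (suminf a) * sqrt (suminf b)"
proof -
  have *: "(\<Sum>l\<le>N. sqrt (a l) * sqrt (b l)) \<le> sqrt (suminf a) * sqrt (suminf b)" for N
  proof -
    have "(\<Sum>l\<le>N. sqrt (a l) * sqrt (b l))\<^sup>2 \<le> (\<Sum>l\<le>N. (sqrt (a l))\<^sup>2) * (\<Sum>l\<le>N. (sqrt (b l))\<^sup>2)"
      by (rule Cauchy_Schwarz_ineq_sum)
    also have "\<dots> \<le> suminf a * suminf b"
      using a b by (intro mult_mono) (auto intro: sum_le_suminf_atMost sum_nonneg suminf_nonneg)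
    finally show ?thesis
      by (metis real_le_rsqrt real_sqrt_mult)
  qed
  show "summable (\<lambda>l. sqrt (a l) * sqrt (b l))" "(\<Sum>l. sqrt (a l) * sqrt (b l)) \<le> sqrt (suminf a) * sqrt (suminf b)"
    using a b by (auto intro!: nonneg_sums_bounded * mult_nonneg_nonneg)
qed

lemma continuous_on_sphere_suminf:
  fixes f :: "nat \<Rightarrow> 'a::euclidean_space \<Rightarrow> real"
  assumes f: "\<And>l. continuous_on (sphere 0 1) (f l)" and M: "\<And>l x. x \<in> sphere 0 1 \<Longrightarrow> \<bar>f l x\<bar> \<le> M l" "summable M"
  shows "continuous_on (sphere 0 1) (\<lambda>x. \<Sum>l. f l x)"
proof (rule uniform_limit_theorem)
  show "uniform_limit (sphere 0 1) (\<lambda>n x. \<Sum>l<n. f l x) (\<lambda>x. \<Sum>l. f l x) sequentially"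
    using M by (intro Weierstrass_m_test) auto
qed (auto intro!: always_eventually continuous_on_sum f)

lemma integral_sphere_suminf:
  fixes f :: "nat \<Rightarrow> 'a::euclidean_space \<Rightarrow> real"
  assumes f: "\<And>l. continuous_on (sphere 0 1) (f l)" and M: "\<And>l x. x \<in> sphere 0 1 \<Longrightarrow> \<bar>f l x\<bar> \<le> M l" "summable M"
  shows "(LINT x|sphere_measure. (\<Sum>l. f l x)) = (\<Sum>l. LINT x|sphere_measure. f l x)"
proof (rule integral_suminf)
  interpret prob_space "sphere_measure :: 'a measure" by (rule prob_space_sphere_measure)
  show "integrable sphere_measure (f l)" for l by (rule integrable_sphere_continuous[OF f])
  show "AE x in sphere_measure. summable (\<lambda>l. norm (f l x))"
    using M by (intro AE_I2 summable_comparison_test'[OF M(2)]) auto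
  show "summable (\<lambda>l. LINT x|sphere_measure. norm (f l x))"
  proof (rule summable_comparison_test'[OF M(2)])
    fix l
    have "(LINT x|sphere_measure. norm (f l x)) \<le> (LINT (x::'a)|sphere_measure. M l)"
      using M(1)[of _ l] by (intro integral_mono integrable_norm integrable_sphere_continuous[OF f]) auto
    then show "norm (LINT x|sphere_measure. norm (f l x)) \<le> M l"
      using prob_space by (simp add: integral_nonneg_AE)
  qed
qed

section \<open>Growth of eigenvalues and multiplicities\<close>

context harmonic_basis
begin

abbreviation lam :: "nat \<Rightarrow> real" where "lam \<equiv> sphere_eigenvalue d"

lemma lam_mono: "l \<le> m \<Longrightarrow> lam l \<le> lam m"
  unfolding sphere_eigenvalue_def using d_pos by (intro mult_mono) auto

lemma lam_nonneg: "lam l \<ge> 0"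
  unfolding sphere_eigenvalue_def using d_pos by simp

lemma lam_ge_square: "(real l)\<^sup>2 \<le> lam l"
  unfolding sphere_eigenvalue_def power2_eq_square using d_pos by (intro mult_left_mono) auto

text \<open>From 2 l m <= l^2 + m^2 <= \<lambda>_l + \<lambda>_m. It separates the weight at the
  degree l + m of a product into the weights of its factors.\<close>

lemma lam_add_le: "1 + lam (l + m) \<le> 2 * ((1 + lam l) * (1 + lam m))"
proof -
  have "0 \<le> (real l - real m)\<^sup>2" by simp
  then have "2 * (real l * real m) \<le> (real l)\<^sup>2 + (real m)\<^sup>2" by (simp add: power2_diff)
  also have "\<dots> \<le> lam l + lam m" using lam_ge_square add_mono by blast
  finally have "2 * (real l * real m) \<le> lam l + lam m" .
  moreover have "lam (l + m) = lam l + lam m + 2 * (real l * real m)"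
    by (simp add: sphere_eigenvalue_def algebra_simps)
  moreover have "0 \<le> lam l * lam m" using lam_nonneg by simp
  ultimately show ?thesis by (simp add: algebra_simps)
qed

lemma multiplicity_sum_le:
  assumes a: "\<And>l. a (Suc l) \<le> a l" "\<And>l. a l \<ge> 0"
  shows "(\<Sum>l\<le>N. real (Z l) * a l) \<le> (\<Sum>l\<le>N. 2 * real d * (real l + 1) ^ (d - 1) * a l)"
proof -
  \<comment> \<open>The increments of the bound 2 (N+1)^d on the partial sums of Z; as d >= 1 they
    telescope to it exactly.\<close>
  define b where "b = (\<lambda>l. 2 * ((real l + 1) ^ d - real l ^ d))"
  have "(\<Sum>l\<le>N. real (Z l)) \<le> (\<Sum>l\<le>N. b l)" for N
  proof -
    have "(\<Sum>l\<le>N. b l) = 2 * (real N + 1) ^ d"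
      by (induction N) (use d_pos in \<open>auto simp: b_def algebra_simps\<close>)
    moreover have "real (card (idx N)) \<le> real (2 * (N + 1) ^ d)"
      using card_idx_le of_nat_le_iff by blast
    moreover have "card (idx N) = (\<Sum>l\<le>N. Z l)" by (simp add: idx_def)
    ultimately show ?thesis by (simp add: add.commute)
  qed
  then have "(\<Sum>l\<le>N. real (Z l) * a l) \<le> (\<Sum>l\<le>N. b l * a l)"
    by (intro abel_majorization a)
  also have "\<dots> \<le> (\<Sum>l\<le>N. 2 * real d * (real l + 1) ^ (d - 1) * a l)"
  proof (intro sum_mono mult_right_mono a(2))
    fix l
    show "b l \<le> 2 * real d * (real l + 1) ^ (d - 1)"
      using power_Suc_diff_le[of "real l" d] by (simp add: b_def mult.assoc del: One_nat_def)
  qed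
  finally show ?thesis .
qed

text \<open>Summation by parts replaces Z_l by a multiple of (l+1)^(d-1), and 1 + \<lambda>_l is at
  least (l+1)^2/2; the resulting exponent d - 1 - 2 t is below -1 exactly when t > d/2.\<close>

lemma multiplicity_powr_summable:
  assumes t: "t > d / 2"
  shows "summable (\<lambda>l. (1 + lam l) powr (- t) * real (Z l))"
proof -
  define g where "g = (\<lambda>l. 2 * real d * 2 powr t * (real (Suc l)) powr (real d - 1 - 2 * t))"
  have "summable (\<lambda>l. real l powr (real d - 1 - 2 * t))"
    using t by (subst summable_real_powr_iff) (simp add: field_simps)
  then have "summable (\<lambda>l. (real (Suc l)) powr (real d - 1 - 2 * t))"
    by (subst (asm) summable_Suc_iff[symmetric])
  then have g: "summable g" unfolding g_def by (rule summable_mult)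
  have t0: "t > 0" using t d_pos by (auto intro: le_less_trans[of _ "d/2"])
  have dec: "(1 + lam (Suc l)) powr - t \<le> (1 + lam l) powr - t" for l
    using t0 lam_nonneg lam_mono[of l "Suc l"] by (intro powr_mono2') (auto simp: add_pos_nonneg)
  have "(\<Sum>l\<le>N. (1 + lam l) powr (- t) * real (Z l)) \<le> suminf g" for N
  proof -
    have "(\<Sum>l\<le>N. (1 + lam l) powr (- t) * real (Z l)) = (\<Sum>l\<le>N. real (Z l) * (1 + lam l) powr (- t))"
      by (simp add: mult.commute)
    also have "\<dots> \<le> (\<Sum>l\<le>N. 2 * real d * (real l + 1) ^ (d - 1) * (1 + lam l) powr (- t))"
      by (rule multiplicity_sum_le) (use dec in auto)
    also have "\<dots> \<le> (\<Sum>l\<le>N. g l)"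
    proof (rule sum_mono)
      fix l
      have "(real l + 1)\<^sup>2 / 2 \<le> 1 + (real l)\<^sup>2"
        using zero_le_power2[of "real l - 1"] by (simp add: power2_eq_square field_simps)
      also have "\<dots> \<le> 1 + lam l" using lam_ge_square by simp
      finally have "(1 + lam l) powr (- t) \<le> ((real l + 1)\<^sup>2 / 2) powr (- t)"
        using t0 by (intro powr_mono2') auto
      also have "\<dots> = 2 powr t * (real l + 1) powr (- 2 * t)"
        by (simp add: powr_divide powr_minus_divide powr_powr flip: powr_numeral)
      finally have "(real l + 1) ^ (d - 1) * (1 + lam l) powr (- t)
          \<le> (real l + 1) ^ (d - 1) * (2 powr t * (real l + 1) powr (- 2 * t))"
        by (intro mult_left_mono) auto
      also have "\<dots> = 2 powr t * ((real l + 1) powr real (d - 1) * (real l + 1) powr (- 2 * t))"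
        by (simp add: powr_realpow)
      also have "\<dots> = 2 powr t * (real l + 1) powr (real d - 1 - 2 * t)"
        using d_pos by (simp add: powr_add[symmetric] of_nat_diff)
      finally have "2 * real d * ((real l + 1) ^ (d - 1) * (1 + lam l) powr (- t))
         \<le> 2 * real d * (2 powr t * (real l + 1) powr (real d - 1 - 2 * t))"
        by (intro mult_left_mono) auto
      then show "2 * real d * (real l + 1) ^ (d - 1) * (1 + lam l) powr (- t) \<le> g l"
        by (simp add: g_def ac_simps)
    qed
    also have "\<dots> \<le> suminf g" by (rule sum_le_suminf_atMost[OF g]) (simp add: g_def)
    finally show ?thesis .
  qed
  then show ?thesis by (intro nonneg_sums_bounded(1)[where B="suminf g"]) auto
qed

text \<open>With u = sqrt t the heat factor is dominated by the Gaussian exp (-(u l)^2). This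
  absorbs d + 1 powers of 1 + u l: d - 1 of them against the growth of the multiplicities, at the
  cost of u^-(d-1), and 2 to leave the weight 1/(1 + u l)^2, whose sum is at most 2/u.\<close>

lemma heat_trace_bound:
  "\<exists>C>0. \<forall>t. 0 < t \<and> t \<le> 1 \<longrightarrow> summable (\<lambda>l. exp (- t * lam l) * real (Z l)) \<and>
    (\<Sum>l. exp (- t * lam l) * real (Z l)) \<le> C / sqrt t ^ d"
proof -
  define K where "K = exp ((real (d + 1))\<^sup>2)"
  have B: "(\<Sum>l\<le>N. exp (- t * lam l) * real (Z l)) \<le> 4 * real d * K / sqrt t ^ d"
    if t: "0 < t" "t \<le> 1" for t N
  proof -
    define u where "u = sqrt t"
    have u: "0 < u" "u \<le> 1" "t = u\<^sup>2" using t by (auto simp: u_def)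
    have "(\<Sum>l\<le>N. exp (- t * lam l) * real (Z l)) = (\<Sum>l\<le>N. real (Z l) * exp (- t * lam l))"
      by (simp add: mult.commute)
    also have "\<dots> \<le> (\<Sum>l\<le>N. 2 * real d * (real l + 1) ^ (d - 1) * exp (- t * lam l))"
      using t lam_mono by (intro multiplicity_sum_le) auto
    also have "\<dots> \<le> (\<Sum>l\<le>N. 2 * real d * K / u ^ (d - 1) * (1 / (1 + u * real l)\<^sup>2))"
    proof (rule sum_mono)
      fix l
      define v where "v = 1 + u * real l"
      have v: "v \<ge> 1" "u * (real l + 1) \<le> v" using u by (auto simp: v_def distrib_left)
      have "t * (real l)\<^sup>2 \<le> t * lam l" using t lam_ge_square by simp
      then have "exp (- t * lam l) \<le> exp (- (u * real l)\<^sup>2)" using u by (simp add: power_mult_distrib)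
      then have "v ^ (d + 1) * exp (- t * lam l) \<le> v ^ (d + 1) * exp (- (u * real l)\<^sup>2)"
        using v by (intro mult_left_mono) auto
      also have "\<dots> \<le> K" unfolding K_def v_def by (rule power_le_exp_square) (use u in simp)
      finally have 1: "v ^ (d + 1) * exp (- t * lam l) \<le> K" .
      have "(u * (real l + 1)) ^ (d - 1) * exp (- t * lam l) * v\<^sup>2 \<le> v ^ (d - 1) * exp (- t * lam l) * v\<^sup>2"
        using v u by (intro mult_right_mono power_mono) auto
      also have "\<dots> = v ^ (d + 1) * exp (- t * lam l)"
        using d_pos by (simp add: power_add[symmetric] ac_simps flip: mult.assoc)
      also have "\<dots> \<le> K" by (rule 1)
      finally have "((real l + 1) ^ (d - 1) * exp (- t * lam l)) * (u ^ (d - 1) * v\<^sup>2) \<le> K"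
        by (simp only: power_mult_distrib ac_simps)
      moreover have "u ^ (d - 1) * v\<^sup>2 > 0" using u v by simp
      ultimately have "(real l + 1) ^ (d - 1) * exp (- t * lam l) \<le> K / (u ^ (d - 1) * v\<^sup>2)"
        by (subst pos_le_divide_eq)
      then have "(real l + 1) ^ (d - 1) * exp (- t * lam l) \<le> K / u ^ (d - 1) * (1 / v\<^sup>2)"
        by simp
      then have "2 * real d * ((real l + 1) ^ (d - 1) * exp (- t * lam l)) \<le> 2 * real d * (K / u ^ (d - 1) * (1 / v\<^sup>2))"
        by (intro mult_left_mono) auto
      then show "2 * real d * (real l + 1) ^ (d - 1) * exp (- t * lam l) \<le> 2 * real d * K / u ^ (d - 1) * (1 / (1 + u * real l)\<^sup>2)"
        by (simp add: v_def ac_simps)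
    qed
    also have "\<dots> = 2 * real d * K / u ^ (d - 1) * (\<Sum>l\<le>N. 1 / (1 + u * real l)\<^sup>2)"
      by (simp only: sum_distrib_left)
    also have "\<dots> \<le> 2 * real d * K / u ^ (d - 1) * (2 / u)"
    proof (rule mult_left_mono)
      have "1 + 1 / u \<le> 2 / u" using u by (simp add: field_simps)
      then show "(\<Sum>l\<le>N. 1 / (1 + u * real l)\<^sup>2) \<le> 2 / u"
        using sum_inverse_square_le[OF u(1), of N] by simp
    qed (use u in \<open>simp add: K_def\<close>)
    also have "\<dots> = 4 * real d * K / u ^ d"
      using d_pos by (cases d) (auto simp: field_simps)
    finally show ?thesis by (simp add: u_def)
  qed
  have "4 * real d * K > 0" using d_pos by (simp add: K_def)
  moreover have "summable (\<lambda>l. exp (- t * lam l) * real (Z l)) \<and>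
    (\<Sum>l. exp (- t * lam l) * real (Z l)) \<le> 4 * real d * K / sqrt t ^ d" if "0 < t \<and> t \<le> 1" for t
    using nonneg_sums_bounded[OF _ B[of t]] that by auto
  ultimately show ?thesis by blast
qed

end

section \<open>Sobolev norms and multiplication\<close>

lemma smooth_on_sphere_continuous:
  assumes "smooth_on_sphere \<phi>" shows "continuous_on (sphere (0::'a::euclidean_space) 1) \<phi>"
proof -
  have "iter_partial [] (\<phi> \<circ> sgn) differentiable_on (- {0::'a})"
    using assms unfolding smooth_on_sphere_def by (metis empty_subsetI list.set(1))
  then have "continuous_on (- {0}) (\<phi> \<circ> sgn)"
    by (intro differentiable_imp_continuous_on) (simp add: iter_partial_def)
  then have "continuous_on (sphere 0 1) (\<phi> \<circ> sgn)"
    by (rule continuous_on_subset) auto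
  then show ?thesis by (rule continuous_on_eq) (simp add: sgn_div_norm)
qed

lemma smooth_seminorm_0: "smooth_seminorm 0 \<phi> = (SUP x\<in>sphere (0::'a::euclidean_space) 1. \<bar>\<phi> x\<bar>)"
proof -
  have "{bs. set bs \<subseteq> (Basis::'a set) \<and> length bs \<le> 0} = {[]}" by auto
  moreover have "(SUP x\<in>sphere (0::'a) 1. \<bar>\<phi> (sgn x)\<bar>) = (SUP x\<in>sphere (0::'a) 1. \<bar>\<phi> x\<bar>)"
    by (intro SUP_cong) (auto simp: sgn_div_norm)
  ultimately show ?thesis by (simp add: smooth_seminorm_def iter_partial_def)
qed

text \<open>A continuous density has order 0 as a distribution: \<open>smooth_seminorm 0\<close> is
  the supremum norm on the sphere, where \<open>sgn\<close> is the identity.\<close>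

lemma sphere_distribution_dist_of_fun:
  fixes f :: "'a::euclidean_space \<Rightarrow> real"
  assumes f: "continuous_on (sphere 0 1) f"
  shows "sphere_distribution (dist_of_fun f)"
  unfolding sphere_distribution_def
proof (intro conjI allI impI)
  fix \<phi> \<psi> :: "'a \<Rightarrow> real" and a b :: real
  assume s: "smooth_on_sphere \<phi>" "smooth_on_sphere \<psi>"
  have i: "integrable sphere_measure (\<lambda>x. f x * \<phi> x)" "integrable sphere_measure (\<lambda>x. f x * \<psi> x)"
    by (intro integrable_sphere_continuous continuous_on_mult f smooth_on_sphere_continuous s)+
  have "dist_of_fun f (\<lambda>x. a * \<phi> x + b * \<psi> x) = (LINT x|sphere_measure. a * (f x * \<phi> x) + b * (f x * \<psi> x))"
    unfolding dist_of_fun_def by (simp add: algebra_simps)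
  also have "\<dots> = a * dist_of_fun f \<phi> + b * dist_of_fun f \<psi>"
    using i by (simp add: dist_of_fun_def)
  finally show "dist_of_fun f (\<lambda>x. a * \<phi> x + b * \<psi> x) = a * dist_of_fun f \<phi> + b * dist_of_fun f \<psi>" .
next
  interpret prob_space "sphere_measure :: 'a measure" by (rule prob_space_sphere_measure)
  obtain B where B: "B > 0" "\<And>x. x \<in> sphere 0 1 \<Longrightarrow> \<bar>f x\<bar> \<le> B"
    using bounded_sphere_continuous[OF f] by blast
  have "\<bar>dist_of_fun f \<phi>\<bar> \<le> B * smooth_seminorm 0 \<phi>" if s: "smooth_on_sphere \<phi>" for \<phi>
  proof -
    note c = smooth_on_sphere_continuous[OF s]
    obtain B' where B': "\<And>x. x \<in> sphere 0 1 \<Longrightarrow> \<bar>\<phi> x\<bar> \<le> B'"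
      using bounded_sphere_continuous[OF c] by blast
    let ?S = "SUP x\<in>sphere (0::'a) 1. \<bar>\<phi> x\<bar>"
    have S: "\<bar>\<phi> x\<bar> \<le> ?S" if "x \<in> sphere 0 1" for x
      using that B' by (intro cSUP_upper bdd_aboveI2[where M=B']) auto
    have "\<bar>dist_of_fun f \<phi>\<bar> \<le> (LINT x|sphere_measure. \<bar>f x * \<phi> x\<bar>)"
      unfolding dist_of_fun_def by (rule integral_abs_bound)
    also have "\<dots> \<le> (LINT (x::'a)|sphere_measure. B * ?S)"
    proof (rule integral_mono)
      fix x :: 'a assume "x \<in> space sphere_measure"
      then have x: "x \<in> sphere 0 1" by simp
      show "\<bar>f x * \<phi> x\<bar> \<le> B * ?S"
        unfolding abs_mult using B(2)[OF x] S[OF x] B(1) by (intro mult_mono) auto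
    qed (use f c in \<open>auto intro!: integrable_sphere_continuous continuous_intros\<close>)
    also have "\<dots> = B * ?S" using prob_space by simp
    finally show ?thesis by (simp add: smooth_seminorm_0)
  qed
  then show "\<exists>N K. \<forall>\<phi>. smooth_on_sphere \<phi> \<longrightarrow> \<bar>dist_of_fun f \<phi>\<bar> \<le> K * smooth_seminorm N \<phi>" by blast
qed

text \<open>Telescoping of w into its increments, with w (-1) read as 0, and exchange of the sums.
  The product estimate uses it in both directions, to pass between weighted sums and tail
  sums.\<close>

lemma layer_cake_sum:
  fixes w :: "nat \<Rightarrow> real"
  assumes J: "finite J" and D: "\<And>i. i \<in> J \<Longrightarrow> D i \<le> M"
  shows "(\<Sum>i\<in>J. w (D i) * e i)
    = (\<Sum>j\<le>M. (w j - (if j = 0 then 0 else w (j - 1))) * (\<Sum>i\<in>{i\<in>J. j \<le> D i}. e i))"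
proof -
  define a where "a = (\<lambda>j. w j - (if j = 0 then 0 else w (j - 1)))"
  have wk: "w k = (\<Sum>j\<le>k. a j)" for k by (induction k) (auto simp: a_def)
  have "(\<Sum>i\<in>J. w (D i) * e i) = (\<Sum>i\<in>J. \<Sum>j\<le>M. if j \<le> D i then a j * e i else 0)"
  proof (rule sum.cong)
    fix i assume "i \<in> J"
    then have "(\<Sum>j\<le>M. if j \<le> D i then a j * e i else 0) = (\<Sum>j\<le>D i. a j * e i)"
      using D by (intro sum.mono_neutral_cong_right) (auto intro: order_trans)
    then show "w (D i) * e i = (\<Sum>j\<le>M. if j \<le> D i then a j * e i else 0)"
      by (simp add: wk sum_distrib_right)
  qed simp
  also have "\<dots> = (\<Sum>j\<le>M. \<Sum>i\<in>J. if j \<le> D i then a j * e i else 0)" by (rule sum.swap)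
  also have "\<dots> = (\<Sum>j\<le>M. a j * (\<Sum>i\<in>{i\<in>J. j \<le> D i}. e i))"
    using J by (intro sum.cong refl) (simp add: sum.inter_filter sum_distrib_left if_distrib cong: if_cong)
  finally show ?thesis by (simp add: a_def)
qed

context harmonic_basis
begin

definition proj :: "('a \<Rightarrow> real) \<Rightarrow> nat \<Rightarrow> 'a \<Rightarrow> real" where
  "proj f l x = (\<Sum>k=1..Z l. coeff f (l, k) * Y l k x)"

text \<open>By orthonormality, the squared L2 norm of \<open>proj f l\<close>.\<close>

definition energy :: "('a \<Rightarrow> real) \<Rightarrow> nat \<Rightarrow> real" where
  "energy f l = (\<Sum>k=1..Z l. (coeff f (l, k))\<^sup>2)"

lemma energy_nonneg: "energy f l \<ge> 0"
  by (simp add: energy_def sum_nonneg)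

lemma Y_continuous: "k \<in> {1..Z l} \<Longrightarrow> continuous_on (sphere 0 1) (Y l k)"
  using harm_continuous[of "(l, k)"] by (simp add: harm_def[abs_def] valid_idx_def)

lemma proj_continuous: "continuous_on (sphere 0 1) (proj f l)"
  unfolding proj_def[abs_def] by (intro continuous_on_sum continuous_on_mult continuous_on_const Y_continuous)

text \<open>Cauchy-Schwarz together with the constant diagonal sum.\<close>

lemma kernel_bound:
  assumes "x \<in> sphere 0 1" "y \<in> sphere 0 1"
  shows "\<bar>\<Sum>k=1..Z l. Y l k x * Y l k y\<bar> \<le> Z l"
proof -
  have "(\<Sum>k=1..Z l. Y l k x * Y l k y)\<^sup>2 \<le> (\<Sum>k=1..Z l. (Y l k x)\<^sup>2) * (\<Sum>k=1..Z l. (Y l k y)\<^sup>2)"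
    by (rule Cauchy_Schwarz_ineq_sum)
  also have "\<dots> = (real (Z l))\<^sup>2" by (simp only: addition_theorem_diagonal[OF assms(1)] addition_theorem_diagonal[OF assms(2)]
      power2_eq_square[of "real (Z l)"])
  finally show ?thesis by (simp only: abs_le_square_iff[symmetric] abs_of_nat)
qed

lemma proj_bound:
  assumes "x \<in> sphere 0 1"
  shows "\<bar>proj f l x\<bar> \<le> sqrt (Z l) * sqrt (energy f l)"
proof -
  have "(proj f l x)\<^sup>2 \<le> energy f l * (\<Sum>k=1..Z l. (Y l k x)\<^sup>2)"
    unfolding proj_def energy_def by (rule Cauchy_Schwarz_ineq_sum)
  then have "(proj f l x)\<^sup>2 \<le> real (Z l) * energy f l"
    by (simp only: addition_theorem_diagonal[OF assms] mult.commute)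
  then have "sqrt ((proj f l x)\<^sup>2) \<le> sqrt (real (Z l) * energy f l)" by (rule real_sqrt_le_mono)
  then show ?thesis by (simp add: real_sqrt_mult)
qed

lemma poly_space_proj: "poly_space l (proj f l)"
proof -
  have "poly_space l (\<lambda>x. \<Sum>k=1..Z l. coeff f (l, k) * harm (l, k) x)"
    by (intro lin_span_sum lin_span_cmult lin_span_base finite_idx) (auto simp: idx_iff valid_idx_def)
  then show ?thesis by (rule lin_span_cong) (simp add: proj_def harm_def)
qed

lemma coeff_proj: "valid_idx i \<Longrightarrow> coeff (proj f l) i = (if fst i = l then coeff f i else 0)"
proof -
  assume i: "valid_idx i"
  have "coeff (proj f l) i = (if i \<in> Pair l ` {1..Z l} then coeff f i else 0)"
  proof (rule coeff_lincomb)
    fix x :: 'a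
    show "proj f l x = (\<Sum>j\<in>Pair l ` {1..Z l}. coeff f j * harm j x)"
      by (subst sum.reindex) (auto simp: proj_def harm_def inj_on_def)
  qed (use i in \<open>auto simp: valid_idx_def\<close>)
  moreover have "i \<in> Pair l ` {1..Z l} \<longleftrightarrow> fst i = l"
    using i by (cases i) (auto simp: valid_idx_def)
  ultimately show ?thesis by simp
qed

lemma sobolev_partial:
  "(\<Sum>i\<in>idx N. (1 + eig i) powr t * (U (harm i))\<^sup>2) = (\<Sum>l\<le>N. sobolev_term d Z Y t U l)"
  by (simp add: sum_idx sobolev_term_def eig_def harm_def[abs_def] sum_distrib_left)

lemma dist_of_fun_harm: "dist_of_fun f (harm i) = coeff f i"
  by (simp add: dist_of_fun_def coeff_def)

lemma sobolev_term_dist_of_fun: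
  "sobolev_term d Z Y t (dist_of_fun f) l = (1 + lam l) powr t * energy f l"
  using dist_of_fun_harm[of f "(l, _)"] by (simp add: sobolev_term_def energy_def harm_def)

lemma sobolev_term_nonneg: "sobolev_term d Z Y t U l \<ge> 0"
  by (simp add: sobolev_term_def sum_nonneg)

lemma sobolev_norm_nonneg: "summable (sobolev_term d Z Y t U) \<Longrightarrow> sobolev_norm d Z Y t U \<ge> 0"
  by (simp add: sobolev_norm_def sobolev_term_nonneg suminf_nonneg)

lemma sobolev_norm_square:
  "summable (sobolev_term d Z Y t U) \<Longrightarrow> (sobolev_norm d Z Y t U)\<^sup>2 = (\<Sum>l. sobolev_term d Z Y t U l)"
  by (simp add: sobolev_norm_def sobolev_term_nonneg suminf_nonneg)

lemma sobolev_partial_le: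
  assumes "summable (sobolev_term d Z Y t U)"
  shows "(\<Sum>i\<in>idx N. (1 + eig i) powr t * (U (harm i))\<^sup>2) \<le> (sobolev_norm d Z Y t U)\<^sup>2"
  unfolding sobolev_partial sobolev_norm_square[OF assms]
  by (rule sum_le_suminf_atMost[OF assms sobolev_term_nonneg])

lemma sobolev_normI:
  assumes "\<And>N. (\<Sum>i\<in>idx N. (1 + eig i) powr t * (U (harm i))\<^sup>2) \<le> B\<^sup>2" "B \<ge> 0"
  shows "summable (sobolev_term d Z Y t U)" "sobolev_norm d Z Y t U \<le> B"
proof -
  note * = nonneg_sums_bounded[where f="sobolev_term d Z Y t U" and B="B\<^sup>2",
      OF sobolev_term_nonneg assms(1)[unfolded sobolev_partial]]
  show "summable (sobolev_term d Z Y t U)" by (rule *(1))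
  have "sobolev_norm d Z Y t U \<le> sqrt (B\<^sup>2)" unfolding sobolev_norm_def by (rule real_sqrt_le_mono[OF *(2)])
  then show "sobolev_norm d Z Y t U \<le> B" using assms(2) by simp
qed

text \<open>Cauchy-Schwarz after splitting (1+\<lambda>)^(r/2) into (1+\<lambda>)^(-(s-r)/2) and
  (1+\<lambda>)^(s/2). The condition s - r > d/2 makes the first factor square summable against the
  multiplicities.\<close>

lemma harmonic_series_weighted:
  assumes sum: "summable (\<lambda>l. (1 + lam l) powr s * energy f l)" and sr: "s - r > d / 2"
  shows "summable (\<lambda>l. (1 + lam l) powr (r / 2) * (sqrt (Z l) * sqrt (energy f l)))"
    "(\<Sum>l. (1 + lam l) powr (r / 2) * (sqrt (Z l) * sqrt (energy f l)))
      \<le> sqrt (\<Sum>l. (1 + lam l) powr (- (s - r)) * Z l) * sqrt (\<Sum>l. (1 + lam l) powr s * energy f l)"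
proof -
  define a where "a = (\<lambda>l. (1 + lam l) powr (- (s - r)) * real (Z l))"
  define b where "b = (\<lambda>l. (1 + lam l) powr s * energy f l)"
  have eq: "(1 + lam l) powr (r / 2) * (sqrt (Z l) * sqrt (energy f l)) = sqrt (a l) * sqrt (b l)" for l
  proof -
    have p: "sqrt ((1 + lam l) powr u) = (1 + lam l) powr (u / 2)" for u
      by (simp add: powr_half_sqrt[symmetric] powr_powr)
    have "(1 + lam l) powr (r / 2) = (1 + lam l) powr (- (s - r) / 2) * (1 + lam l) powr (s / 2)"
      by (simp add: powr_add[symmetric] field_simps)
    then show ?thesis by (simp add: a_def b_def real_sqrt_mult p)
  qed
  have "summable a" unfolding a_def by (rule multiplicity_powr_summable[OF sr])
  from suminf_cauchy_schwarz[OF this _ sum[folded b_def]]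
  show "summable (\<lambda>l. (1 + lam l) powr (r / 2) * (sqrt (Z l) * sqrt (energy f l)))"
    "(\<Sum>l. (1 + lam l) powr (r / 2) * (sqrt (Z l) * sqrt (energy f l)))
      \<le> sqrt (\<Sum>l. (1 + lam l) powr (- (s - r)) * Z l) * sqrt (\<Sum>l. (1 + lam l) powr s * energy f l)"
    unfolding eq a_def[symmetric] b_def[symmetric]
    by (auto simp: a_def b_def energy_nonneg)
qed

text \<open>The series converges uniformly to a continuous function with the same coefficients as f,
  so completeness identifies the two.\<close>

lemma harmonic_series:
  assumes f: "continuous_on (sphere 0 1) f" and sum: "summable (\<lambda>l. sqrt (Z l) * sqrt (energy f l))"
    and x: "x \<in> sphere 0 1"
  shows "f x = (\<Sum>l. proj f l x)"
proof -
  let ?M = "\<lambda>l. sqrt (Z l) * sqrt (energy f l)"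
  define h where "h = (\<lambda>x. \<Sum>l. proj f l x)"
  have h: "continuous_on (sphere 0 1) h"
    unfolding h_def by (rule continuous_on_sphere_suminf[OF proj_continuous proj_bound sum])
  have "coeff (\<lambda>x. f x - h x) i = 0" if i: "valid_idx i" for i
  proof -
    note ci = harm_continuous[OF i]
    obtain B where B: "B > 0" "\<And>x. x \<in> sphere 0 1 \<Longrightarrow> \<bar>harm i x\<bar> \<le> B"
      using bounded_sphere_continuous[OF ci] by blast
    have "coeff h i = (LINT x|sphere_measure. (\<Sum>l. proj f l x * harm i x))"
      unfolding coeff_def h_def
    proof (rule LINT_sphere_cong)
      fix x :: 'a assume x: "x \<in> sphere 0 1"
      have "summable (\<lambda>l. proj f l x)"
        by (rule summable_comparison_test'[OF sum]) (use proj_bound[OF x] in simp)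
      then show "(\<Sum>l. proj f l x) * harm i x = (\<Sum>l. proj f l x * harm i x)"
        by (rule suminf_mult2)
    qed
    also have "\<dots> = (\<Sum>l. coeff (proj f l) i)"
      unfolding coeff_def
    proof (rule integral_sphere_suminf[where M="\<lambda>l. ?M l * B"])
      show "\<bar>proj f l x * harm i x\<bar> \<le> ?M l * B" if x: "x \<in> sphere 0 1" for l x
        unfolding abs_mult using proj_bound[OF x] B(2)[OF x]
        by (intro mult_mono) (auto simp: energy_nonneg)
    qed (auto intro!: continuous_on_mult proj_continuous ci summable_mult2 sum)
    also have "\<dots> = (\<Sum>l. if fst i = l then coeff f i else 0)" by (simp add: coeff_proj[OF i])
    also have "\<dots> = (\<Sum>l\<in>{fst i}. if fst i = l then coeff f i else 0)"
      by (rule suminf_finite) auto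
    finally have "coeff h i = coeff f i" by simp
    moreover have "coeff (\<lambda>x. f x - h x) i = coeff f i - coeff h i"
      unfolding coeff_def left_diff_distrib
      by (rule Bochner_Integration.integral_diff; intro integrable_sphere_continuous continuous_on_mult f h ci)
    ultimately show ?thesis by simp
  qed
  from completeness[OF continuous_on_diff[OF f h] this x] have "f x - h x = 0" .
  then show ?thesis by (simp add: h_def)
qed

lemma coeff_mult_lincomb:
  assumes h: "continuous_on (sphere 0 1) h" and A: "finite A" "\<And>i. i \<in> A \<Longrightarrow> valid_idx i" and j: "valid_idx j"
  shows "coeff (\<lambda>x. h x * (\<Sum>i\<in>A. c i * harm i x)) j = (\<Sum>i\<in>A. c i * coeff (\<lambda>x. h x * harm i x) j)"
proof -
  have "coeff (\<lambda>x. h x * (\<Sum>i\<in>A. c i * harm i x)) j = (LINT x|sphere_measure. (\<Sum>i\<in>A. c i * (h x * harm i x * harm j x)))"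
    unfolding coeff_def by (simp add: sum_distrib_left sum_distrib_right ac_simps)
  also have "\<dots> = (\<Sum>i\<in>A. c i * coeff (\<lambda>x. h x * harm i x) j)"
    unfolding coeff_def using assms by (subst Bochner_Integration.integral_sum)
      (auto intro!: integrable_mult_right integrable_sphere_continuous continuous_on_mult harm_continuous)
  finally show ?thesis .
qed

text \<open>The part of the product in degrees at least j only sees the part of the second factor in
  degrees at least j - L; summing over j with the increments of the weight gives the estimate.\<close>

lemma sobolev_product:
  assumes h: "poly_space L h" and B: "\<And>x. x \<in> sphere 0 1 \<Longrightarrow> \<bar>h x\<bar> \<le> B" and r: "r \<ge> 0"
  shows "(\<Sum>i\<in>idx (L + N). (1 + eig i) powr r * (coeff (\<lambda>x. h x * (\<Sum>i\<in>idx N. c i * harm i x)) i)\<^sup>2)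
    \<le> B\<^sup>2 * (\<Sum>i\<in>idx N. (1 + lam (fst i + L)) powr r * (c i)\<^sup>2)"
proof -
  define w where "w = (\<lambda>l. (1 + lam l) powr r)"
  define inc where "inc = (\<lambda>j. w j - (if j = 0 then 0 else w (j - 1)))"
  define \<phi> where "\<phi> = (\<lambda>x. \<Sum>i\<in>idx N. c i * harm i x)"
  have inc: "inc j \<ge> 0" for j
    unfolding inc_def w_def using r lam_nonneg lam_mono by (auto intro!: powr_mono2 add_nonneg_nonneg)
  note hc = poly_space_continuous[OF h]
  have level: "(\<Sum>i\<in>{i\<in>idx (L + N). j \<le> fst i}. (coeff (\<lambda>x. h x * \<phi> x) i)\<^sup>2)
      \<le> B\<^sup>2 * (\<Sum>i\<in>{i\<in>idx N. j \<le> fst i + L}. (c i)\<^sup>2)" for j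
  proof -
    define A where "A = {i\<in>idx N. j \<le> fst i + L}"
    have AN: "A \<subseteq> idx N" by (auto simp: A_def)
    have A: "finite A" "\<And>i. i \<in> A \<Longrightarrow> valid_idx i" "A \<subseteq> idx N"
      using AN finite_subset[OF AN] by (auto intro: idx_valid)
    define \<phi>' where "\<phi>' = (\<lambda>x. \<Sum>i\<in>A. c i * harm i x)"
    have p': "poly_space N \<phi>'" unfolding \<phi>'_def using A
      by (intro lin_span_sum lin_span_cmult lin_span_base finite_idx) auto
    note p'c = poly_space_continuous[OF p']
    have eq: "coeff (\<lambda>x. h x * \<phi> x) i = coeff (\<lambda>x. h x * \<phi>' x) i" if i: "i \<in> idx (L + N)" "j \<le> fst i" for i
    proof -
      have "coeff (\<lambda>x. h x * \<phi> x) i = (\<Sum>i'\<in>idx N. c i' * coeff (\<lambda>x. h x * harm i' x) i)"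
        unfolding \<phi>_def using i by (intro coeff_mult_lincomb hc) (auto simp: idx_iff)
      also have "\<dots> = (\<Sum>i'\<in>A. c i' * coeff (\<lambda>x. h x * harm i' x) i)"
      proof (rule sum.mono_neutral_right)
        show "\<forall>i'\<in>idx N - A. c i' * coeff (\<lambda>x. h x * harm i' x) i = 0"
        proof
          fix i' assume i': "i' \<in> idx N - A"
          have "poly_space (fst i') (harm i')"
            using i' by (intro lin_span_base finite_idx) (simp add: idx_iff)
          then have "poly_space (L + fst i') (\<lambda>x. h x * harm i' x)" by (rule poly_space_mult[OF h])
          moreover have "fst i > L + fst i'" using i' i by (auto simp: A_def)
          ultimately show "c i' * coeff (\<lambda>x. h x * harm i' x) i = 0"
            using poly_space_coeff_0[of "L + fst i'" _ i] i(1) by (simp add: idx_iff)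
        qed
      qed (use A in auto)
      also have "\<dots> = coeff (\<lambda>x. h x * \<phi>' x) i"
        unfolding \<phi>'_def by (rule coeff_mult_lincomb[OF hc A(1,2) idx_valid[OF i(1)], symmetric])
      finally show ?thesis .
    qed
    have "(\<Sum>i\<in>{i\<in>idx (L + N). j \<le> fst i}. (coeff (\<lambda>x. h x * \<phi> x) i)\<^sup>2)
      = (\<Sum>i\<in>{i\<in>idx (L + N). j \<le> fst i}. (coeff (\<lambda>x. h x * \<phi>' x) i)\<^sup>2)"
      by (intro sum.cong) (auto simp: eq)
    also have "\<dots> \<le> (\<Sum>i\<in>idx (L + N). (coeff (\<lambda>x. h x * \<phi>' x) i)\<^sup>2)"
      by (rule sum_mono2) auto
    \<comment> \<open>Bessel's inequality passes to the L2 norm of the product, where the bound B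
      applies pointwise; Parseval then returns to the coefficients of the truncated factor.\<close>
    also have "\<dots> \<le> (LINT x|sphere_measure. (h x * \<phi>' x)\<^sup>2)"
      by (intro bessel continuous_on_mult hc p'c)
    also have "\<dots> \<le> (LINT x|sphere_measure. B\<^sup>2 * (\<phi>' x * \<phi>' x))"
    proof (rule integral_mono)
      fix x :: 'a assume "x \<in> space sphere_measure"
      then have "\<bar>h x\<bar> \<le> B" using B by simp
      then have "(h x)\<^sup>2 \<le> B\<^sup>2" by (meson abs_ge_zero order_trans power2_le_iff_abs_le)
      then show "(h x * \<phi>' x)\<^sup>2 \<le> B\<^sup>2 * (\<phi>' x * \<phi>' x)"
        unfolding power_mult_distrib power2_eq_square[of "\<phi>' x"] by (rule mult_right_mono) simp
    qed (use hc p'c in \<open>auto intro!: integrable_sphere_continuous continuous_intros\<close>)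
    also have "\<dots> = B\<^sup>2 * (\<Sum>i\<in>idx N. (coeff \<phi>' i)\<^sup>2)"
      using parseval[OF p' p'c] by (simp add: power2_eq_square)
    also have "(\<Sum>i\<in>idx N. (coeff \<phi>' i)\<^sup>2) = (\<Sum>i\<in>idx N. if i \<in> A then (c i)\<^sup>2 else 0)"
      using coeff_lincomb[OF A(2) idx_valid A(1), of _ N \<phi>' c] by (intro sum.cong) (auto simp: \<phi>'_def)
    also have "\<dots> = (\<Sum>i\<in>A. (c i)\<^sup>2)"
      using A by (simp add: sum.If_cases Int_absorb1)
    finally show ?thesis by (simp add: A_def)
  qed
  have "(\<Sum>i\<in>idx (L + N). (1 + eig i) powr r * (coeff (\<lambda>x. h x * \<phi> x) i)\<^sup>2)
      = (\<Sum>i\<in>idx (L + N). w (fst i) * (coeff (\<lambda>x. h x * \<phi> x) i)\<^sup>2)"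
    by (simp add: w_def eig_def)
  also have "\<dots> = (\<Sum>j\<le>L + N. inc j * (\<Sum>i\<in>{i\<in>idx (L + N). j \<le> fst i}. (coeff (\<lambda>x. h x * \<phi> x) i)\<^sup>2))"
    unfolding inc_def by (rule layer_cake_sum) (auto simp: idx_iff)
  also have "\<dots> \<le> (\<Sum>j\<le>L + N. inc j * (B\<^sup>2 * (\<Sum>i\<in>{i\<in>idx N. j \<le> fst i + L}. (c i)\<^sup>2)))"
    by (intro sum_mono mult_left_mono level inc)
  also have "\<dots> = B\<^sup>2 * (\<Sum>j\<le>L + N. inc j * (\<Sum>i\<in>{i\<in>idx N. j \<le> fst i + L}. (c i)\<^sup>2))"
    by (simp add: sum_distrib_left ac_simps)
  \<comment> \<open>The layers are reassembled, now with the shifted degree \<open>fst i + L\<close>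
    as the level.\<close>
  also have "(\<Sum>j\<le>L + N. inc j * (\<Sum>i\<in>{i\<in>idx N. j \<le> fst i + L}. (c i)\<^sup>2)) = (\<Sum>i\<in>idx N. w (fst i + L) * (c i)\<^sup>2)"
    unfolding inc_def by (rule layer_cake_sum[symmetric]) (auto simp: idx_iff)
  finally show ?thesis by (simp add: \<phi>_def w_def)
qed

end

section \<open>The quadrature error\<close>

lemma sampling_error_sum:
  fixes g :: "'i \<Rightarrow> 'a::euclidean_space \<Rightarrow> real"
  assumes g: "\<And>i. i \<in> I \<Longrightarrow> continuous_on (sphere 0 1) (g i)"
  shows "sampling_error m x w (\<lambda>y. \<Sum>i\<in>I. c i * g i y) = (\<Sum>i\<in>I. c i * sampling_error m x w (g i))"
proof -
  have "(LINT y|sphere_measure. (\<Sum>i\<in>I. c i * g i y)) = (\<Sum>i\<in>I. c i * (LINT y|sphere_measure. g i y))"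
    using g by (subst Bochner_Integration.integral_sum) (auto intro!: integrable_mult_right integrable_sphere_continuous)
  moreover have "(\<Sum>j=1..m. w j * (\<Sum>i\<in>I. c i * g i (x j))) = (\<Sum>i\<in>I. c i * (\<Sum>j=1..m. w j * g i (x j)))"
    by (simp add: sum_distrib_left mult.left_commute) (rule sum.swap)
  ultimately show ?thesis by (simp add: sampling_error_def right_diff_distrib sum_subtractf)
qed

lemma sampling_error_cong:
  fixes f :: "'a::euclidean_space \<Rightarrow> real"
  assumes "\<And>j. j \<in> {1..m} \<Longrightarrow> x j \<in> sphere 0 1" "\<And>y. y \<in> sphere 0 1 \<Longrightarrow> f y = g y"
  shows "sampling_error m x w f = sampling_error m x w g"
proof -
  have "(LINT y|sphere_measure. f y) = (LINT y|sphere_measure. g y)"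
    using assms(2) by (intro Bochner_Integration.integral_cong) auto
  moreover have "(\<Sum>j=1..m. w j * f (x j)) = (\<Sum>j=1..m. w j * g (x j))"
    using assms by (intro sum.cong) auto
  ultimately show ?thesis by (simp add: sampling_error_def)
qed

lemma sampling_error_sums:
  fixes g :: "nat \<Rightarrow> 'a::euclidean_space \<Rightarrow> real"
  assumes x: "\<And>j. j \<in> {1..m} \<Longrightarrow> x j \<in> sphere 0 1"
    and g: "\<And>l. continuous_on (sphere 0 1) (g l)"
    and M: "\<And>l y. y \<in> sphere 0 1 \<Longrightarrow> \<bar>g l y\<bar> \<le> M l" "summable M"
  shows "(\<lambda>l. sampling_error m x w (g l)) sums sampling_error m x w (\<lambda>y. \<Sum>l. g l y)"
proof -
  have s: "summable (\<lambda>l. g l y)" if "y \<in> sphere 0 1" for y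
    by (rule summable_comparison_test'[OF M(2)]) (use M(1)[OF that] in simp)
  have "summable (\<lambda>l. LINT y|sphere_measure. g l y)"
  proof (rule summable_comparison_test'[OF M(2)])
    interpret prob_space "sphere_measure :: 'a measure" by (rule prob_space_sphere_measure)
    fix l
    have "\<bar>LINT y|sphere_measure. g l y\<bar> \<le> (LINT y|sphere_measure. \<bar>g l y\<bar>)" by (rule integral_abs_bound)
    also have "\<dots> \<le> (LINT (y::'a)|sphere_measure. M l)"
      using M(1)[of _ l] g[of l] by (intro integral_mono integrable_sphere_continuous continuous_intros) auto
    finally show "norm (LINT y|sphere_measure. g l y) \<le> M l" using prob_space by simp
  qed
  moreover have "(LINT y|sphere_measure. (\<Sum>l. g l y)) = (\<Sum>l. LINT y|sphere_measure. g l y)"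
    by (rule integral_sphere_suminf[OF g M])
  ultimately have "(\<lambda>l. LINT y|sphere_measure. g l y) sums (LINT y|sphere_measure. (\<Sum>l. g l y))"
    by (metis summable_sums)
  moreover have "(\<lambda>l. \<Sum>j=1..m. w j * g l (x j)) sums (\<Sum>j=1..m. w j * (\<Sum>l. g l (x j)))"
    using x by (intro sums_sum sums_mult summable_sums s) auto
  ultimately show ?thesis unfolding sampling_error_def by (intro sums_diff)
qed

text \<open>With b = max 1 a, 1 + x <= b (1 + x/b) <= b exp (x/b), and a/b <= 2. The factor exp (-2
  x) is the square of the heat filter, as it occurs in squared norms.\<close>

lemma powr_exp_bounded:
  fixes a x :: real
  assumes "a \<ge> 0" "x \<ge> 0"
  shows "(1 + x) powr a * exp (- 2 * x) \<le> max 1 a powr a"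
proof -
  define b where "b = max 1 a"
  have b: "b \<ge> 1" "a \<le> b" by (auto simp: b_def)
  have "1 + x \<le> b * (1 + x / b)" using b by (simp add: distrib_left)
  also have "\<dots> \<le> b * exp (x / b)" using b by (intro mult_left_mono exp_ge_add_one_self) auto
  finally have "(1 + x) powr a \<le> (b * exp (x / b)) powr a" using assms by (intro powr_mono2) auto
  also have "\<dots> = b powr a * exp (a / b * x)" using b by (subst powr_mult) (auto simp: exp_powr_real mult.commute)
  also have "\<dots> \<le> b powr a * exp (2 * x)"
  proof -
    have "a / b \<le> 2" using b by (simp add: divide_le_eq)
    then have "a / b * x \<le> 2 * x" using assms by (intro mult_right_mono) auto
    then have "exp (a / b * x) \<le> exp (2 * x)" by (simp only: exp_le_cancel_iff)
    then show ?thesis by (rule mult_left_mono) simp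
  qed
  finally have "(1 + x) powr a * exp (- 2 * x) \<le> b powr a * exp (2 * x) * exp (- 2 * x)"
    by (rule mult_right_mono) simp
  then show ?thesis by (simp add: b_def exp_add[symmetric] mult.assoc)
qed

text \<open>The left side is at most 1 and at most x^2. For x >= 1 the first bound lies below x^p,
  for x < 1 the second does because p <= 2; this is the source of the restriction s - q <=
  2.\<close>

lemma one_minus_exp_bound:
  fixes x p :: real
  assumes x: "x \<ge> 0" and p: "0 < p" "p \<le> 2"
  shows "(1 - exp (- x))\<^sup>2 \<le> x powr p"
proof -
  have e: "0 \<le> 1 - exp (- x)" "1 - exp (- x) \<le> 1" "1 - exp (- x) \<le> x"
    using x exp_ge_add_one_self[of "- x"] by auto
  show ?thesis
  proof (cases "x \<ge> 1")
    case True
    have "(1 - exp (- x))\<^sup>2 \<le> 1" using e by (simp add: power_le_one)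
    also have "\<dots> \<le> x powr p" using True p by (intro ge_one_powr_ge_zero) auto
    finally show ?thesis .
  next
    case False
    show ?thesis
    proof (cases "x = 0")
      case False
      have "(1 - exp (- x))\<^sup>2 \<le> x\<^sup>2" using e by (intro power_mono) auto
      also have "\<dots> = x powr 2" using x False by (simp add: powr_numeral)
      also have "\<dots> \<le> x powr p" using x False \<open>\<not> x \<ge> 1\<close> p by (intro powr_mono') auto
      finally show ?thesis .
    qed simp
  qed
qed

context harmonic_basis
begin

text \<open>Duality of H^r and H^-r by Cauchy-Schwarz, after inserting the factors (1 +
  \<lambda>)^(r/2) and (1 + \<lambda>)^(-r/2) into the finite expansion of g.\<close>

lemma sampling_error_bound:
  assumes x: "\<And>j. j \<in> {1..m} \<Longrightarrow> x j \<in> sphere (0::'a) 1" and g: "poly_space M g"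
    and nu: "summable (sobolev_term d Z Y (- r) (sampling_error m x w))"
  shows "\<bar>sampling_error m x w g\<bar>
    \<le> sqrt (\<Sum>i\<in>idx M. (1 + eig i) powr r * (coeff g i)\<^sup>2) * sobolev_norm d Z Y (- r) (sampling_error m x w)"
proof -
  let ?\<nu> = "sampling_error m x w" and ?n = "sobolev_norm d Z Y (- r) (sampling_error m x w)"
  have pos: "1 + eig i > 0" for i using eig_nonneg[of i] by linarith
  have "?\<nu> g = ?\<nu> (\<lambda>y. \<Sum>i\<in>idx M. coeff g i * harm i y)"
    using poly_space_expand[OF g] by (intro sampling_error_cong x)
  also have "\<dots> = (\<Sum>i\<in>idx M. coeff g i * ?\<nu> (harm i))"
    by (rule sampling_error_sum) (simp add: harm_continuous idx_valid)
  also have "\<dots> = (\<Sum>i\<in>idx M. ((1 + eig i) powr (r / 2) * coeff g i) * ((1 + eig i) powr (- r / 2) * ?\<nu> (harm i)))"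
  proof (rule sum.cong)
    fix i
    have *: "(1 + eig i) powr (r / 2) * (1 + eig i) powr (- r / 2) = 1"
      using pos[of i] by (simp add: powr_add[symmetric] less_imp_neq[symmetric])
    have "((1 + eig i) powr (r / 2) * coeff g i) * ((1 + eig i) powr (- r / 2) * ?\<nu> (harm i))
      = ((1 + eig i) powr (r / 2) * (1 + eig i) powr (- r / 2)) * (coeff g i * ?\<nu> (harm i))"
      by (simp only: ac_simps)
    then show "coeff g i * ?\<nu> (harm i) = ((1 + eig i) powr (r / 2) * coeff g i) * ((1 + eig i) powr (- r / 2) * ?\<nu> (harm i))"
      unfolding * by simp
  qed simp
  finally have eq: "?\<nu> g = (\<Sum>i\<in>idx M. ((1 + eig i) powr (r / 2) * coeff g i) * ((1 + eig i) powr (- r / 2) * ?\<nu> (harm i)))" .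
  have "(?\<nu> g)\<^sup>2 \<le> (\<Sum>i\<in>idx M. ((1 + eig i) powr (r / 2) * coeff g i)\<^sup>2) * (\<Sum>i\<in>idx M. ((1 + eig i) powr (- r / 2) * ?\<nu> (harm i))\<^sup>2)"
    unfolding eq by (rule Cauchy_Schwarz_ineq_sum)
  also have "\<dots> = (\<Sum>i\<in>idx M. (1 + eig i) powr r * (coeff g i)\<^sup>2) * (\<Sum>i\<in>idx M. (1 + eig i) powr (- r) * (?\<nu> (harm i))\<^sup>2)"
  proof -
    have "(a powr (u / 2))\<^sup>2 = a powr u" for a u :: real by (simp add: power2_eq_square powr_add[symmetric])
    then show ?thesis by (simp only: power_mult_distrib)
  qed
  also have "\<dots> \<le> (\<Sum>i\<in>idx M. (1 + eig i) powr r * (coeff g i)\<^sup>2) * ?n\<^sup>2"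
    by (intro mult_left_mono sobolev_partial_le nu sum_nonneg) auto
  finally have "sqrt ((?\<nu> g)\<^sup>2) \<le> sqrt ((\<Sum>i\<in>idx M. (1 + eig i) powr r * (coeff g i)\<^sup>2) * ?n\<^sup>2)"
    by (rule real_sqrt_le_mono)
  then show ?thesis using sobolev_norm_nonneg[OF nu] by (simp add: real_sqrt_mult)
qed

text \<open>By duality with the function \<open>\<phi>\<close> whose coefficients are \<open>(1 + \<lambda>)\<^sup>-\<^sup>r \<langle>f \<nu>, Y\<rangle>\<close>:
  expand f into harmonics and bound each product with \<open>\<phi>\<close> in \<open>H\<^sup>r\<close>.\<close>

lemma sampling_error_multiplication:
  assumes x: "\<And>j. j \<in> {1..m} \<Longrightarrow> x j \<in> sphere (0::'a) 1"
    and nu: "summable (sobolev_term d Z Y (- r) (sampling_error m x w))"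
    and f: "continuous_on (sphere 0 1) f" and fs: "summable (\<lambda>l. (1 + lam l) powr s * energy f l)"
    and r: "r \<ge> 0" and sr: "s - r > d / 2"
  shows "(\<Sum>i\<in>idx N. (1 + eig i) powr (- r) * (sampling_error m x w (\<lambda>y. f y * harm i y))\<^sup>2)
    \<le> (2 powr (r / 2) * sqrt (\<Sum>l. (1 + lam l) powr (- (s - r)) * Z l)
        * sqrt (\<Sum>l. (1 + lam l) powr s * energy f l) * sobolev_norm d Z Y (- r) (sampling_error m x w))\<^sup>2"
proof -
  define \<nu> where "\<nu> = sampling_error m x w"
  define n where "n = sobolev_norm d Z Y (- r) \<nu>"
  have n0: "n \<ge> 0" unfolding n_def \<nu>_def by (rule sobolev_norm_nonneg[OF nu])
  define A where "A = (\<Sum>i\<in>idx N. (1 + eig i) powr (- r) * (\<nu> (\<lambda>y. f y * harm i y))\<^sup>2)"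
  have A0: "A \<ge> 0" unfolding A_def by (intro sum_nonneg) auto
  define c where "c = (\<lambda>i. (1 + eig i) powr (- r) * \<nu> (\<lambda>y. f y * harm i y))"
  define \<phi> where "\<phi> = (\<lambda>y. \<Sum>i\<in>idx N. c i * harm i y)"
  have \<phi>: "poly_space N \<phi>" unfolding \<phi>_def by (rule poly_space_partial_sum)
  note \<phi>c = poly_space_continuous[OF \<phi>]
  define b where "b = (\<lambda>l. sqrt (Z l) * sqrt (energy f l))"
  have b0: "b l \<ge> 0" for l by (simp add: b_def energy_nonneg)
  have pos: "1 + eig i > 0" for i using eig_nonneg[of i] by linarith
  have posl: "1 + lam l > 0" for l using lam_nonneg[of l] by linarith
  note W = harmonic_series_weighted[OF fs sr]
  let ?W = "sqrt (\<Sum>l. (1 + lam l) powr (- (s - r)) * Z l) * sqrt (\<Sum>l. (1 + lam l) powr s * energy f l)"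
  have bW: "summable b"
  proof (rule summable_comparison_test'[OF W(1)])
    fix l
    have "1 \<le> (1 + lam l) powr (r / 2)" using r lam_nonneg by (intro ge_one_powr_ge_zero) auto
    then show "norm (b l) \<le> (1 + lam l) powr (r / 2) * (sqrt (Z l) * sqrt (energy f l))"
      using b0[of l] mult_right_mono[of 1 "(1 + lam l) powr (r / 2)" "b l"] by (simp add: b_def)
  qed
  \<comment> \<open>The coefficients c make \<nu> (f \<phi>) equal to A, and the squared H^r norm of
    \<phi> is A as well. Hence an estimate of \<nu> (f \<phi>) by the norm of \<phi> is one of A by
    sqrt A.\<close>
  have Aeq: "A = \<nu> (\<lambda>y. f y * \<phi> y)"
  proof -
    have "\<nu> (\<lambda>y. f y * \<phi> y) = \<nu> (\<lambda>y. \<Sum>i\<in>idx N. c i * (f y * harm i y))"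
      by (simp add: \<phi>_def sum_distrib_left ac_simps)
    also have "\<dots> = (\<Sum>i\<in>idx N. c i * \<nu> (\<lambda>y. f y * harm i y))"
      unfolding \<nu>_def by (rule sampling_error_sum) (intro continuous_on_mult f harm_continuous idx_valid)
    finally show ?thesis by (simp add: A_def c_def power2_eq_square ac_simps)
  qed
  obtain B where B: "B > 0" "\<And>y. y \<in> sphere 0 1 \<Longrightarrow> \<bar>\<phi> y\<bar> \<le> B"
    using bounded_sphere_continuous[OF \<phi>c] by blast
  have "(\<lambda>l. \<nu> (\<lambda>y. proj f l y * \<phi> y)) sums \<nu> (\<lambda>y. \<Sum>l. proj f l y * \<phi> y)"
    unfolding \<nu>_def
  proof (rule sampling_error_sums[OF x, where M="\<lambda>l. b l * B"])
    show "\<bar>proj f l y * \<phi> y\<bar> \<le> b l * B" if y: "y \<in> sphere 0 1" for l y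
      unfolding abs_mult using proj_bound[OF y] B(2)[OF y] b0 by (intro mult_mono) (auto simp: b_def)
  qed (auto intro!: continuous_on_mult proj_continuous \<phi>c summable_mult2 bW)
  also have "\<nu> (\<lambda>y. \<Sum>l. proj f l y * \<phi> y) = \<nu> (\<lambda>y. f y * \<phi> y)"
    unfolding \<nu>_def
  proof (rule sampling_error_cong[OF x])
    fix y :: 'a assume y: "y \<in> sphere 0 1"
    have "summable (\<lambda>l. proj f l y)"
      by (rule summable_comparison_test'[OF bW]) (use proj_bound[OF y] in \<open>simp add: b_def\<close>)
    then have "(\<Sum>l. proj f l y * \<phi> y) = (\<Sum>l. proj f l y) * \<phi> y" by (rule suminf_mult2[symmetric])
    then show "(\<Sum>l. proj f l y * \<phi> y) = f y * \<phi> y"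
      using harmonic_series[OF f bW[unfolded b_def] y] by simp
  qed
  finally have sums: "(\<lambda>l. \<nu> (\<lambda>y. proj f l y * \<phi> y)) sums A" using Aeq by simp
  \<comment> \<open>\<open>sobolev_product\<close> with the bound b l for \<open>proj f l\<close>,
    then \<open>lam_add_le\<close> to detach the weight of degree l; what remains is the H^r norm of
    \<phi>, that is sqrt A.\<close>
  have bound: "\<nu> (\<lambda>y. proj f l y * \<phi> y) \<le> 2 powr (r / 2) * sqrt A * n * ((1 + lam l) powr (r / 2) * b l)" for l
  proof -
    have ps: "poly_space (l + N) (\<lambda>y. proj f l y * \<phi> y)" by (rule poly_space_mult[OF poly_space_proj \<phi>])
    have "(\<Sum>i\<in>idx (l + N). (1 + eig i) powr r * (coeff (\<lambda>y. proj f l y * \<phi> y) i)\<^sup>2)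
       \<le> (b l)\<^sup>2 * (\<Sum>i\<in>idx N. (1 + lam (fst i + l)) powr r * (c i)\<^sup>2)"
      unfolding \<phi>_def using proj_bound by (intro sobolev_product poly_space_proj r) (auto simp: b_def)
    also have "\<dots> \<le> (b l)\<^sup>2 * (\<Sum>i\<in>idx N. 2 powr r * (1 + lam l) powr r * ((1 + eig i) powr (- r) * (\<nu> (\<lambda>y. f y * harm i y))\<^sup>2))"
    proof (intro mult_left_mono sum_mono)
      fix i :: "nat \<times> nat"
      have "(1 + lam (fst i + l)) powr r \<le> (2 * ((1 + lam (fst i)) * (1 + lam l))) powr r"
        using r lam_add_le[of "fst i" l] lam_nonneg[of "fst i + l"] by (intro powr_mono2) auto
      also have "\<dots> = 2 powr r * (1 + lam l) powr r * (1 + eig i) powr r"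
        using posl less_imp_le[OF posl] by (simp add: powr_mult eig_def)
      finally have "(1 + lam (fst i + l)) powr r * (c i)\<^sup>2 \<le> 2 powr r * (1 + lam l) powr r * (1 + eig i) powr r * (c i)\<^sup>2"
        by (rule mult_right_mono) simp
      also have "\<dots> = 2 powr r * (1 + lam l) powr r * (((1 + eig i) powr r * (1 + eig i) powr (- r)) * ((1 + eig i) powr (- r) * (\<nu> (\<lambda>y. f y * harm i y))\<^sup>2))"
        by (simp add: c_def power_mult_distrib power2_eq_square ac_simps)
      also have "(1 + eig i) powr r * (1 + eig i) powr (- r) = 1"
        using pos[of i] by (simp add: powr_add[symmetric] less_imp_neq[symmetric])
      finally show "(1 + lam (fst i + l)) powr r * (c i)\<^sup>2
        \<le> 2 powr r * (1 + lam l) powr r * ((1 + eig i) powr (- r) * (\<nu> (\<lambda>y. f y * harm i y))\<^sup>2)" by simp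
    qed simp
    also have "\<dots> = (2 powr (r / 2) * sqrt A * ((1 + lam l) powr (r / 2) * b l))\<^sup>2"
    proof -
      have h: "u powr r = (u powr (r / 2))\<^sup>2" for u :: real by (simp add: power2_eq_square powr_add[symmetric])
      have "(\<Sum>i\<in>idx N. 2 powr r * (1 + lam l) powr r * ((1 + eig i) powr (- r) * (\<nu> (\<lambda>y. f y * harm i y))\<^sup>2))
        = 2 powr r * (1 + lam l) powr r * A"
        by (simp only: A_def sum_distrib_left)
      then show ?thesis using A0 by (simp add: h power_mult_distrib ac_simps)
    qed
    finally have "sqrt (\<Sum>i\<in>idx (l + N). (1 + eig i) powr r * (coeff (\<lambda>y. proj f l y * \<phi> y) i)\<^sup>2)
       \<le> 2 powr (r / 2) * sqrt A * ((1 + lam l) powr (r / 2) * b l)"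
      using A0 b0[of l] by (intro real_le_lsqrt) (auto intro!: mult_nonneg_nonneg)
    then have "sqrt (\<Sum>i\<in>idx (l + N). (1 + eig i) powr r * (coeff (\<lambda>y. proj f l y * \<phi> y) i)\<^sup>2) * n
       \<le> 2 powr (r / 2) * sqrt A * ((1 + lam l) powr (r / 2) * b l) * n"
      using n0 by (rule mult_right_mono)
    moreover have "\<nu> (\<lambda>y. proj f l y * \<phi> y) \<le> sqrt (\<Sum>i\<in>idx (l + N). (1 + eig i) powr r * (coeff (\<lambda>y. proj f l y * \<phi> y) i)\<^sup>2) * n"
      using sampling_error_bound[OF x ps nu] by (simp add: \<nu>_def n_def)
    ultimately show ?thesis by (simp add: ac_simps)
  qed
  have "A \<le> (\<Sum>l. 2 powr (r / 2) * sqrt A * n * ((1 + lam l) powr (r / 2) * b l))"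
    unfolding sums_unique[OF sums]
    by (rule suminf_le[OF _ sums_summable[OF sums]]) (use bound W(1) in \<open>auto simp: b_def sums_unique[OF sums, symmetric] intro!: summable_mult\<close>)
  also have "\<dots> = 2 powr (r / 2) * sqrt A * n * (\<Sum>l. (1 + lam l) powr (r / 2) * b l)"
    using W(1) by (intro suminf_mult) (simp add: b_def)
  also have "\<dots> \<le> 2 powr (r / 2) * sqrt A * n * ?W"
    using W(2) n0 A0 by (intro mult_left_mono) (auto simp: b_def)
  finally have "sqrt A * sqrt A \<le> sqrt A * (2 powr (r / 2) * ?W * n)" using A0 by (simp add: ac_simps)
  moreover have "2 powr (r / 2) * ?W * n \<ge> 0"
    by (intro mult_nonneg_nonneg real_sqrt_ge_zero suminf_nonneg multiplicity_powr_summable[OF sr] fs n0)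
       (auto simp: energy_nonneg)
  \<comment> \<open>Cancels one factor sqrt A; when A = 0 the claim follows from the nonnegativity
    of the right side.\<close>
  moreover have "a \<le> b" if "a * a \<le> a * b" "b \<ge> 0" for a b :: real
    using that by (cases "a > 0") (auto dest: mult_left_le_imp_le)
  ultimately have "sqrt A \<le> 2 powr (r / 2) * ?W * n" by blast
  then have "(sqrt A)\<^sup>2 \<le> (2 powr (r / 2) * ?W * n)\<^sup>2" using A0 by (intro power_mono) auto
  then show ?thesis using A0 by (simp add: A_def n_def \<nu>_def ac_simps)
qed

section \<open>The heat kernel\<close>

text \<open>Parametrised by the time t = 1/n^2, in which the semigroup law takes its usual
  form.\<close>

definition heat :: "real \<Rightarrow> 'a \<Rightarrow> 'a \<Rightarrow> real" where
  "heat t x y = (\<Sum>l. exp (- t * lam l) * (\<Sum>k=1..Z l. Y l k x * Y l k y))"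

lemma heat_kernel_eq: "heat_kernel d Z Y n x y = heat (1 / n\<^sup>2) x y"
  by (simp add: heat_kernel_def heat_def)

lemma heat_summable: "0 < t \<Longrightarrow> t \<le> 1 \<Longrightarrow> summable (\<lambda>l. exp (- t * lam l) * real (Z l))"
  using heat_trace_bound by blast

lemma heat_term_bound:
  assumes "x \<in> sphere 0 1" "y \<in> sphere 0 1"
  shows "\<bar>exp (- t * lam l) * (\<Sum>k=1..Z l. Y l k x * Y l k y)\<bar> \<le> exp (- t * lam l) * real (Z l)"
  unfolding abs_mult using kernel_bound[OF assms] by (intro mult_mono) auto

lemma heat_continuous:
  assumes "0 < t" "t \<le> 1" "y \<in> sphere 0 1"
  shows "continuous_on (sphere 0 1) (\<lambda>x. heat t x y)"
  unfolding heat_def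
  by (rule continuous_on_sphere_suminf[OF _ heat_term_bound[OF _ assms(3)] heat_summable[OF assms(1,2)]])
     (intro continuous_on_mult continuous_on_const continuous_on_sum Y_continuous)

lemma integral_heat:
  assumes t: "0 < t" "t \<le> 1" and y: "y \<in> sphere 0 1" and g: "continuous_on (sphere 0 1) g"
  shows "(LINT x|sphere_measure. heat t x y * g x) = (\<Sum>l. exp (- t * lam l) * proj g l y)"
proof -
  obtain B where B: "B > 0" "\<And>x. x \<in> sphere 0 1 \<Longrightarrow> \<bar>g x\<bar> \<le> B"
    using bounded_sphere_continuous[OF g] by blast
  let ?f = "\<lambda>l x. exp (- t * lam l) * (\<Sum>k=1..Z l. Y l k x * Y l k y)"
  have "(LINT x|sphere_measure. heat t x y * g x) = (LINT x|sphere_measure. (\<Sum>l. ?f l x * g x))"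
  proof (rule LINT_sphere_cong)
    fix x :: 'a assume x: "x \<in> sphere 0 1"
    have "summable (\<lambda>l. ?f l x)"
      by (rule summable_comparison_test'[OF heat_summable[OF t]]) (use heat_term_bound[OF x y] in simp)
    then show "heat t x y * g x = (\<Sum>l. ?f l x * g x)" unfolding heat_def by (rule suminf_mult2)
  qed
  also have "\<dots> = (\<Sum>l. LINT x|sphere_measure. ?f l x * g x)"
  proof (rule integral_sphere_suminf[where M="\<lambda>l. exp (- t * lam l) * real (Z l) * B"])
    show "continuous_on (sphere 0 1) (\<lambda>x. ?f l x * g x)" for l
      by (intro continuous_on_mult continuous_on_const continuous_on_sum Y_continuous g)
    show "\<bar>?f l x * g x\<bar> \<le> exp (- t * lam l) * real (Z l) * B" if x: "x \<in> sphere 0 1" for l x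
      unfolding abs_mult[of "?f l x"] using heat_term_bound[OF x y] B(2)[OF x] by (intro mult_mono) auto
  qed (intro summable_mult2 heat_summable t)
  also have "(\<lambda>l. LINT x|sphere_measure. ?f l x * g x) = (\<lambda>l. exp (- t * lam l) * proj g l y)"
  proof
    fix l
    have "(LINT x|sphere_measure. ?f l x * g x)
       = (LINT x|sphere_measure. (\<Sum>k=1..Z l. exp (- t * lam l) * Y l k y * (g x * Y l k x)))"
      by (simp add: sum_distrib_left sum_distrib_right ac_simps)
    also have "\<dots> = (\<Sum>k=1..Z l. exp (- t * lam l) * Y l k y * (LINT x|sphere_measure. g x * Y l k x))"
      by (subst Bochner_Integration.integral_sum)
        (auto intro!: integrable_mult_right integrable_sphere_continuous continuous_on_mult g Y_continuous)
    also have "\<dots> = exp (- t * lam l) * proj g l y"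
      by (simp add: proj_def coeff_def harm_def sum_distrib_left ac_simps)
    finally show "(LINT x|sphere_measure. ?f l x * g x) = exp (- t * lam l) * proj g l y" .
  qed
  finally show ?thesis .
qed

lemma coeff_heat:
  assumes t: "0 < t" "t \<le> 1" and y: "y \<in> sphere 0 1" and i: "valid_idx i"
  shows "coeff (\<lambda>x. heat t x y) i = exp (- t * eig i) * harm i y"
proof -
  have p: "proj (harm i) l y = (if l = fst i then harm i y else 0)" for l
  proof -
    have "proj (harm i) l y = (\<Sum>k=1..Z l. if i = (l, k) then harm i y else 0)"
      unfolding proj_def coeff_def
      by (intro sum.cong refl, subst harm_orthonormal) (use i in \<open>auto simp: valid_idx_def harm_def\<close>)
    also have "\<dots> = (if l = fst i then harm i y else 0)"
    proof (cases "l = fst i")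
      case True
      then have "(\<Sum>k=1..Z l. if i = (l, k) then harm i y else 0) = (\<Sum>k=1..Z l. if k = snd i then harm i y else 0)"
        by (intro sum.cong) (auto simp: prod_eq_iff)
      also have "\<dots> = harm i y" using i True by (simp add: valid_idx_def)
      finally show ?thesis using True by simp
    next
      case False
      then show ?thesis by (auto intro!: sum.neutral)
    qed
    finally show ?thesis .
  qed
  have "coeff (\<lambda>x. heat t x y) i = (\<Sum>l. exp (- t * lam l) * proj (harm i) l y)"
    unfolding coeff_def by (rule integral_heat[OF t y harm_continuous[OF i]])
  also have "\<dots> = (\<Sum>l\<in>{fst i}. exp (- t * lam l) * proj (harm i) l y)"
    by (rule suminf_finite) (auto simp: p)
  finally show ?thesis by (simp add: p eig_def)
qed

section \<open>Error of the hyperinterpolation in Sobolev norms\<close>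

lemma hyperinterpolation_continuous:
  assumes "n \<ge> 1" "\<And>j. j \<in> {1..m} \<Longrightarrow> x j \<in> sphere (0::'a) 1"
  shows "continuous_on (sphere 0 1) (heat_hyperinterpolation d Z Y m x w n f)"
proof -
  have n: "0 < 1 / n\<^sup>2" "1 / n\<^sup>2 \<le> 1" using assms(1) by auto
  show ?thesis
    unfolding heat_hyperinterpolation_def[abs_def] heat_kernel_eq
    by (intro continuous_on_sum continuous_on_mult continuous_on_const heat_continuous n assms(2))
qed

lemma coeff_hyperinterpolation:
  assumes n: "n \<ge> 1" and x: "\<And>j. j \<in> {1..m} \<Longrightarrow> x j \<in> sphere (0::'a) 1" and i: "valid_idx i"
  shows "coeff (heat_hyperinterpolation d Z Y m x w n f) i = exp (- (eig i / n\<^sup>2)) * (\<Sum>j=1..m. w j * (f (x j) * harm i (x j)))"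
proof -
  have n': "0 < 1 / n\<^sup>2" "1 / n\<^sup>2 \<le> 1" using n by auto
  have "coeff (heat_hyperinterpolation d Z Y m x w n f) i
     = (LINT y|sphere_measure. (\<Sum>j=1..m. w j * f (x j) * (heat (1 / n\<^sup>2) y (x j) * harm i y)))"
    unfolding coeff_def heat_hyperinterpolation_def heat_kernel_eq by (simp add: sum_distrib_right mult.assoc)
  also have "\<dots> = (\<Sum>j=1..m. w j * f (x j) * coeff (\<lambda>y. heat (1 / n\<^sup>2) y (x j)) i)"
    unfolding coeff_def
    by (subst Bochner_Integration.integral_sum)
       (use n' x i in \<open>auto intro!: integrable_mult_right integrable_sphere_continuous continuous_on_mult heat_continuous harm_continuous\<close>)
  also have "\<dots> = (\<Sum>j=1..m. w j * f (x j) * (exp (- (eig i / n\<^sup>2)) * harm i (x j)))"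
    using x by (intro sum.cong refl) (simp add: coeff_heat[OF n' _ i])
  finally show ?thesis by (simp add: sum_distrib_left ac_simps)
qed

lemma hyperinterpolation_error:
  assumes x: "\<And>j. j \<in> {1..m} \<Longrightarrow> x j \<in> sphere (0::'a) 1"
    and nu: "sampling_error m x w \<in> sobolev_space d Z Y (- r)"
    and f: "continuous_on (sphere 0 1) f" and fs: "dist_of_fun f \<in> sobolev_space d Z Y s"
    and r: "r \<ge> 0" and sr: "s - r > d / 2" and q: "0 \<le> q" "0 < s - q" "s - q \<le> 2" and n: "n \<ge> 1"
  defines "E \<equiv> dist_of_fun (\<lambda>y. f y - heat_hyperinterpolation d Z Y m x w n f y)"
  defines "K \<equiv> 2 powr (r / 2) * sqrt (\<Sum>l. (1 + lam l) powr (- (s - r)) * Z l)"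
  shows "E \<in> sobolev_space d Z Y q"
    "sobolev_norm d Z Y q E \<le> (sqrt 2 * n powr (- (s - q))
       + sqrt (2 * max 1 (q + r) powr (q + r)) * K * (n powr (q + r) * sobolev_norm d Z Y (- r) (sampling_error m x w)))
         * sobolev_norm d Z Y s (dist_of_fun f)"
proof -
  define \<nu> where "\<nu> = sampling_error m x w"
  define N\<nu> where "N\<nu> = sobolev_norm d Z Y (- r) \<nu>"
  define Nf where "Nf = sobolev_norm d Z Y s (dist_of_fun f)"
  define G where "G = max 1 (q + r) powr (q + r)"
  define p where "p = s - q"
  define g where "g = (\<lambda>y. f y - heat_hyperinterpolation d Z Y m x w n f y)"
  have nus: "summable (sobolev_term d Z Y (- r) \<nu>)" using nu by (simp add: sobolev_space_def \<nu>_def)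
  have fs': "summable (sobolev_term d Z Y s (dist_of_fun f))" using fs by (simp add: sobolev_space_def)
  have fse: "summable (\<lambda>l. (1 + lam l) powr s * energy f l)"
    using fs' by (simp add: sobolev_term_dist_of_fun[abs_def])
  have N0: "N\<nu> \<ge> 0" "Nf \<ge> 0" unfolding N\<nu>_def Nf_def by (intro sobolev_norm_nonneg nus fs')+
  have K0: "K \<ge> 0" unfolding K_def
    by (intro mult_nonneg_nonneg real_sqrt_ge_zero suminf_nonneg multiplicity_powr_summable sr) auto
  have G0: "G \<ge> 0" by (simp add: G_def)
  have Fc: "continuous_on (sphere 0 1) (heat_hyperinterpolation d Z Y m x w n f)"
    by (rule hyperinterpolation_continuous[OF n x])
  have gc: "continuous_on (sphere 0 1) g" unfolding g_def by (intro continuous_on_diff f Fc)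
  \<comment> \<open>The quadrature sum of f times a harmonic is the exact integral plus \<nu> of the
    product; the integral part combines with the coefficient of f to the factor 1 - exp
    (-\<lambda>/n^2).\<close>
  have cg: "coeff g i = (1 - exp (- (eig i / n\<^sup>2))) * coeff f i - exp (- (eig i / n\<^sup>2)) * \<nu> (\<lambda>y. f y * harm i y)"
    if i: "valid_idx i" for i
  proof -
    have "coeff g i = coeff f i - coeff (heat_hyperinterpolation d Z Y m x w n f) i"
      unfolding coeff_def g_def left_diff_distrib
      by (rule Bochner_Integration.integral_diff; intro integrable_sphere_continuous continuous_on_mult f Fc harm_continuous i)
    moreover have "coeff (heat_hyperinterpolation d Z Y m x w n f) i
        = exp (- (eig i / n\<^sup>2)) * (\<Sum>j=1..m. w j * (f (x j) * harm i (x j)))"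
      by (rule coeff_hyperinterpolation[OF n x i])
    moreover have "(\<Sum>j=1..m. w j * (f (x j) * harm i (x j))) = \<nu> (\<lambda>y. f y * harm i y) + coeff f i"
      by (simp add: \<nu>_def sampling_error_def coeff_def)
    ultimately show ?thesis by (simp only:) (simp add: algebra_simps)
  qed
  define A where "A = sqrt 2 * n powr (- p) * Nf"
  define B where "B = sqrt (2 * G) * (n powr (q + r)) * (K * Nf * N\<nu>)"
  have AB0: "A \<ge> 0" "B \<ge> 0" unfolding A_def B_def using N0 K0 G0 by (auto intro!: mult_nonneg_nonneg)
  have part: "(\<Sum>i\<in>idx M. (1 + eig i) powr q * (dist_of_fun g (harm i))\<^sup>2) \<le> (A + B)\<^sup>2" for M
  proof -
    have "(\<Sum>i\<in>idx M. (1 + eig i) powr q * (dist_of_fun g (harm i))\<^sup>2)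
      \<le> (\<Sum>i\<in>idx M. 2 * (n powr (- p))\<^sup>2 * ((1 + eig i) powr s * (dist_of_fun f (harm i))\<^sup>2)
          + 2 * G * (n powr (q + r))\<^sup>2 * ((1 + eig i) powr (- r) * (\<nu> (\<lambda>y. f y * harm i y))\<^sup>2))"
    proof (rule sum_mono)
      fix i assume "i \<in> idx M"
      then have i: "valid_idx i" by (rule idx_valid)
      define u where "u = eig i / n\<^sup>2"
      define e where "e = exp (- u)"
      have u0: "u \<ge> 0" using eig_nonneg n by (simp add: u_def)
      have eig: "eig i = u * n\<^sup>2" using n by (simp add: u_def)
      have pos: "1 + eig i > 0" using eig_nonneg[of i] by linarith
      have n2: "(n\<^sup>2) powr a = (n powr a)\<^sup>2" for a using n by (simp add: power2_eq_square powr_mult)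
      have "(dist_of_fun g (harm i))\<^sup>2 = ((1 - e) * coeff f i - e * \<nu> (\<lambda>y. f y * harm i y))\<^sup>2"
        by (simp add: dist_of_fun_harm cg[OF i] e_def u_def)
      \<comment> \<open>From (a - b)^2 <= 2 a^2 + 2 b^2, the origin of the factors sqrt 2 in the
        constants.\<close>
      also have "\<dots> \<le> 2 * ((1 - e) * coeff f i)\<^sup>2 + 2 * (e * \<nu> (\<lambda>y. f y * harm i y))\<^sup>2"
        using zero_le_power2[of "(1 - e) * coeff f i + e * \<nu> (\<lambda>y. f y * harm i y)"]
        by (simp only: power2_sum power2_diff)
      finally have "(1 + eig i) powr q * (dist_of_fun g (harm i))\<^sup>2
         \<le> (1 + eig i) powr q * (2 * ((1 - e) * coeff f i)\<^sup>2 + 2 * (e * \<nu> (\<lambda>y. f y * harm i y))\<^sup>2)"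
        by (rule mult_left_mono) simp
      also have "\<dots> = 2 * ((1 + eig i) powr q * (1 - e)\<^sup>2) * (coeff f i)\<^sup>2 + 2 * ((1 + eig i) powr q * e\<^sup>2) * (\<nu> (\<lambda>y. f y * harm i y))\<^sup>2"
        by (simp only: power_mult_distrib) (simp add: distrib_left ac_simps)
      also have "\<dots> \<le> 2 * ((n powr (- p))\<^sup>2 * (1 + eig i) powr s) * (coeff f i)\<^sup>2
         + 2 * (G * (n powr (q + r))\<^sup>2 * (1 + eig i) powr (- r)) * (\<nu> (\<lambda>y. f y * harm i y))\<^sup>2"
      proof (intro add_mono mult_right_mono mult_left_mono)
        \<comment> \<open>Smoothing part: u^p = \<lambda>^p n^(-2 p) with p = s - q, and enlarging
          \<lambda>^p to (1 + \<lambda>)^p completes the weight from q to s.\<close>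
        have "(1 + eig i) powr q * (1 - e)\<^sup>2 \<le> (1 + eig i) powr q * u powr p"
          unfolding e_def p_def by (intro mult_left_mono one_minus_exp_bound u0 q) auto
        also have "u powr p = eig i powr p * (n powr (- p))\<^sup>2"
          unfolding u_def n2[symmetric] using eig_nonneg[of i] n by (simp add: powr_divide powr_minus_divide)
        also have "(1 + eig i) powr q * (eig i powr p * (n powr (- p))\<^sup>2) \<le> (1 + eig i) powr q * ((1 + eig i) powr p * (n powr (- p))\<^sup>2)"
          using q eig_nonneg[of i] by (intro mult_left_mono mult_right_mono powr_mono2) (auto simp: p_def)
        also have "\<dots> = (n powr (- p))\<^sup>2 * (1 + eig i) powr s"
          by (simp add: p_def powr_add[symmetric] mult.assoc[symmetric])
        finally show "(1 + eig i) powr q * (1 - e)\<^sup>2 \<le> (n powr (- p))\<^sup>2 * (1 + eig i) powr s" .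
        \<comment> \<open>Quadrature part: n >= 1 gives 1 + \<lambda> <= n^2 (1 + u). The q + r
          powers of 1 + u are absorbed by exp (-2 u), and the compensating weight (1 + \<lambda>)^-r
          is the one of the H^-r norm.\<close>
        have "(1 + eig i) powr (q + r) \<le> (n\<^sup>2 * (1 + u)) powr (q + r)"
        proof (rule powr_mono2)
          have "1 \<le> n\<^sup>2" using n by simp
          then show "1 + eig i \<le> n\<^sup>2 * (1 + u)" unfolding eig by (simp add: algebra_simps)
        qed (use q r pos in auto)
        also have "\<dots> = (n powr (q + r))\<^sup>2 * (1 + u) powr (q + r)" using u0 by (simp add: powr_mult n2)
        finally have "(1 + eig i) powr (q + r) * e\<^sup>2 \<le> (n powr (q + r))\<^sup>2 * (1 + u) powr (q + r) * e\<^sup>2"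
          by (rule mult_right_mono) simp
        also have "\<dots> = (n powr (q + r))\<^sup>2 * ((1 + u) powr (q + r) * exp (- 2 * u))"
          by (simp add: e_def power2_eq_square exp_add[symmetric] mult.assoc)
        also have "\<dots> \<le> (n powr (q + r))\<^sup>2 * G"
          unfolding G_def using q r u0 by (intro mult_left_mono powr_exp_bounded) auto
        finally have "(1 + eig i) powr (- r) * ((1 + eig i) powr (q + r) * e\<^sup>2) \<le> (1 + eig i) powr (- r) * ((n powr (q + r))\<^sup>2 * G)"
          by (rule mult_left_mono) simp
        moreover have "(1 + eig i) powr (- r) * ((1 + eig i) powr (q + r) * e\<^sup>2) = (1 + eig i) powr q * e\<^sup>2"
          by (simp add: powr_add[symmetric] mult.assoc[symmetric])
        ultimately have "(1 + eig i) powr q * e\<^sup>2 \<le> (1 + eig i) powr (- r) * ((n powr (q + r))\<^sup>2 * G)"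
          by (simp only:)
        then show "(1 + eig i) powr q * e\<^sup>2 \<le> G * (n powr (q + r))\<^sup>2 * (1 + eig i) powr (- r)"
          by (simp add: ac_simps)
      qed auto
      finally show "(1 + eig i) powr q * (dist_of_fun g (harm i))\<^sup>2
        \<le> 2 * (n powr (- p))\<^sup>2 * ((1 + eig i) powr s * (dist_of_fun f (harm i))\<^sup>2)
          + 2 * G * (n powr (q + r))\<^sup>2 * ((1 + eig i) powr (- r) * (\<nu> (\<lambda>y. f y * harm i y))\<^sup>2)"
        by (simp add: dist_of_fun_harm ac_simps)
    qed
    also have "\<dots> = 2 * (n powr (- p))\<^sup>2 * (\<Sum>i\<in>idx M. (1 + eig i) powr s * (dist_of_fun f (harm i))\<^sup>2)
          + 2 * G * (n powr (q + r))\<^sup>2 * (\<Sum>i\<in>idx M. (1 + eig i) powr (- r) * (\<nu> (\<lambda>y. f y * harm i y))\<^sup>2)"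
      by (simp only: sum.distrib sum_distrib_left)
    also have "\<dots> \<le> 2 * (n powr (- p))\<^sup>2 * Nf\<^sup>2 + 2 * G * (n powr (q + r))\<^sup>2 * (K * Nf * N\<nu>)\<^sup>2"
    proof (intro add_mono mult_left_mono)
      show "(\<Sum>i\<in>idx M. (1 + eig i) powr s * (dist_of_fun f (harm i))\<^sup>2) \<le> Nf\<^sup>2"
        unfolding Nf_def by (rule sobolev_partial_le[OF fs'])
      have "Nf = sqrt (\<Sum>l. (1 + lam l) powr s * energy f l)"
        by (simp add: Nf_def sobolev_norm_def sobolev_term_dist_of_fun)
      then show "(\<Sum>i\<in>idx M. (1 + eig i) powr (- r) * (\<nu> (\<lambda>y. f y * harm i y))\<^sup>2) \<le> (K * Nf * N\<nu>)\<^sup>2"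
        using sampling_error_multiplication[OF x nus[unfolded \<nu>_def] f fse r sr, of M]
        by (simp add: \<nu>_def N\<nu>_def K_def)
    qed (use G0 in auto)
    also have "\<dots> = A\<^sup>2 + B\<^sup>2"
      using G0 by (simp add: A_def B_def power_mult_distrib)
    also have "\<dots> \<le> (A + B)\<^sup>2" using AB0 by (simp add: power2_sum)
    finally show ?thesis .
  qed
  have Eg: "E = dist_of_fun g" by (simp add: E_def g_def)
  show "E \<in> sobolev_space d Z Y q"
    unfolding Eg sobolev_space_def using sphere_distribution_dist_of_fun[OF gc] sobolev_normI(1)[OF part] AB0 by simp
  have "sobolev_norm d Z Y q E \<le> A + B" unfolding Eg using sobolev_normI(2)[OF part] AB0 by simp
  then show "sobolev_norm d Z Y q E \<le> (sqrt 2 * n powr (- (s - q))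
       + sqrt (2 * max 1 (q + r) powr (q + r)) * K * (n powr (q + r) * sobolev_norm d Z Y (- r) (sampling_error m x w)))
         * sobolev_norm d Z Y s (dist_of_fun f)"
    by (simp add: A_def B_def p_def G_def Nf_def N\<nu>_def \<nu>_def algebra_simps)
qed

end

section \<open>Positivity and moments of the heat kernel\<close>

context harmonic_basis
begin

text \<open>On polynomials this is a finite sum, which can be evaluated at t = 0 and differentiated
  in t; for 0 < t <= 1 it is the integral against the heat kernel
  (\<open>integral_heat_op\<close>).\<close>

definition heat_op :: "real \<Rightarrow> ('a \<Rightarrow> real) \<Rightarrow> 'a \<Rightarrow> real" where
  "heat_op t f y = (\<Sum>l. exp (- t * lam l) * proj f l y)"

lemma heat_op_poly:
  assumes "poly_space N f"
  shows "heat_op t f y = (\<Sum>i\<in>idx N. exp (- t * eig i) * (coeff f i * harm i y))"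
proof -
  have "proj f l y = 0" if "l \<notin> {..N}" for l
    unfolding proj_def using poly_space_coeff_0[OF assms] that by (intro sum.neutral) (auto simp: valid_idx_def)
  then have "heat_op t f y = (\<Sum>l\<le>N. exp (- t * lam l) * proj f l y)"
    unfolding heat_op_def by (intro suminf_finite) auto
  then show ?thesis by (simp add: sum_idx proj_def eig_def harm_def sum_distrib_left)
qed

lemma poly_space_common:
  assumes "real_polynomial_function p" "real_polynomial_function q"
  obtains N where "poly_space N p" "poly_space N q"
proof -
  obtain N M where "poly_space N p" "poly_space M q" using assms poly_space_poly by meson
  then have "poly_space (max N M) p" "poly_space (max N M) q" by (auto intro: poly_space_mono[rotated])
  then show ?thesis by (rule that)
qed

lemma coeff_lin:
  assumes "continuous_on (sphere 0 1) f" "continuous_on (sphere 0 1) g" "valid_idx i"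
  shows "coeff (\<lambda>x. a * f x + b * g x) i = a * coeff f i + b * coeff g i"
proof -
  have "coeff (\<lambda>x. a * f x + b * g x) i = (LINT x|sphere_measure. a * (f x * harm i x) + b * (g x * harm i x))"
    by (simp add: coeff_def algebra_simps)
  also have "\<dots> = a * coeff f i + b * coeff g i"
    unfolding coeff_def
    by (subst Bochner_Integration.integral_add)
       (use assms in \<open>auto intro!: integrable_mult_right integrable_sphere_continuous continuous_on_mult harm_continuous\<close>)
  finally show ?thesis .
qed

lemma heat_op_lin:
  assumes f: "real_polynomial_function f" and g: "real_polynomial_function g"
  shows "heat_op t (\<lambda>x. a * f x + b * g x) y = a * heat_op t f y + b * heat_op t g y"
proof -
  obtain N where N: "poly_space N f" "poly_space N g" by (rule poly_space_common[OF f g])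
  have "poly_space N (\<lambda>x. a * f x + b * g x)" by (intro lin_span_add lin_span_cmult N)
  then have "heat_op t (\<lambda>x. a * f x + b * g x) y
     = (\<Sum>i\<in>idx N. exp (- t * eig i) * ((a * coeff f i + b * coeff g i) * harm i y))"
    unfolding heat_op_poly[OF \<open>poly_space N (\<lambda>x. a * f x + b * g x)\<close>]
    by (intro sum.cong refl)
       (simp only: coeff_lin[OF poly_space_continuous[OF N(1)] poly_space_continuous[OF N(2)] idx_valid])
  also have "\<dots> = a * heat_op t f y + b * heat_op t g y"
    by (simp add: heat_op_poly[OF N(1)] heat_op_poly[OF N(2)] sum_distrib_left algebra_simps sum.distrib)
  finally show ?thesis .
qed

lemma heat_op_0: "poly_space N f \<Longrightarrow> y \<in> sphere 0 1 \<Longrightarrow> heat_op 0 f y = f y"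
  by (simp add: heat_op_poly poly_space_expand)

lemma harm_polys:
  obtains P where "\<And>i. i \<in> idx N \<Longrightarrow> harmonic_poly (fst i) (P i)"
    "\<And>i x. i \<in> idx N \<Longrightarrow> x \<in> sphere 0 1 \<Longrightarrow> harm i x = P i x"
proof -
  have "\<forall>i. \<exists>h. i \<in> idx N \<longrightarrow> harmonic_poly (fst i) h \<and> (\<forall>x\<in>sphere 0 1. harm i x = h x)"
    by (meson harm_poly idx_valid)
  then obtain P where "\<forall>i. i \<in> idx N \<longrightarrow> harmonic_poly (fst i) (P i) \<and> (\<forall>x\<in>sphere 0 1. harm i x = P i x)"
    by (rule choice[THEN exE])
  then show ?thesis using that[of P] by blast
qed

text \<open>The harmonics are prescribed only on the sphere, so p is first replaced by a combination
  of harmonic polynomials with the same values there; these are eigenfunctions.\<close>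

lemma sphere_laplacian_expand:
  assumes p: "real_polynomial_function p" and N: "poly_space N p" and x: "x \<in> sphere 0 1"
  shows "sphere_laplacian p x = (\<Sum>i\<in>idx N. - eig i * coeff p i * harm i x)"
proof -
  obtain P where P: "\<And>i. i \<in> idx N \<Longrightarrow> harmonic_poly (fst i) (P i)"
    "\<And>i x. i \<in> idx N \<Longrightarrow> x \<in> sphere 0 1 \<Longrightarrow> harm i x = P i x" using harm_polys by blast
  have rpP: "real_polynomial_function (P i)" if "i \<in> idx N" for i
    using P(1)[OF that] by (auto simp: harmonic_poly_def intro: homog_rp)
  have "sphere_laplacian p x = sphere_laplacian (\<lambda>x. \<Sum>i\<in>idx N. coeff p i * P i x) x"
  proof (rule sphere_laplacian_sphere_cong[OF p _ _ x])
    show "real_polynomial_function (\<lambda>x. \<Sum>i\<in>idx N. coeff p i * P i x)"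
      by (intro rp_sum rp_cmult rpP)
    show "p x = (\<Sum>i\<in>idx N. coeff p i * P i x)" if "x \<in> sphere 0 1" for x
      unfolding poly_space_expand[OF N that] using P(2)[OF _ that] by simp
  qed
  also have "\<dots> = (\<Sum>i\<in>idx N. coeff p i * sphere_laplacian (P i) x)"
    by (rule sphere_laplacian_lincomb) (rule rpP)
  also have "\<dots> = (\<Sum>i\<in>idx N. - eig i * coeff p i * harm i x)"
    by (intro sum.cong refl) (simp add: sphere_laplacian_harmonic[OF P(1) dim] eig_def P(2)[OF _ x])
  finally show ?thesis .
qed

text \<open>Positivity of the resolvent: at a minimum of u on the sphere the Laplacian of u is nonnegative.\<close>

lemma resolvent_nonneg:
  assumes e: "\<epsilon> \<ge> 0" and pos: "\<And>x. x \<in> sphere 0 1 \<Longrightarrow> (\<Sum>i\<in>idx N. (1 + \<epsilon> * eig i) * c i * harm i x) \<ge> 0"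
    and x: "x \<in> sphere 0 1"
  shows "(\<Sum>i\<in>idx N. c i * harm i x) \<ge> 0"
proof -
  obtain P where P: "\<And>i. i \<in> idx N \<Longrightarrow> harmonic_poly (fst i) (P i)"
    "\<And>i x. i \<in> idx N \<Longrightarrow> x \<in> sphere 0 1 \<Longrightarrow> harm i x = P i x" using harm_polys by blast
  have rpP: "real_polynomial_function (P i)" if "i \<in> idx N" for i
    using P(1)[OF that] by (auto simp: harmonic_poly_def intro: homog_rp)
  define p where "p = (\<lambda>x. \<Sum>i\<in>idx N. c i * P i x)"
  have p: "real_polynomial_function p" unfolding p_def by (intro rp_sum rp_cmult rpP)
  have ph: "p x = (\<Sum>i\<in>idx N. c i * harm i x)" if "x \<in> sphere 0 1" for x
    unfolding p_def using P(2)[OF _ that] by simp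
  have pN: "poly_space N p"
    by (rule lin_span_cong[OF poly_space_partial_sum]) (simp only: ph)
  have cp: "coeff p i = c i" if "i \<in> idx N" for i
    using coeff_lincomb[OF idx_valid idx_valid[OF that] finite_idx ph] that by simp
  obtain y where y: "y \<in> sphere 0 1" "\<And>z. z \<in> sphere 0 1 \<Longrightarrow> p y \<le> p z"
    using continuous_attains_inf[of "sphere (0::'a) 1" p] rp_continuous[OF p] x by auto
  have "0 \<le> (\<Sum>i\<in>idx N. (1 + \<epsilon> * eig i) * c i * harm i y)" by (rule pos[OF y(1)])
  also have "\<dots> = p y - \<epsilon> * sphere_laplacian p y"
    by (simp add: sphere_laplacian_expand[OF p pN y(1)] ph[OF y(1)] cp sum_distrib_left sum_negf algebra_simps sum.distrib)
  also have "\<dots> \<le> p y" using sphere_laplacian_nonneg_at_min[OF p y] e by simp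
  also have "\<dots> \<le> p x" by (rule y(2)[OF x])
  finally show ?thesis by (simp add: ph[OF x])
qed

text \<open>Implicit Euler scheme: the heat flow is the limit of (1 - (t/n) \<Delta>)^-n, and each
  of the n resolvents preserves nonnegativity.\<close>

lemma heat_op_nonneg:
  assumes f: "poly_space N f" and pos: "\<And>x. x \<in> sphere 0 1 \<Longrightarrow> f x \<ge> 0" and t: "t \<ge> 0" and y: "y \<in> sphere 0 1"
  shows "heat_op t f y \<ge> 0"
proof -
  have iter: "\<forall>x\<in>sphere 0 1. (\<Sum>i\<in>idx N. coeff f i / (1 + \<epsilon> * eig i) ^ n * harm i x) \<ge> 0" if e: "\<epsilon> \<ge> 0" for \<epsilon> n
  proof (induction n)
    case 0
    then show ?case using pos poly_space_expand[OF f] by simp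
  next
    case (Suc n)
    show ?case
    proof
      fix x :: 'a assume x: "x \<in> sphere 0 1"
      show "(\<Sum>i\<in>idx N. coeff f i / (1 + \<epsilon> * eig i) ^ Suc n * harm i x) \<ge> 0"
      proof (rule resolvent_nonneg[OF e _ x])
        fix z :: 'a assume z: "z \<in> sphere 0 1"
        have "1 + \<epsilon> * eig i \<noteq> 0" for i using e eig_nonneg[of i] by (smt (verit) mult_nonneg_nonneg)
        then have "(\<Sum>i\<in>idx N. (1 + \<epsilon> * eig i) * (coeff f i / (1 + \<epsilon> * eig i) ^ Suc n) * harm i z)
          = (\<Sum>i\<in>idx N. coeff f i / (1 + \<epsilon> * eig i) ^ n * harm i z)"
          by (intro sum.cong) auto
        then show "(\<Sum>i\<in>idx N. (1 + \<epsilon> * eig i) * (coeff f i / (1 + \<epsilon> * eig i) ^ Suc n) * harm i z) \<ge> 0"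
          using Suc.IH z by simp
      qed
    qed
  qed
  have "(\<lambda>n. \<Sum>i\<in>idx N. coeff f i / (1 + t * eig i / real n) ^ n * harm i y)
     \<longlonglongrightarrow> (\<Sum>i\<in>idx N. coeff f i / exp (t * eig i) * harm i y)"
    by (intro tendsto_sum tendsto_mult tendsto_divide tendsto_const tendsto_exp_limit_sequentially) simp
  moreover have "(\<Sum>i\<in>idx N. coeff f i / (1 + t * eig i / real n) ^ n * harm i y) \<ge> 0" for n
    using iter[of "t / real n" n] t y by simp
  ultimately have "0 \<le> (\<Sum>i\<in>idx N. coeff f i / exp (t * eig i) * harm i y)"
    by (intro LIMSEQ_le_const) auto
  also have "\<dots> = heat_op t f y"
    unfolding heat_op_poly[OF f] by (intro sum.cong refl) (simp add: exp_minus field_simps)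
  finally show ?thesis .
qed

lemma heat_op_mono:
  assumes f: "real_polynomial_function f" and g: "real_polynomial_function g"
    and le: "\<And>x. x \<in> sphere 0 1 \<Longrightarrow> f x \<le> g x" and t: "t \<ge> 0" and y: "y \<in> sphere 0 1"
  shows "heat_op t f y \<le> heat_op t g y"
proof -
  obtain N where N: "poly_space N f" "poly_space N g" by (rule poly_space_common[OF f g])
  have "poly_space N (\<lambda>x. 1 * g x + (-1) * f x)" by (intro lin_span_add lin_span_cmult N)
  then have "0 \<le> heat_op t (\<lambda>x. 1 * g x + (-1) * f x) y"
    by (rule heat_op_nonneg) (use le t y in auto)
  then show ?thesis unfolding heat_op_lin[OF g f] by simp
qed

lemma integral_heat_op:
  assumes "0 < t" "t \<le> 1" "y \<in> sphere 0 1" "continuous_on (sphere 0 1) f"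
  shows "(LINT x|sphere_measure. heat t x y * f x) = heat_op t f y"
  unfolding heat_op_def by (rule integral_heat[OF assms])

text \<open>The kernel is tested against its own negative part f, which makes the integral of the
  product minus that of f^2. Positivity is available on polynomials, so f is approximated from above
  by the nonnegative polynomials p + \<epsilon>.\<close>

lemma heat_nonneg:
  assumes t: "0 < t" "t \<le> 1" and x: "x \<in> sphere 0 1" and y: "y \<in> sphere 0 1"
  shows "heat t x y \<ge> 0"
proof -
  interpret prob_space "sphere_measure :: 'a measure" by (rule prob_space_sphere_measure)
  define f where "f = (\<lambda>x. max 0 (- heat t x y))"
  note hc = heat_continuous[OF t y]
  have fc: "continuous_on (sphere 0 1) f" unfolding f_def by (intro continuous_intros hc)
  obtain B where B: "B > 0" "\<And>x. x \<in> sphere 0 1 \<Longrightarrow> \<bar>heat t x y\<bar> \<le> B"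
    using bounded_sphere_continuous[OF hc] by blast
  have "(LINT x|sphere_measure. f x * f x) \<le> 0 + e" if e: "e > 0" for e
  proof -
    \<comment> \<open>The function p + \<epsilon> differs from f by at most 2 \<epsilon> and B
      bounds the kernel, so the integrand of the error is at most e.\<close>
    define \<epsilon> where "\<epsilon> = e / (2 * B)"
    have eps: "\<epsilon> > 0" using e B by (simp add: \<epsilon>_def)
    obtain p where p: "real_polynomial_function p" "\<And>x. x \<in> sphere 0 1 \<Longrightarrow> \<bar>f x - p x\<bar> < \<epsilon>"
      using Stone_Weierstrass_real_polynomial_function[of "sphere 0 1" f \<epsilon>] fc eps by auto
    have rq: "real_polynomial_function (\<lambda>x. p x + \<epsilon>)" by (intro rp_intros p)
    obtain N where N: "poly_space N (\<lambda>x. p x + \<epsilon>)" using poly_space_poly[OF rq] by blast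
    note qc = rp_continuous[OF rq, of "sphere 0 1"]
    have q0: "0 \<le> heat_op t (\<lambda>x. p x + \<epsilon>) y"
    proof (rule heat_op_nonneg[OF N _ _ y])
      fix x :: 'a assume "x \<in> sphere 0 1"
      then have "\<bar>f x - p x\<bar> < \<epsilon>" by (rule p(2))
      moreover have "f x \<ge> 0" by (simp add: f_def)
      ultimately show "0 \<le> p x + \<epsilon>" by linarith
    qed (use t in simp)
    have "(LINT x|sphere_measure. f x * f x) = (LINT x|sphere_measure. heat t x y * ((p x + \<epsilon>) - f x)) - (LINT x|sphere_measure. heat t x y * (p x + \<epsilon>))"
    proof -
      have "(LINT x|sphere_measure. heat t x y * ((p x + \<epsilon>) - f x)) - (LINT x|sphere_measure. heat t x y * (p x + \<epsilon>))
        = (LINT x|sphere_measure. heat t x y * ((p x + \<epsilon>) - f x) - heat t x y * (p x + \<epsilon>))"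
        by (rule Bochner_Integration.integral_diff[symmetric];
            intro integrable_sphere_continuous continuous_on_mult hc continuous_on_diff qc fc)
      also have "\<dots> = (LINT x|sphere_measure. f x * f x)"
        by (intro LINT_sphere_cong) (simp add: f_def algebra_simps max_def)
      finally show ?thesis by simp
    qed
    also have "\<dots> \<le> (LINT x|sphere_measure. heat t x y * ((p x + \<epsilon>) - f x))"
      using q0 integral_heat_op[OF t y qc] by simp
    also have "\<dots> \<le> (LINT (x::'a)|sphere_measure. e)"
    proof (rule integral_mono)
      fix x :: 'a assume "x \<in> space sphere_measure"
      then have x: "x \<in> sphere 0 1" by simp
      have "\<bar>(p x + \<epsilon>) - f x\<bar> \<le> 2 * \<epsilon>" using p(2)[OF x] by linarith
      then have "\<bar>heat t x y\<bar> * \<bar>(p x + \<epsilon>) - f x\<bar> \<le> B * (2 * \<epsilon>)"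
        using B(2)[OF x] B(1) by (intro mult_mono) auto
      also have "\<dots> = e" using B(1) by (simp add: \<epsilon>_def)
      finally show "heat t x y * ((p x + \<epsilon>) - f x) \<le> e" by (simp add: abs_mult[symmetric])
    qed (auto intro!: integrable_sphere_continuous continuous_on_mult hc continuous_on_diff qc fc)
    also have "\<dots> = e" using prob_space by simp
    finally show ?thesis by simp
  qed
  then have "(LINT x|sphere_measure. f x * f x) \<le> 0" by (rule field_le_epsilon)
  then have "f x * f x = 0"
    using x by (intro continuous_nonneg_integral_0[of "\<lambda>x. f x * f x"] continuous_on_mult fc) auto
  then show ?thesis by (simp add: f_def max_def split: if_splits)
qed

lemma heat_bound:
  assumes "0 < t" "t \<le> 1" "x \<in> sphere 0 1" "y \<in> sphere 0 1"
  shows "heat t x y \<le> (\<Sum>l. exp (- t * lam l) * real (Z l))"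
  unfolding heat_def
proof (rule suminf_le)
  show "exp (- t * lam l) * (\<Sum>k=1..Z l. Y l k x * Y l k y) \<le> exp (- t * lam l) * real (Z l)" for l
    using heat_term_bound[OF assms(3,4), of t l] by linarith
  show "summable (\<lambda>l. exp (- t * lam l) * (\<Sum>k=1..Z l. Y l k x * Y l k y))"
    by (rule summable_comparison_test'[OF heat_summable[OF assms(1,2)]]) (use heat_term_bound[OF assms(3,4)] in simp)
qed (rule heat_summable[OF assms(1,2)])

lemma heat_semigroup:
  assumes t: "0 < t" "t \<le> 1" and x: "x \<in> sphere 0 1" and y: "y \<in> sphere 0 1"
  shows "heat (2 * t) x y = (LINT z|sphere_measure. heat t z x * heat t z y)"
proof -
  have "proj (\<lambda>z. heat t z y) l x = exp (- t * lam l) * (\<Sum>k=1..Z l. Y l k x * Y l k y)" for l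
    unfolding proj_def
    by (simp add: coeff_heat[OF t y] valid_idx_def eig_def harm_def sum_distrib_left ac_simps)
  then have "(LINT z|sphere_measure. heat t z x * heat t z y)
     = (\<Sum>l. exp (- t * lam l) * (exp (- t * lam l) * (\<Sum>k=1..Z l. Y l k x * Y l k y)))"
    using integral_heat[OF t x heat_continuous[OF t y]] by simp
  also have "\<dots> = heat (2 * t) x y"
    unfolding heat_def mult.assoc[symmetric] exp_add[symmetric] by (simp add: mult.assoc)
  finally show ?thesis by simp
qed

lemma heat_op_const_1: "y \<in> sphere 0 1 \<Longrightarrow> heat_op t (\<lambda>x. 1) y = 1"
proof -
  assume y: "y \<in> sphere 0 1"
  have "heat_op t (\<lambda>x. 1) y = heat_op 0 (\<lambda>x. 1) y"
    unfolding heat_op_poly[OF poly_space_const[of 0]]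
    by (intro sum.cong refl) (simp add: idx_iff eig_def sphere_eigenvalue_def)
  then show ?thesis using heat_op_0[OF poly_space_const y] by simp
qed

section \<open>Moments and off-diagonal decay\<close>

lemma heat_op_deriv:
  assumes p: "real_polynomial_function p" and y: "y \<in> sphere 0 1"
  shows "((\<lambda>t. heat_op t p y) has_real_derivative heat_op t (sphere_laplacian p) y) (at t)"
proof -
  note L = rp_sphere_laplacian[OF p]
  obtain N where N: "poly_space N p" "poly_space N (sphere_laplacian p)" by (rule poly_space_common[OF p L])
  have c: "coeff (sphere_laplacian p) i = - eig i * coeff p i" if "i \<in> idx N" for i
    using coeff_lincomb[OF idx_valid idx_valid[OF that] finite_idx sphere_laplacian_expand[OF p N(1)]] that by simp
  have "((\<lambda>t. \<Sum>i\<in>idx N. exp (- t * eig i) * (coeff p i * harm i y)) has_real_derivative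
     (\<Sum>i\<in>idx N. exp (- t * eig i) * (- eig i * coeff p i * harm i y))) (at t)"
    by (auto intro!: derivative_eq_intros sum.cong simp: algebra_simps)
  then show ?thesis unfolding heat_op_poly[OF N(1)] heat_op_poly[OF N(2)] by (simp add: c)
qed

text \<open>With t = x . y the exact value is k (k+1)(1 - t^2)(1 - t)^(k-1) + d (k+1) t (1 - t)^k.
  Since 1 - t^2 = (1 + t)(1 - t) <= 2 (1 - t), the operator lowers the power of 1 - t by only one,
  so each moment is driven by the preceding one.\<close>

lemma sphere_laplacian_zonal:
  fixes y :: 'a
  assumes x: "x \<in> sphere 0 1" and y: "y \<in> sphere 0 1"
  shows "sphere_laplacian (\<lambda>x. (1 - x \<bullet> y) ^ Suc k) x \<le> (2 * real k * (real k + 1) + real d * (real k + 1)) * (1 - x \<bullet> y) ^ k"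
proof -
  define g where "g = (\<lambda>x. 1 - x \<bullet> y)"
  have g: "real_polynomial_function g" unfolding g_def by (intro rp_intros)
  have pg: "partial_deriv b g = (\<lambda>x. - (b \<bullet> y))" for b
    unfolding g_def by (subst partial_deriv_diff) (auto intro: rp_intros)
  have pd: "partial_deriv b (\<lambda>x. c * g x ^ n) = (\<lambda>x. - c * real n * (b \<bullet> y) * g x ^ (n - 1))" for b c n
  proof (induction n)
    case (Suc n)
    have "partial_deriv b (\<lambda>x. (c * g x ^ n) * g x) = (\<lambda>x. (c * g x ^ n) * partial_deriv b g x + partial_deriv b (\<lambda>x. c * g x ^ n) x * g x)"
      by (rule partial_deriv_mult) (intro rp_intros g)+
    also have "\<dots> = (\<lambda>x. - c * real (Suc n) * (b \<bullet> y) * g x ^ (Suc n - 1))"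
      unfolding Suc.IH pg by (rule ext, cases n) (auto simp: algebra_simps)
    finally show ?case by (simp add: ac_simps)
  qed simp
  have pd1: "partial_deriv b (\<lambda>x. g x ^ Suc k) = (\<lambda>x. - (real k + 1) * (b \<bullet> y) * g x ^ k)" for b
    using pd[of b 1 "Suc k"] by (simp add: ac_simps)
  have pd2: "partial_deriv b (partial_deriv a (\<lambda>x. g x ^ Suc k)) x = (real k + 1) * real k * (a \<bullet> y) * (b \<bullet> y) * g x ^ (k - 1)" for a b
    unfolding pd1 pd by (simp add: algebra_simps)
  define t where "t = x \<bullet> y"
  have t: "\<bar>t\<bar> \<le> 1" using Cauchy_Schwarz_ineq2[of x y] x y by (simp add: t_def)
  have xx: "x \<bullet> x = 1" "y \<bullet> y = 1" using x y by (auto simp: dot_square_norm)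
  have gx: "g x = 1 - t" by (simp add: g_def t_def)
  have lap: "laplacian (\<lambda>x. g x ^ Suc k) x = (real k + 1) * real k * g x ^ (k - 1)"
  proof -
    have "laplacian (\<lambda>x. g x ^ Suc k) x = (\<Sum>b\<in>Basis. ((real k + 1) * real k * g x ^ (k - 1)) * ((y \<bullet> b) * (y \<bullet> b)))"
      unfolding laplacian_eq pd2 by (intro sum.cong) (auto simp: inner_commute[of y] ac_simps)
    also have "\<dots> = (real k + 1) * real k * g x ^ (k - 1)"
      unfolding sum_distrib_left[symmetric] euclidean_inner[symmetric] xx by simp
    finally show ?thesis .
  qed
  have E: "(\<Sum>b\<in>Basis. (x \<bullet> b) * partial_deriv b (\<lambda>x. g x ^ Suc k) x) = - (real k + 1) * t * g x ^ k"
  proof -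
    have "(\<Sum>b\<in>Basis. (x \<bullet> b) * partial_deriv b (\<lambda>x. g x ^ Suc k) x) = (\<Sum>b\<in>Basis. (- (real k + 1) * g x ^ k) * ((x \<bullet> b) * (y \<bullet> b)))"
      unfolding pd1 by (intro sum.cong) (auto simp: inner_commute[of y] algebra_simps)
    also have "\<dots> = - (real k + 1) * t * g x ^ k"
      unfolding sum_distrib_left[symmetric] euclidean_inner[symmetric] t_def by (simp add: algebra_simps)
    finally show ?thesis .
  qed
  have Q: "(\<Sum>a\<in>Basis. (x \<bullet> a) * (\<Sum>b\<in>Basis. (x \<bullet> b) * partial_deriv b (partial_deriv a (\<lambda>x. g x ^ Suc k)) x))
     = (real k + 1) * real k * t\<^sup>2 * g x ^ (k - 1)"
  proof -
    have "(\<Sum>b\<in>Basis. (x \<bullet> b) * partial_deriv b (partial_deriv a (\<lambda>x. g x ^ Suc k)) x)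
      = (real k + 1) * real k * g x ^ (k - 1) * (y \<bullet> a) * t" for a
    proof -
      have "(\<Sum>b\<in>Basis. (x \<bullet> b) * partial_deriv b (partial_deriv a (\<lambda>x. g x ^ Suc k)) x)
        = (\<Sum>b\<in>Basis. ((real k + 1) * real k * g x ^ (k - 1) * (y \<bullet> a)) * ((x \<bullet> b) * (y \<bullet> b)))"
        unfolding pd2 by (intro sum.cong) (auto simp: inner_commute[of y] ac_simps)
      then show ?thesis unfolding sum_distrib_left[symmetric] euclidean_inner[symmetric] t_def .
    qed
    then have "(\<Sum>a\<in>Basis. (x \<bullet> a) * (\<Sum>b\<in>Basis. (x \<bullet> b) * partial_deriv b (partial_deriv a (\<lambda>x. g x ^ Suc k)) x))
      = (\<Sum>a\<in>Basis. ((real k + 1) * real k * g x ^ (k - 1) * t) * ((x \<bullet> a) * (y \<bullet> a)))"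
      by (simp add: ac_simps)
    also have "\<dots> = (real k + 1) * real k * t\<^sup>2 * g x ^ (k - 1)"
      unfolding sum_distrib_left[symmetric] euclidean_inner[symmetric] t_def by (simp add: power2_eq_square ac_simps)
    finally show ?thesis .
  qed
  have rg: "real_polynomial_function (\<lambda>x. g x ^ Suc k)" by (intro rp_intros g)
  have eq: "sphere_laplacian (\<lambda>x. g x ^ Suc k) x
     = (real k + 1) * real k * (1 - t\<^sup>2) * g x ^ (k - 1) + real d * (real k + 1) * t * g x ^ k"
    unfolding sphere_laplacian_eq[OF rg] lap E Q xx by (simp add: dim algebra_simps)
  have g0: "g x \<ge> 0" using t gx by simp
  have 1: "(real k + 1) * real k * (1 - t\<^sup>2) * g x ^ (k - 1) \<le> 2 * real k * (real k + 1) * g x ^ k"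
  proof (cases k)
    case (Suc n)
    have "1 - t\<^sup>2 = (1 + t) * g x" by (simp add: gx power2_eq_square algebra_simps)
    also have "\<dots> \<le> 2 * g x" using t g0 by (intro mult_right_mono) auto
    finally have "(1 - t\<^sup>2) * g x ^ n \<le> 2 * g x * g x ^ n" using g0 by (intro mult_right_mono) auto
    then have "(real k + 1) * real k * ((1 - t\<^sup>2) * g x ^ n) \<le> (real k + 1) * real k * (2 * g x * g x ^ n)"
      by (intro mult_left_mono) auto
    moreover have "k - 1 = n" "g x ^ k = g x * g x ^ n" using Suc by simp_all
    ultimately show ?thesis by (simp only: ac_simps)
  qed simp
  have "real d * (real k + 1) * t * g x ^ k \<le> real d * (real k + 1) * 1 * g x ^ k"
    using t g0 by (intro mult_right_mono mult_left_mono) auto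
  with 1 show ?thesis unfolding g_def[symmetric] eq[unfolded g_def] by (simp add: g_def algebra_simps)
qed

lemma heat_moments:
  "\<exists>C\<ge>0. \<forall>t\<ge>0. \<forall>y\<in>sphere 0 1. heat_op t (\<lambda>x. (1 - x \<bullet> y) ^ k) y \<le> C * t ^ k"
proof (induction k)
  case 0
  show ?case by (intro exI[of _ 1]) (simp add: heat_op_const_1)
next
  case (Suc k)
  then obtain C where C: "C \<ge> 0" "\<And>t y. t \<ge> 0 \<Longrightarrow> y \<in> sphere 0 1 \<Longrightarrow> heat_op t (\<lambda>x. (1 - x \<bullet> y) ^ k) y \<le> C * t ^ k"
    by blast
  define c where "c = 2 * real k * (real k + 1) + real d * (real k + 1)"
  have c: "c \<ge> 0" by (simp add: c_def)
  have "heat_op t (\<lambda>x. (1 - x \<bullet> y) ^ Suc k) y \<le> (c * C) * t ^ Suc k" if t: "t \<ge> 0" and y: "y \<in> sphere 0 1" for t y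
  proof -
    let ?g = "\<lambda>n x. (1 - x \<bullet> y) ^ n"
    have rg: "real_polynomial_function (?g n)" for n by (intro rp_intros)
    have yy: "y \<bullet> y = 1" using y by (simp add: dot_square_norm)
    obtain N where N: "poly_space N (?g (Suc k))" using poly_space_poly[OF rg] by blast
    have at0: "heat_op 0 (?g (Suc k)) y = 0" using heat_op_0[OF N y] yy by simp
    show ?thesis
    proof (cases "t = 0")
      case True then show ?thesis using at0 by simp
    next
      case False
      \<comment> \<open>The moment vanishes at time 0, where the integrand is evaluated at y. The
        mean value theorem bounds it by t times its derivative at some z < t, which is at most c C
        z^k <= c C t^k.\<close>
      then have "0 < t" using t by simp
      then obtain z where z: "0 < z" "z < t"
        "heat_op t (?g (Suc k)) y - heat_op 0 (?g (Suc k)) y = (t - 0) * heat_op z (sphere_laplacian (?g (Suc k))) y"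
        using MVT2[of 0 t "\<lambda>t. heat_op t (?g (Suc k)) y" "\<lambda>t. heat_op t (sphere_laplacian (?g (Suc k))) y"]
          heat_op_deriv[OF rg y] by blast
      have "heat_op z (sphere_laplacian (?g (Suc k))) y \<le> heat_op z (\<lambda>x. c * ?g k x + 0 * ?g k x) y"
        using sphere_laplacian_zonal[OF _ y, of _ k] z
        by (intro heat_op_mono[OF rp_sphere_laplacian[OF rg] _ _ _ y]) (auto intro!: rp_intros simp: c_def)
      also have "\<dots> = c * heat_op z (?g k) y" by (simp only: heat_op_lin[OF rg rg])
      also have "\<dots> \<le> c * (C * z ^ k)" using C(2)[OF _ y, of z] z c by (intro mult_left_mono) auto
      also have "\<dots> \<le> c * (C * t ^ k)" using z c C by (intro mult_left_mono power_mono) auto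
      finally have "t * heat_op z (sphere_laplacian (?g (Suc k))) y \<le> t * (c * (C * t ^ k))"
        using t by (intro mult_left_mono) auto
      then show ?thesis using z(3) at0 by (simp add: ac_simps)
    qed
  qed
  then show ?case using c C(1) by (intro exI[of _ "c * C"]) auto
qed

text \<open>In \<open>heat (2 * t) x y\<close>, written as an integral over z, the inequality 1 - x
  . y <= 2 (1 - z . x) + 2 (1 - z . y) puts the power on one of the two factors; that factor is
  integrated as a moment and the other is bounded by its supremum, of order n^d.\<close>

lemma heat_kernel_decay:
  "\<exists>C>0. \<forall>n\<ge>1. \<forall>x\<in>sphere 0 1. \<forall>y\<in>sphere 0 1.
     heat (1 / n\<^sup>2) x y * (1 + (n\<^sup>2 * (1 - x \<bullet> y)) ^ k) \<le> C * n ^ d"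
proof -
  obtain C1 where C1: "C1 > 0" "\<And>t. 0 < t \<Longrightarrow> t \<le> 1 \<Longrightarrow> (\<Sum>l. exp (- t * lam l) * real (Z l)) \<le> C1 / sqrt t ^ d"
    using heat_trace_bound by blast
  obtain C2 where C2: "C2 \<ge> 0" "\<And>t y. t \<ge> 0 \<Longrightarrow> y \<in> sphere 0 1 \<Longrightarrow> heat_op t (\<lambda>x. (1 - x \<bullet> y) ^ k) y \<le> C2 * t ^ k"
    using heat_moments[of k] by blast
  define C where "C = C1 * sqrt 2 ^ d * (1 + 2 * 4 ^ k * C2)"
  have C: "C > 0" unfolding C_def using C1 C2 by (intro mult_pos_pos add_pos_nonneg) auto
  have "heat (1 / n\<^sup>2) x y * (1 + (n\<^sup>2 * (1 - x \<bullet> y)) ^ k) \<le> C * n ^ d"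
    if n: "n \<ge> 1" and x: "x \<in> sphere 0 1" and y: "y \<in> sphere 0 1" for n x y
  proof -
    \<comment> \<open>Half of the time 1/n^2, as the semigroup identity requires; n >= 1 keeps it in
      the range of the trace bound.\<close>
    define t where "t = 1 / (2 * n\<^sup>2)"
    have n2: "n\<^sup>2 \<ge> 1" using n by simp
    have n1: "1 / n\<^sup>2 \<le> 1" by (rule divide_le_eq_1_pos[THEN iffD2, OF _ n2]) (use n in simp)
    have n0: "0 < 1 / n\<^sup>2" using n by simp
    define v where "v = 1 / n\<^sup>2"
    have "t = v / 2" "0 < v" "v \<le> 1" using n n1 by (simp_all add: t_def v_def)
    then have "0 < t" "t \<le> 1" "t \<le> v" by auto
    then have t: "0 < t" "t \<le> 1" "t \<le> 1 / n\<^sup>2" by (simp_all only: v_def)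
    have t2: "1 / n\<^sup>2 = 2 * t" by (simp add: t_def)
    define S where "S = C1 / sqrt t ^ d"
    have S: "S = C1 * sqrt 2 ^ d * n ^ d"
    proof -
      have "sqrt t = 1 / (sqrt 2 * n)" using n by (simp add: t_def real_sqrt_divide real_sqrt_mult)
      then show ?thesis by (simp add: S_def power_divide power_mult_distrib)
    qed
    have S0: "S \<ge> 0" unfolding S using C1 n by simp
    have bd: "heat t z v \<le> S" if "z \<in> sphere 0 1" "v \<in> sphere 0 1" for z v
      using heat_bound[OF t(1,2) that] C1(2)[OF t(1,2)] by (simp add: S_def)
    have h2: "heat (1 / n\<^sup>2) x y \<le> S"
    proof -
      have "heat (1 / n\<^sup>2) x y \<le> (\<Sum>l. exp (- (1 / n\<^sup>2) * lam l) * real (Z l))"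
        by (rule heat_bound[OF n0 n1 x y])
      also have "\<dots> \<le> (\<Sum>l. exp (- t * lam l) * real (Z l))"
      proof (rule suminf_le)
        show "exp (- (1 / n\<^sup>2) * lam l) * real (Z l) \<le> exp (- t * lam l) * real (Z l)" for l
        proof (rule mult_right_mono)
          have "t * lam l \<le> 1 / n\<^sup>2 * lam l" by (rule mult_right_mono[OF t(3) lam_nonneg])
          then show "exp (- (1 / n\<^sup>2) * lam l) \<le> exp (- t * lam l)" by simp
        qed simp
      qed (rule heat_summable[OF n0 n1], rule heat_summable[OF t(1,2)])
      also have "\<dots> \<le> S" unfolding S_def by (rule C1(2)[OF t(1,2)])
      finally show ?thesis .
    qed
    let ?g = "\<lambda>v z. (1 - z \<bullet> v) ^ k"
    have gc: "continuous_on (sphere 0 1) (?g v)" for v by (intro continuous_intros)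
    note hcx = heat_continuous[OF t(1,2) x] and hcy = heat_continuous[OF t(1,2) y]
    have "(1 - x \<bullet> y) ^ k * heat (1 / n\<^sup>2) x y = (LINT z|sphere_measure. (1 - x \<bullet> y) ^ k * (heat t z x * heat t z y))"
      unfolding t2 heat_semigroup[OF t(1,2) x y] by simp
    also have "\<dots> \<le> (LINT z|sphere_measure. 4 ^ k * S * (heat t z x * ?g x z) + 4 ^ k * S * (heat t z y * ?g y z))"
    proof (rule integral_mono)
      fix z :: 'a assume "z \<in> space sphere_measure"
      then have z: "z \<in> sphere 0 1" by simp
      define a where "a = 1 - z \<bullet> x"
      define b where "b = 1 - z \<bullet> y"
      have nn: "x \<bullet> x = 1" "y \<bullet> y = 1" "z \<bullet> z = 1" using x y z by (auto simp: dot_square_norm)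
      have a: "a \<ge> 0" "b \<ge> 0" "1 - x \<bullet> y \<ge> 0"
        using Cauchy_Schwarz_ineq2[of z x] Cauchy_Schwarz_ineq2[of z y] Cauchy_Schwarz_ineq2[of x y] x y z
        by (auto simp: a_def b_def)
      \<comment> \<open>Expanding this square gives the relaxed triangle inequality for half the
        squared chord.\<close>
      have "0 \<le> (x + y - 2 *\<^sub>R z) \<bullet> (x + y - 2 *\<^sub>R z)" by (rule inner_ge_zero)
      then have "1 - x \<bullet> y \<le> 2 * a + 2 * b"
        unfolding a_def b_def using nn by (simp add: inner_simps inner_commute)
      also have "\<dots> \<le> 4 * max a b" by (auto simp: max_def)
      finally have "(1 - x \<bullet> y) ^ k \<le> (4 * max a b) ^ k" using a by (intro power_mono) auto
      also have "\<dots> = 4 ^ k * max a b ^ k" by (simp add: power_mult_distrib)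
      also have "\<dots> \<le> 4 ^ k * (a ^ k + b ^ k)"
        using a by (intro mult_left_mono) (auto simp: max_def)
      finally have d: "(1 - x \<bullet> y) ^ k \<le> 4 ^ k * (a ^ k + b ^ k)" .
      have h0: "heat t z x \<ge> 0" "heat t z y \<ge> 0" using heat_nonneg[OF t(1,2) z] x y by auto
      have "(1 - x \<bullet> y) ^ k * (heat t z x * heat t z y) \<le> 4 ^ k * (a ^ k + b ^ k) * (heat t z x * heat t z y)"
        using d h0 by (intro mult_right_mono) auto
      also have "\<dots> = 4 ^ k * (heat t z x * a ^ k) * heat t z y + 4 ^ k * (heat t z y * b ^ k) * heat t z x"
        by (simp add: algebra_simps)
      also have "\<dots> \<le> 4 ^ k * (heat t z x * a ^ k) * S + 4 ^ k * (heat t z y * b ^ k) * S"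
        using h0 a bd[OF z x] bd[OF z y] by (intro add_mono mult_left_mono) auto
      finally show "(1 - x \<bullet> y) ^ k * (heat t z x * heat t z y) \<le> 4 ^ k * S * (heat t z x * ?g x z) + 4 ^ k * S * (heat t z y * ?g y z)"
        by (simp add: a_def b_def ac_simps)
    qed (intro integrable_sphere_continuous continuous_intros hcx hcy)+
    also have "\<dots> = 4 ^ k * S * heat_op t (?g x) x + 4 ^ k * S * heat_op t (?g y) y"
      unfolding integral_heat_op[OF t(1,2) x gc, symmetric] integral_heat_op[OF t(1,2) y gc, symmetric]
      by (subst Bochner_Integration.integral_add)
         (auto intro!: integrable_mult_right integrable_sphere_continuous continuous_on_mult hcx hcy gc)
    also have "\<dots> \<le> 4 ^ k * S * (C2 * t ^ k) + 4 ^ k * S * (C2 * t ^ k)"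
      using C2(2) t x y S0 by (intro add_mono mult_left_mono) auto
    finally have m: "(1 - x \<bullet> y) ^ k * heat (1 / n\<^sup>2) x y \<le> 2 * 4 ^ k * C2 * S * t ^ k" by (simp add: ac_simps)
    have "(n\<^sup>2) ^ k * ((1 - x \<bullet> y) ^ k * heat (1 / n\<^sup>2) x y) \<le> (n\<^sup>2) ^ k * (2 * 4 ^ k * C2 * S * t ^ k)"
      by (rule mult_left_mono[OF m]) simp
    also have "\<dots> = 2 * 4 ^ k * C2 * S * (n\<^sup>2 * t) ^ k" by (simp add: power_mult_distrib ac_simps)
    also have "\<dots> \<le> 2 * 4 ^ k * C2 * S * 1"
    proof (rule mult_left_mono)
      have "n\<^sup>2 * t = 1 / 2" using n by (simp add: t_def)
      then show "(n\<^sup>2 * t) ^ k \<le> 1" by (simp add: power_le_one)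
    qed (use C2 S0 in simp)
    finally have mm: "(n\<^sup>2) ^ k * ((1 - x \<bullet> y) ^ k * heat (1 / n\<^sup>2) x y) \<le> 2 * 4 ^ k * C2 * S * 1" .
    have "heat (1 / n\<^sup>2) x y * (1 + (n\<^sup>2 * (1 - x \<bullet> y)) ^ k)
      = heat (1 / n\<^sup>2) x y + (n\<^sup>2) ^ k * ((1 - x \<bullet> y) ^ k * heat (1 / n\<^sup>2) x y)"
      unfolding power_mult_distrib by (simp only: distrib_left mult_1_right ac_simps)
    also have "\<dots> \<le> S + 2 * 4 ^ k * C2 * S * 1" by (rule add_mono[OF h2 mm])
    also have "\<dots> = C * n ^ d" unfolding S C_def by (simp add: algebra_simps)
    finally show ?thesis .
  qed
  then show ?thesis using C by blast
qed

end

section \<open>Quasi-uniform sampling\<close>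

text \<open>Taylor gives sin u >= u - u^3/6, and u^2 <= 4 on this interval. The range covers half of
  any angle in [0, \<pi>].\<close>

lemma sin_ge_third:
  fixes u :: real
  assumes u: "0 \<le> u" "u \<le> 2" shows "u / 3 \<le> sin u"
proof -
  obtain t where t: "sin u = (\<Sum>m<3. sin_coeff m * u ^ m) + (sin (t + 1/2 * real 3 * pi) / fact 3) * u ^ 3"
    using Maclaurin_sin_expansion[of u 3] by blast
  have "(\<Sum>m<3. sin_coeff m * u ^ m) = u"
    by (simp add: numeral_3_eq_3 sin_coeff_def)
  moreover have "(- 1) / 6 * u ^ 3 \<le> (sin (t + 1/2 * real 3 * pi) / fact 3) * u ^ 3"
    using u sin_ge_minus_one[of "t + 1/2 * real 3 * pi"] by (intro mult_right_mono) (auto simp: fact_numeral)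
  ultimately have "u - u ^ 3 / 6 \<le> sin u" using t by simp
  moreover have "u ^ 3 \<le> 4 * u"
  proof -
    have "u\<^sup>2 \<le> 2\<^sup>2" using u by (intro power_mono) auto
    then have "u\<^sup>2 * u \<le> 4 * u" using u by (intro mult_right_mono) auto
    then show ?thesis by (simp add: power3_eq_cube power2_eq_square)
  qed
  ultimately show ?thesis by linarith
qed

lemma inner_sphere_bound:
  assumes "x \<in> sphere 0 1" "y \<in> sphere (0::'a::euclidean_space) 1"
  shows "\<bar>x \<bullet> y\<bar> \<le> 1"
  using Cauchy_Schwarz_ineq2[of x y] assms by simp

lemma chord_square:
  assumes "x \<in> sphere 0 1" "y \<in> sphere (0::'a::euclidean_space) 1"
  shows "(norm (x - y))\<^sup>2 = 2 * (1 - x \<bullet> y)"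
proof -
  have "x \<bullet> x = 1" "y \<bullet> y = 1" using assms by (simp_all add: dot_square_norm)
  then show ?thesis
    by (simp only: power2_norm_eq_inner inner_diff_left inner_diff_right inner_commute[of y x]) simp
qed

lemma geodesic_dist_bounds:
  assumes "x \<in> sphere 0 1" "y \<in> sphere (0::'a::euclidean_space) 1"
  shows "0 \<le> geodesic_dist x y" "geodesic_dist x y \<le> pi"
  using inner_sphere_bound[OF assms] unfolding geodesic_dist_def by (auto intro: arccos_lbound arccos_ubound)

text \<open>An angle \<theta> has chord 2 sin (\<theta>/2). Separation is measured geodesically
  while the caps are Euclidean, and this inequality passes from one to the other.\<close>

lemma geodesic_le_chord:
  assumes x: "x \<in> sphere 0 1" and y: "y \<in> sphere (0::'a::euclidean_space) 1"
  shows "geodesic_dist x y \<le> 3 * norm (x - y)"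
proof -
  define \<theta> where "\<theta> = geodesic_dist x y"
  have \<theta>: "0 \<le> \<theta>" "\<theta> \<le> pi" using geodesic_dist_bounds[OF x y] by (simp_all add: \<theta>_def)
  have c: "cos \<theta> = x \<bullet> y" using inner_sphere_bound[OF x y] by (simp add: \<theta>_def geodesic_dist_def cos_arccos_abs)
  have s: "\<theta> / 2 / 3 \<le> sin (\<theta> / 2)" using \<theta> pi_less_4 by (intro sin_ge_third) auto
  have "(norm (x - y))\<^sup>2 = 2 * (1 - cos \<theta>)" by (simp add: chord_square[OF x y] c)
  also have "\<dots> = (2 * sin (\<theta> / 2))\<^sup>2"
    using cos_double_sin[of "\<theta> / 2"] by (simp add: power_mult_distrib)
  finally have "norm (x - y) = 2 * sin (\<theta> / 2)"
    using s \<theta> by (subst (asm) power2_eq_iff_nonneg) auto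
  then show ?thesis using s by (simp add: \<theta>_def)
qed

lemma mesh_norm_bounds:
  assumes "m > 0" "\<And>j. j \<in> {1..m} \<Longrightarrow> x j \<in> sphere (0::'a::euclidean_space) 1"
  shows "0 \<le> mesh_norm m x" "mesh_norm m x \<le> pi"
proof -
  let ?f = "\<lambda>y. Min ((\<lambda>j. geodesic_dist y (x j)) ` {1..m})"
  have 1: "1 \<in> {1..m}" using assms(1) by simp
  have f: "0 \<le> ?f y" "?f y \<le> pi" if y: "y \<in> sphere 0 1" for y
  proof -
    show "0 \<le> ?f y" using assms(1) geodesic_dist_bounds(1)[OF y assms(2)] by (intro Min.boundedI) auto
    have "?f y \<le> geodesic_dist y (x 1)" using 1 by (intro Min_le) auto
    also have "\<dots> \<le> pi" by (rule geodesic_dist_bounds(2)[OF y assms(2)[OF 1]])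
    finally show "?f y \<le> pi" .
  qed
  have "?f (x 1) \<le> mesh_norm m x"
    unfolding mesh_norm_def using f(2) assms(2)[OF 1] by (intro cSUP_upper bdd_aboveI2[where M=pi])
  then show "0 \<le> mesh_norm m x" using f(1)[OF assms(2)[OF 1]] by linarith
  show "mesh_norm m x \<le> pi"
    unfolding mesh_norm_def using assms(2)[OF 1] f(2) by (intro cSUP_least) auto
qed

lemma separation_radius_le:
  assumes "i \<in> {1..m}" "j \<in> {1..m}" "i \<noteq> j"
  shows "2 * separation_radius m x \<le> geodesic_dist (x i) (x j)"
proof -
  let ?S = "{geodesic_dist (x i) (x j) | i j. i \<in> {1..m} \<and> j \<in> {1..m} \<and> i \<noteq> j}"
  have "?S \<subseteq> (\<lambda>(i, j). geodesic_dist (x i) (x j)) ` ({1..m} \<times> {1..m})" by auto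
  then have "finite ?S" by (rule finite_subset) simp
  then have "Min ?S \<le> geodesic_dist (x i) (x j)" using assms by (intro Min_le) auto
  then show ?thesis by (simp add: separation_radius_def)
qed

text \<open>The excess max 0 (|f| - L) over the essential supremum L is continuous, nonnegative and
  zero almost everywhere, hence zero on the whole sphere.\<close>

lemma Linf_norm_real:
  assumes f: "continuous_on (sphere (0::'a::euclidean_space) 1) f"
  obtains L where "Linf_norm f = ereal L" "\<And>x. x \<in> sphere 0 1 \<Longrightarrow> \<bar>f x\<bar> \<le> L"
proof -
  interpret prob_space "sphere_measure :: 'a measure" by (rule prob_space_sphere_measure)
  have meas: "(\<lambda>x. ereal \<bar>f x\<bar>) \<in> borel_measurable sphere_measure"
    using f by (intro borel_measurable_ereal borel_measurable_sphere_continuous continuous_intros)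
  obtain B where B: "B > 0" "\<And>x. x \<in> sphere 0 1 \<Longrightarrow> \<bar>f x\<bar> \<le> B"
    using bounded_sphere_continuous[OF f] by blast
  have "Linf_norm f \<le> ereal B"
    unfolding Linf_norm_def using B meas by (intro esssup_I AE_I2) auto
  moreover have "(0::ereal) \<le> Linf_norm f"
  proof -
    have "esssup sphere_measure (\<lambda>x::'a. 0::ereal) \<le> Linf_norm f"
      unfolding Linf_norm_def by (rule esssup_mono) auto
    moreover have "esssup sphere_measure (\<lambda>x::'a. 0::ereal) = 0"
      by (rule esssup_const) (simp add: emeasure_space_1 del: space_sphere_measure)
    ultimately show ?thesis by simp
  qed
  ultimately obtain L where L: "Linf_norm f = ereal L"
    by (cases "Linf_norm f") auto
  have "\<bar>f x\<bar> \<le> L" if x: "x \<in> sphere 0 1" for x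
  proof -
    define g where "g = (\<lambda>x. max 0 (\<bar>f x\<bar> - L))"
    have g: "continuous_on (sphere 0 1) g" unfolding g_def by (intro continuous_intros f)
    have "AE x in sphere_measure. ereal \<bar>f x\<bar> \<le> ereal L"
      using esssup_AE[of "\<lambda>x. ereal \<bar>f x\<bar>" sphere_measure] unfolding L[symmetric] Linf_norm_def .
    then have "AE x in sphere_measure. g x = 0" by eventually_elim (simp add: g_def)
    then have "(LINT x|sphere_measure. g x) = 0" by (rule integral_eq_zero_AE)
    then have "g x = 0" using g x by (intro continuous_nonneg_integral_0) (auto simp: g_def)
    then show ?thesis by (simp add: g_def)
  qed
  with L show ?thesis by (rule that)
qed

text \<open>The numerator is the volume growth of the i-th shell. The power d + 1 of a squared
  distance grows with exponent 2 d + 2, which leaves two powers to spare for the summation; the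
  constant comes from (i + 1)^2 <= 8 max 1 (i^2/2).\<close>

lemma shell_weight_bound:
  "(real i + 1) ^ d / (1 + ((real i)\<^sup>2 / 2) ^ (d + 1)) \<le> 8 ^ (d + 1) / (1 + real i)\<^sup>2"
proof -
  let ?a = "(real i)\<^sup>2 / 2"
  have pos: "0 < 1 + ?a ^ (d + 1)" by (intro add_pos_nonneg) auto
  have "(real i + 1) ^ d * (1 + real i)\<^sup>2 = (real i + 1) ^ (d + 2)" by (simp add: power_add power2_eq_square add.commute)
  also have "\<dots> \<le> (real i + 1) ^ (2 * (d + 1))" by (intro power_increasing) auto
  also have "\<dots> = ((real i + 1)\<^sup>2) ^ (d + 1)" by (simp only: power_mult)
  also have "\<dots> \<le> (8 * max 1 ?a) ^ (d + 1)"
  proof (rule power_mono)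
    show "(real i + 1)\<^sup>2 \<le> 8 * max 1 ?a"
      using zero_le_power2[of "real i - 1"] by (simp add: power2_eq_square algebra_simps max_def)
  qed simp
  also have "\<dots> = 8 ^ (d + 1) * max 1 ?a ^ (d + 1)" by (rule power_mult_distrib)
  also have "\<dots> \<le> 8 ^ (d + 1) * (1 + ?a ^ (d + 1))"
    by (intro mult_left_mono) (auto simp: max_def)
  finally have "(real i + 1) ^ d * (1 + real i)\<^sup>2 \<le> 8 ^ (d + 1) * (1 + ?a ^ (d + 1))" .
  moreover have "a / b \<le> c / e" if "a * e \<le> c * b" "b > 0" "e > 0" for a b c e :: real
    using that by (simp add: field_simps)
  ultimately show ?thesis using pos by simp
qed

text \<open>At distances between i/n and (i+1)/n from y the integrand is bounded by its value at the
  inner radius, and the shell is enlarged to the full cap of radius (i+1)/n.\<close>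

lemma integral_decay_bound:
  assumes dim: "DIM('a::euclidean_space) = d + 1"
  shows "\<exists>K>0. \<forall>n>0. \<forall>y\<in>sphere (0::'a) 1.
    (LINT z|sphere_measure. 1 / (1 + (n\<^sup>2 * (1 - z \<bullet> y)) ^ (d + 1))) \<le> K / n ^ d"
proof -
  obtain K where K: "K > 0" "\<And>y R. y \<in> sphere (0::'a) 1 \<Longrightarrow> R > 0 \<Longrightarrow>
     measure sphere_measure (sphere 0 1 \<inter> cball y R) \<le> K * R ^ d"
    using sphere_cap_measure_upper[where 'a='a] dim by auto
  interpret prob_space "sphere_measure :: 'a measure" by (rule prob_space_sphere_measure)
  have "(LINT z|sphere_measure. 1 / (1 + (n\<^sup>2 * (1 - z \<bullet> y)) ^ (d + 1))) \<le> 2 * 8 ^ (d + 1) * K / n ^ d"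
    if n: "n > 0" and y: "y \<in> sphere (0::'a) 1" for n y
  proof -
    \<comment> \<open>Chords have length at most 2, so the shells up to index 2 n exhaust the
      sphere.\<close>
    define I where "I = nat \<lceil>2 * n\<rceil>"
    define C where "C = (\<lambda>i::nat. sphere 0 1 \<inter> cball y ((real i + 1) / n))"
    define a where "a = (\<lambda>i::nat. 1 / (1 + ((real i)\<^sup>2 / 2) ^ (d + 1)))"
    have a0: "a i \<ge> 0" for i unfolding a_def by (intro divide_nonneg_nonneg add_nonneg_nonneg) auto
    have C: "C i \<in> sets sphere_measure" for i by (auto simp: sets_sphere_measure_iff C_def)
    have iC: "integrable sphere_measure (\<lambda>z. a i * indicator (C i) z)" for i
      using C by (auto intro!: integrable_mult_right integrable_real_indicator simp: less_top[symmetric])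
    have den: "1 + (n\<^sup>2 * (1 - z \<bullet> y)) ^ (d + 1) > 0" if "z \<in> sphere 0 1" for z
      using inner_sphere_bound[OF that y] by (intro add_pos_nonneg) auto
    have "(LINT z|sphere_measure. 1 / (1 + (n\<^sup>2 * (1 - z \<bullet> y)) ^ (d + 1)))
      \<le> (LINT z|sphere_measure. (\<Sum>i\<le>I. a i * indicator (C i) z))"
    proof (rule integral_mono)
      show "integrable sphere_measure (\<lambda>z. 1 / (1 + (n\<^sup>2 * (1 - z \<bullet> y)) ^ (d + 1)))"
        using den by (intro integrable_sphere_continuous continuous_intros) (auto simp: less_imp_neq[symmetric])
      fix z :: 'a assume "z \<in> space sphere_measure"
      then have z: "z \<in> sphere 0 1" by simp
      define k where "k = nat \<lfloor>n * norm (z - y)\<rfloor>"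
      have nn: "n * norm (z - y) \<ge> 0" using n by simp
      have k: "real k \<le> n * norm (z - y)" "n * norm (z - y) < real k + 1"
        using nn by (simp_all add: k_def)
      have "norm (z - y) \<le> 2" using norm_triangle_ineq4[of z y] z y by simp
      then have "n * norm (z - y) \<le> 2 * n" using n by simp
      then have kI: "k \<le> I" using k(1) unfolding I_def by linarith
      have "norm (z - y) \<le> (real k + 1) / n" using k(2) n by (simp add: field_simps)
      then have zC: "z \<in> C k" using z by (simp add: C_def dist_norm norm_minus_commute)
      have "(real k)\<^sup>2 / 2 \<le> n\<^sup>2 * (1 - z \<bullet> y)"
      proof -
        have "(real k)\<^sup>2 \<le> (n * norm (z - y))\<^sup>2" using k(1) by (intro power_mono) auto
        then show ?thesis unfolding power_mult_distrib chord_square[OF z y] by (simp add: algebra_simps)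
      qed
      then have "((real k)\<^sup>2 / 2) ^ (d + 1) \<le> (n\<^sup>2 * (1 - z \<bullet> y)) ^ (d + 1)" by (intro power_mono) auto
      then have "1 / (1 + (n\<^sup>2 * (1 - z \<bullet> y)) ^ (d + 1)) \<le> a k"
        unfolding a_def by (intro frac_le add_left_mono add_pos_nonneg zero_le_power zero_le_divide_iff[THEN iffD2]) auto
      also have "\<dots> = a k * indicator (C k) z" using zC by simp
      also have "\<dots> \<le> (\<Sum>i\<le>I. a i * indicator (C i) z)"
        using kI a0 by (intro member_le_sum) auto
      finally show "1 / (1 + (n\<^sup>2 * (1 - z \<bullet> y)) ^ (d + 1)) \<le> (\<Sum>i\<le>I. a i * indicator (C i) z)" .
    qed (intro Bochner_Integration.integrable_sum iC)
    also have "\<dots> = (\<Sum>i\<le>I. a i * measure sphere_measure (C i))"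
      using C iC by (subst Bochner_Integration.integral_sum) (auto simp: C_def Int_ac)
    also have "\<dots> \<le> (\<Sum>i\<le>I. 8 ^ (d + 1) * K / n ^ d * (1 / (1 + 1 * real i)\<^sup>2))"
    proof (rule sum_mono)
      fix i
      have "a i * measure sphere_measure (C i) \<le> a i * (K * ((real i + 1) / n) ^ d)"
        unfolding C_def using n y by (intro mult_left_mono K a0) auto
      also have "\<dots> = K / n ^ d * ((real i + 1) ^ d / (1 + ((real i)\<^sup>2 / 2) ^ (d + 1)))"
        by (simp add: a_def power_divide del: power_Suc)
      also have "\<dots> \<le> K / n ^ d * (8 ^ (d + 1) / (1 + real i)\<^sup>2)"
        using K n by (intro mult_left_mono shell_weight_bound) auto
      finally show "a i * measure sphere_measure (C i) \<le> 8 ^ (d + 1) * K / n ^ d * (1 / (1 + 1 * real i)\<^sup>2)"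
        by (simp add: ac_simps)
    qed
    also have "\<dots> = 8 ^ (d + 1) * K / n ^ d * (\<Sum>i\<le>I. 1 / (1 + 1 * real i)\<^sup>2)" by (simp only: sum_distrib_left)
    also have "\<dots> \<le> 8 ^ (d + 1) * K / n ^ d * (1 + 1 / 1)"
      using K n by (intro mult_left_mono sum_inverse_square_le) auto
    finally show ?thesis by (simp add: ac_simps)
  qed
  moreover have "2 * 8 ^ (d + 1) * K > 0" using K by simp
  ultimately show ?thesis by blast
qed

context harmonic_basis
begin

lemma weighted_kernel_sum_bound:
  assumes C0: "C0 \<ge> 1" and C2: "C2 > 0" and C3: "C3 > 0"
  shows "\<exists>C>0. \<forall>m x w n \<delta> y. n \<ge> 1 \<longrightarrow> 0 < \<delta> \<longrightarrow> \<delta> \<le> pi \<longrightarrow> n * \<delta> \<le> C3 \<longrightarrow>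
     (\<forall>j\<in>{1..m}. x j \<in> sphere (0::'a) 1) \<longrightarrow> (\<forall>j\<in>{1..m}. 0 < w j \<and> w j \<le> C2 * \<delta> ^ d) \<longrightarrow>
     (\<forall>i\<in>{1..m}. \<forall>j\<in>{1..m}. i \<noteq> j \<longrightarrow> 2 * \<delta> / (3 * C0) \<le> norm (x i - x j)) \<longrightarrow> y \<in> sphere 0 1 \<longrightarrow>
     (\<Sum>j=1..(m::nat). w j * heat (1 / n\<^sup>2) y (x j)) \<le> C"
proof -
  obtain A where A: "A > 0" "\<And>n x y. n \<ge> 1 \<Longrightarrow> x \<in> sphere 0 1 \<Longrightarrow> y \<in> sphere 0 1 \<Longrightarrow>
     heat (1 / n\<^sup>2) x y * (1 + (n\<^sup>2 * (1 - x \<bullet> y)) ^ (d + 1)) \<le> A * n ^ d"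
    using heat_kernel_decay[of "d + 1"] by blast
  obtain K where K: "K > 0" "\<And>n y. n > 0 \<Longrightarrow> y \<in> sphere (0::'a) 1 \<Longrightarrow>
     (LINT z|sphere_measure. 1 / (1 + (n\<^sup>2 * (1 - z \<bullet> y)) ^ (d + 1))) \<le> K / n ^ d"
    using integral_decay_bound[OF dim] by blast
  obtain c where c: "c > 0" "\<And>y R. y \<in> sphere (0::'a) 1 \<Longrightarrow> 0 < R \<Longrightarrow> R \<le> 1 \<Longrightarrow>
     c * R ^ d \<le> measure sphere_measure (sphere 0 1 \<inter> cball y R)"
    using sphere_cap_measure_lower[where 'a='a] dim by auto
  \<comment> \<open>Comparison constant for the decay profile over a cap: if b <= C3^2 + 2 a for the
    scaled quantities b at z and a at the centre, then b^(d+1) is at most 2^(d+1) (C3^2)^(d+1) +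
    4^(d+1) a^(d+1).\<close>
  define Q where "Q = 1 + 4 ^ (d + 1) + 2 ^ (d + 1) * (C3\<^sup>2) ^ (d + 1)"
  have Q: "Q \<ge> 1" "4 ^ (d + 1) \<le> Q" "1 + 2 ^ (d + 1) * (C3\<^sup>2) ^ (d + 1) \<le> Q" unfolding Q_def by auto
  define C where "C = C2 * A * Q * K * (4 * C0) ^ d / c"
  have C: "C > 0" unfolding C_def using C2 A K c C0 Q by (intro divide_pos_pos mult_pos_pos) auto
  interpret prob_space "sphere_measure :: 'a measure" by (rule prob_space_sphere_measure)
  have main: "(\<Sum>j=1..m. w j * heat (1 / n\<^sup>2) y (x j)) \<le> C"
    if n: "n \<ge> 1" and \<delta>: "0 < \<delta>" "\<delta> \<le> pi" "n * \<delta> \<le> C3"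
      and x: "\<And>j. j \<in> {1..m} \<Longrightarrow> x j \<in> sphere 0 1" and w: "\<And>j. j \<in> {1..m} \<Longrightarrow> 0 < w j \<and> w j \<le> C2 * \<delta> ^ d"
      and sep: "\<And>i j. i \<in> {1..m} \<Longrightarrow> j \<in> {1..m} \<Longrightarrow> i \<noteq> j \<Longrightarrow> 2 * \<delta> / (3 * C0) \<le> norm (x i - x j)"
      and y: "y \<in> sphere 0 1"
    for m :: nat and x w n \<delta> y
  proof -
    \<comment> \<open>Twice this radius is 2 \<delta>/(4 C0), strictly below the separation 2
      \<delta>/(3 C0), so the caps are disjoint. Moreover \<delta> <= \<pi> < 4 and C0 >= 1 give
      \<rho> <= 1, the range of the lower cap estimate.\<close>
    define \<rho> where "\<rho> = \<delta> / (4 * C0)"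
    have \<rho>: "0 < \<rho>" "\<rho> \<le> \<delta>" using C0 \<delta> by (auto simp: \<rho>_def divide_le_eq)
    have \<delta>\<rho>: "\<delta> = \<rho> * (4 * C0)" using C0 by (simp add: \<rho>_def)
    have \<rho>1: "\<rho> \<le> 1"
    proof -
      have "\<delta> \<le> 4 * C0" using \<delta> pi_less_4 C0 by linarith
      then show ?thesis using C0 by (simp add: \<rho>_def divide_le_eq)
    qed
    have \<rho>2: "2 * \<rho> < 2 * \<delta> / (3 * C0)" using C0 \<delta> by (simp add: \<rho>_def field_simps)
    define \<phi> where "\<phi> = (\<lambda>z. 1 / (1 + (n\<^sup>2 * (1 - z \<bullet> y)) ^ (d + 1)))"
    have den: "1 + (n\<^sup>2 * (1 - z \<bullet> y)) ^ (d + 1) > 0" if "z \<in> sphere 0 1" for z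
      using inner_sphere_bound[OF that y] by (intro add_pos_nonneg) auto
    have \<phi>c: "continuous_on (sphere 0 1) \<phi>"
      unfolding \<phi>_def using den by (intro continuous_intros) (auto simp: less_imp_neq[symmetric])
    have \<phi>0: "\<phi> z \<ge> 0" if "z \<in> sphere 0 1" for z using den[OF that] by (simp add: \<phi>_def)
    define B where "B = (\<lambda>j. sphere 0 1 \<inter> cball (x j) \<rho>)"
    have B: "B j \<in> sets sphere_measure" for j by (auto simp: sets_sphere_measure_iff B_def)
    have iB: "integrable sphere_measure (\<lambda>z. \<phi> z * indicator (B j) z)" for j
      using B by (intro integrable_real_mult_indicator integrable_sphere_continuous \<phi>c)
    have cap: "\<phi> (x j) * measure sphere_measure (B j) \<le> Q * (LINT z|sphere_measure. \<phi> z * indicator (B j) z)"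
      if j: "j \<in> {1..m}" for j
    proof -
      have "\<phi> (x j) * measure sphere_measure (B j) = (LINT z|sphere_measure. \<phi> (x j) * indicator (B j) z)"
        using B by (simp add: B_def Int_ac)
      also have "\<dots> \<le> (LINT z|sphere_measure. Q * (\<phi> z * indicator (B j) z))"
      proof (rule integral_mono)
        show "integrable sphere_measure (\<lambda>z. \<phi> (x j) * indicator (B j) z)"
          using B by (auto intro!: integrable_mult_right integrable_real_indicator simp: less_top[symmetric])
        show "integrable sphere_measure (\<lambda>z. Q * (\<phi> z * indicator (B j) z))" by (rule integrable_mult_right[OF iB])
        fix z :: 'a assume "z \<in> space sphere_measure"
        then have z: "z \<in> sphere 0 1" by simp
        have "\<phi> (x j) \<le> Q * \<phi> z" if zB: "z \<in> B j"
        proof -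
          define a where "a = n\<^sup>2 * (1 - x j \<bullet> y)"
          define b where "b = n\<^sup>2 * (1 - z \<bullet> y)"
          have a0: "a \<ge> 0" "b \<ge> 0" using inner_sphere_bound[OF x[OF j] y] inner_sphere_bound[OF z y] by (auto simp: a_def b_def)
          have "norm (z - x j) \<le> \<rho>" using zB by (simp add: B_def dist_norm norm_minus_commute)
          moreover have "norm (z - y) \<le> norm (z - x j) + norm (x j - y)"
            using norm_triangle_ineq[of "z - x j" "x j - y"] by simp
          ultimately have "(norm (z - y))\<^sup>2 \<le> (\<rho> + norm (x j - y))\<^sup>2" by (intro power_mono) auto
          also have "\<dots> \<le> 2 * \<rho>\<^sup>2 + 2 * (norm (x j - y))\<^sup>2"
            using zero_le_power2[of "\<rho> - norm (x j - y)"] by (simp add: power2_eq_square algebra_simps)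
          finally have "1 - z \<bullet> y \<le> \<rho>\<^sup>2 + 2 * (1 - x j \<bullet> y)"
            unfolding chord_square[OF z y] chord_square[OF x[OF j] y] by simp
          then have "b \<le> n\<^sup>2 * (\<rho>\<^sup>2 + 2 * (1 - x j \<bullet> y))" unfolding b_def by (intro mult_left_mono) auto
          also have "\<dots> = (n * \<rho>)\<^sup>2 + 2 * a" by (simp add: a_def power_mult_distrib algebra_simps)
          also have "\<dots> \<le> C3\<^sup>2 + 2 * a"
          proof -
            \<comment> \<open>The restriction of n by C3/\<delta> enters here: across a cap the
              scaled distance to y changes by a bounded amount.\<close>
            have "n * \<rho> \<le> n * \<delta>" using \<rho> n by (intro mult_left_mono) auto
            then have "n * \<rho> \<le> C3" using \<delta> by linarith
            then have "(n * \<rho>)\<^sup>2 \<le> C3\<^sup>2" using n \<rho> by (intro power_mono) auto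
            then show ?thesis by simp
          qed
          also have "\<dots> \<le> 2 * max (C3\<^sup>2) (2 * a)" by (auto simp: max_def)
          finally have "b ^ (d + 1) \<le> (2 * max (C3\<^sup>2) (2 * a)) ^ (d + 1)" using a0 by (intro power_mono) auto
          also have "\<dots> = 2 ^ (d + 1) * max (C3\<^sup>2) (2 * a) ^ (d + 1)" by (rule power_mult_distrib)
          also have "\<dots> \<le> 2 ^ (d + 1) * ((C3\<^sup>2) ^ (d + 1) + (2 * a) ^ (d + 1))"
            using a0 by (intro mult_left_mono) (auto simp: max_def)
          also have "\<dots> = 2 ^ (d + 1) * (C3\<^sup>2) ^ (d + 1) + 4 ^ (d + 1) * a ^ (d + 1)"
            unfolding distrib_left power_mult_distrib[of 2 a] mult.assoc[symmetric] power_mult_distrib[of 2 2, symmetric] by simp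
          finally have "1 + b ^ (d + 1) \<le> (1 + 2 ^ (d + 1) * (C3\<^sup>2) ^ (d + 1)) * 1 + 4 ^ (d + 1) * a ^ (d + 1)" by simp
          also have "\<dots> \<le> Q * 1 + Q * a ^ (d + 1)"
            using Q a0 by (intro add_mono mult_right_mono) auto
          finally have *: "1 + b ^ (d + 1) \<le> Q * (1 + a ^ (d + 1))" by (simp add: distrib_left)
          have p: "1 + b ^ (d + 1) > 0" "1 + a ^ (d + 1) > 0" using a0 by (intro add_pos_nonneg; simp)+
          have "1 / (1 + a ^ (d + 1)) \<le> Q * (1 / (1 + b ^ (d + 1)))"
            using * p by (simp add: divide_simps mult.commute del: power_Suc)
          then show ?thesis by (simp only: \<phi>_def a_def b_def)
        qed
        then show "\<phi> (x j) * indicator (B j) z \<le> Q * (\<phi> z * indicator (B j) z)"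
          by (simp add: indicator_def)
      qed
      finally show ?thesis by simp
    qed
    have summand: "w j * heat (1 / n\<^sup>2) y (x j) \<le> C2 * A * n ^ d * Q * (4 * C0) ^ d / c * (LINT z|sphere_measure. \<phi> z * indicator (B j) z)"
      if j: "j \<in> {1..m}" for j
    proof -
      define J where "J = (LINT z|sphere_measure. \<phi> z * indicator (B j) z)"
      have J0: "\<phi> (x j) \<ge> 0" by (rule \<phi>0[OF x[OF j]])
      have "heat (1 / n\<^sup>2) y (x j) \<le> A * n ^ d * \<phi> (x j)"
      proof -
        have "heat (1 / n\<^sup>2) y (x j) * (1 + (n\<^sup>2 * (1 - x j \<bullet> y)) ^ (d + 1)) \<le> A * n ^ d"
          using A(2)[OF n y x[OF j]] by (simp only: inner_commute)
        then show ?thesis unfolding \<phi>_def using den[OF x[OF j]] by (simp add: pos_le_divide_eq del: power_Suc)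
      qed
      then have "w j * heat (1 / n\<^sup>2) y (x j) \<le> w j * (A * n ^ d * \<phi> (x j))"
        using w[OF j] by (intro mult_left_mono) auto
      also have "\<dots> \<le> C2 * \<delta> ^ d * (A * n ^ d * \<phi> (x j))"
        using w[OF j] A n J0 by (intro mult_right_mono mult_nonneg_nonneg) auto
      \<comment> \<open>The bound on the weights is converted into volume: \<delta>^d is a multiple
        of \<rho>^d, and c \<rho>^d is at most the measure of the cap.\<close>
      also have "\<delta> ^ d = \<rho> ^ d * (4 * C0) ^ d"
        by (subst \<delta>\<rho>) (rule power_mult_distrib)
      also have "C2 * (\<rho> ^ d * (4 * C0) ^ d) * (A * n ^ d * \<phi> (x j)) = C2 * A * n ^ d * (4 * C0) ^ d / c * (\<phi> (x j) * (c * \<rho> ^ d))"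
      proof -
        have cancel: "u / c * (v * (c * t)) = u * (v * t)" for u v t using c by simp
        show ?thesis by (subst cancel) (simp only: ac_simps)
      qed
      also have "\<dots> \<le> C2 * A * n ^ d * (4 * C0) ^ d / c * (\<phi> (x j) * measure sphere_measure (B j))"
        unfolding B_def using C2 A n C0 c J0 x[OF j] \<rho> \<rho>1
        by (intro mult_left_mono c(2) divide_nonneg_nonneg mult_nonneg_nonneg) auto
      also have "\<dots> \<le> C2 * A * n ^ d * (4 * C0) ^ d / c * (Q * J)"
        unfolding J_def using C2 A n C0 c by (intro mult_left_mono cap[OF j] divide_nonneg_nonneg mult_nonneg_nonneg) auto
      finally show ?thesis by (simp add: J_def ac_simps)
    qed
    have "(\<Sum>j=1..m. w j * heat (1 / n\<^sup>2) y (x j))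
       \<le> (\<Sum>j=1..m. C2 * A * n ^ d * Q * (4 * C0) ^ d / c * (LINT z|sphere_measure. \<phi> z * indicator (B j) z))"
      by (rule sum_mono[OF summand])
    also have "\<dots> = C2 * A * n ^ d * Q * (4 * C0) ^ d / c * (LINT z|sphere_measure. (\<Sum>j=1..m. \<phi> z * indicator (B j) z))"
      by (subst Bochner_Integration.integral_sum[OF iB]) (simp only: sum_distrib_left)
    also have "\<dots> \<le> C2 * A * n ^ d * Q * (4 * C0) ^ d / c * (K / n ^ d)"
    proof (rule mult_left_mono)
      have "(LINT z|sphere_measure. (\<Sum>j=1..m. \<phi> z * indicator (B j) z)) \<le> (LINT z|sphere_measure. \<phi> z)"
      proof (rule integral_mono)
        fix z :: 'a assume "z \<in> space sphere_measure"
        then have z: "z \<in> sphere 0 1" by simp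
        show "(\<Sum>j=1..m. \<phi> z * indicator (B j) z) \<le> \<phi> z"
        \<comment> \<open>By disjointness at most one cap contains z, so the indicators add up to at
          most 1.\<close>
        proof (cases "\<exists>i\<in>{1..m}. z \<in> B i")
          case True
          then obtain i where i: "i \<in> {1..m}" "z \<in> B i" by blast
          have "z \<notin> B j" if j: "j \<in> {1..m}" "j \<noteq> i" for j
          proof
            assume "z \<in> B j"
            then have "norm (x i - x j) \<le> 2 * \<rho>"
              using i norm_triangle_ineq4[of "z - x j" "z - x i"]
              by (simp add: B_def dist_norm norm_minus_commute)
            then show False using sep[OF i(1) j(1)] j(2) \<rho>2 by auto
          qed
          then have "(\<Sum>j=1..m. \<phi> z * indicator (B j) z) = (\<Sum>j\<in>{i}. \<phi> z * indicator (B j) z)"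
            using i by (intro sum.mono_neutral_right) auto
          also have "\<dots> = \<phi> z" using i by simp
          finally show ?thesis by (simp only:)
        next
          case False
          then have "(\<Sum>j=1..m. \<phi> z * indicator (B j) z) = 0" by (intro sum.neutral) auto
          then show ?thesis using \<phi>0[OF z] by (simp only:)
        qed
      qed (intro Bochner_Integration.integrable_sum iB integrable_sphere_continuous \<phi>c)+
      also have "\<dots> \<le> K / n ^ d" unfolding \<phi>_def using n y by (intro K) auto
      finally show "(LINT z|sphere_measure. (\<Sum>j=1..m. \<phi> z * indicator (B j) z)) \<le> K / n ^ d" .
    qed (use C2 A n C0 c Q in \<open>auto intro!: divide_nonneg_nonneg mult_nonneg_nonneg\<close>)
    also have "\<dots> = C" using n by (simp add: C_def)
    finally show ?thesis .
  qed
  show ?thesis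
  proof (rule exI[of _ C], intro conjI C allI impI)
    fix m :: nat and x w n \<delta> y
    assume h: "1 \<le> (n::real)" "0 < \<delta>" "\<delta> \<le> pi" "n * \<delta> \<le> C3" "\<forall>j\<in>{1..m}. x j \<in> sphere (0::'a) 1"
      "\<forall>j\<in>{1..m}. 0 < w j \<and> w j \<le> C2 * \<delta> ^ d"
      "\<forall>i\<in>{1..m}. \<forall>j\<in>{1..m}. i \<noteq> j \<longrightarrow> 2 * \<delta> / (3 * C0) \<le> norm (x i - x j)" "y \<in> sphere (0::'a) 1"
    show "(\<Sum>j=1..m. w j * heat (1 / n\<^sup>2) y (x j)) \<le> C"
      by (rule main[OF h(1-4) bspec[OF h(5)] bspec[OF h(6)] h(7)[rule_format] h(8)])
  qed
qed

text \<open>Weights and kernel are nonnegative, so |F f| is at most sup |f| times the same operator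
  applied to the constant 1.\<close>

lemma hyperinterpolation_Linf:
  assumes n: "n \<ge> 1" and x: "\<And>j. j \<in> {1..m} \<Longrightarrow> x j \<in> sphere (0::'a) 1" and w: "\<And>j. j \<in> {1..m} \<Longrightarrow> w j > 0"
    and f: "continuous_on (sphere 0 1) f"
    and C: "\<And>y. y \<in> sphere 0 1 \<Longrightarrow> (\<Sum>j=1..m. w j * heat (1 / n\<^sup>2) y (x j)) \<le> C"
  shows "Linf_norm (heat_hyperinterpolation d Z Y m x w n f) \<le> ereal C * Linf_norm f"
proof -
  let ?F = "heat_hyperinterpolation d Z Y m x w n f"
  have Fc: "continuous_on (sphere 0 1) ?F" by (rule hyperinterpolation_continuous[OF n x])
  have n2: "0 < 1 / n\<^sup>2" "1 / n\<^sup>2 \<le> 1" using n by auto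
  obtain L where L: "Linf_norm f = ereal L" "\<And>x. x \<in> sphere 0 1 \<Longrightarrow> \<bar>f x\<bar> \<le> L"
    using Linf_norm_real[OF f] by blast
  have bound: "\<bar>?F y\<bar> \<le> C * L" if y: "y \<in> sphere 0 1" for y
  proof -
    have L0: "L \<ge> 0" using L(2)[OF y] by linarith
    have "\<bar>?F y\<bar> \<le> (\<Sum>j=1..m. \<bar>w j * f (x j) * heat (1 / n\<^sup>2) y (x j)\<bar>)"
      unfolding heat_hyperinterpolation_def heat_kernel_eq by (rule sum_abs)
    also have "\<dots> \<le> (\<Sum>j=1..m. w j * heat (1 / n\<^sup>2) y (x j) * L)"
    proof (rule sum_mono)
      fix j assume j: "j \<in> {1..m}"
      have h: "heat (1 / n\<^sup>2) y (x j) \<ge> 0" by (rule heat_nonneg[OF n2 y x[OF j]])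
      have "\<bar>w j * f (x j) * heat (1 / n\<^sup>2) y (x j)\<bar> = w j * heat (1 / n\<^sup>2) y (x j) * \<bar>f (x j)\<bar>"
        using h w[OF j] by (simp add: abs_mult)
      also have "\<dots> \<le> w j * heat (1 / n\<^sup>2) y (x j) * L"
        using h w[OF j] L(2)[OF x[OF j]] by (intro mult_left_mono) auto
      finally show "\<bar>w j * f (x j) * heat (1 / n\<^sup>2) y (x j)\<bar> \<le> w j * heat (1 / n\<^sup>2) y (x j) * L" .
    qed
    also have "\<dots> = (\<Sum>j=1..m. w j * heat (1 / n\<^sup>2) y (x j)) * L" by (simp only: sum_distrib_right)
    also have "\<dots> \<le> C * L" by (rule mult_right_mono[OF C[OF y] L0])
    finally show ?thesis .
  qed
  have "Linf_norm ?F \<le> ereal (C * L)"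
    unfolding Linf_norm_def
    by (rule esssup_I; intro borel_measurable_ereal borel_measurable_sphere_continuous continuous_intros Fc AE_I2)
       (use bound in auto)
  then show ?thesis by (simp add: L(1))
qed

end

section \<open>Convergence rates and uniform boundedness\<close>

theorem corollary4p14:
  fixes d :: nat and r s q C1 :: real
    and Z :: "nat \<Rightarrow> nat" and Y :: "nat \<Rightarrow> nat \<Rightarrow> 'a::euclidean_space \<Rightarrow> real"
    and M :: "nat set" and x :: "nat \<Rightarrow> nat \<Rightarrow> 'a" and w :: "nat \<Rightarrow> nat \<Rightarrow> real"
  defines "\<delta> \<equiv> \<lambda>m. mesh_norm m (x m)"
    and "\<gamma> \<equiv> \<lambda>m. separation_radius m (x m)"
    and "\<nu> \<equiv> \<lambda>m. sampling_error m (x m) (w m)"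
    and "H \<equiv> \<lambda>t. sobolev_space d Z Y t"
    and "nrm \<equiv> \<lambda>t. sobolev_norm d Z Y t"
    and "F \<equiv> \<lambda>m. heat_hyperinterpolation d Z Y m (x m) (w m)"
  assumes "DIM('a) = d + 1" and "d \<ge> 1"
    and "harmonic_orthonormal_basis Z Y"
    and "infinite M" and "\<forall>m\<in>M. m > 0"
    and "\<forall>m\<in>M. \<forall>j\<in>{1..m}. x m j \<in> sphere 0 1"
    and "\<forall>m\<in>M. \<forall>j\<in>{1..m}. w m j > 0"
    and "\<forall>m\<in>M. (\<Sum>j=1..m. w m j) = 1"
    and "r > d / 2" and "s > d / 2 + r" and "0 \<le> q" and "q < s" and "0 < s - q" and "s - q \<le> 2"
    and "\<forall>m\<in>M. \<nu> m \<in> H (- r) \<and> nrm (- r) (\<nu> m) \<le> C1 * \<delta> m powr r"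
  shows
    "(\<exists>C>0. \<forall>m\<in>M. \<forall>n::real. n \<ge> 1 \<longrightarrow>
        (\<forall>f. continuous_on (sphere 0 1) f \<and> dist_of_fun f \<in> H s \<longrightarrow>
           dist_of_fun (\<lambda>y. f y - F m n f y) \<in> H q \<and>
           nrm q (dist_of_fun (\<lambda>y. f y - F m n f y))
             \<le> C * (n powr (- (s - q)) + \<delta> m powr r * n powr (r + q)) * nrm s (dist_of_fun f)))
     \<and>
     (\<forall>(n::nat \<Rightarrow> real) c1 c2. c1 > 0 \<and> c2 > 0 \<and>
        (\<forall>m\<in>M. n m \<ge> 1 \<and> c1 * \<delta> m powr (- r / (s + r)) \<le> n m
                       \<and> n m \<le> c2 * \<delta> m powr (- r / (s + r))) \<longrightarrow>
        (\<exists>C'>0. \<forall>m\<in>M. \<forall>f. continuous_on (sphere 0 1) f \<and> dist_of_fun f \<in> H s \<longrightarrow>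
           dist_of_fun (\<lambda>y. f y - F m (n m) f y) \<in> H q \<and>
           nrm q (dist_of_fun (\<lambda>y. f y - F m (n m) f y))
             \<le> C' * \<delta> m powr (r * (s - q) / (s + r)) * nrm s (dist_of_fun f)))
     \<and>
     (\<forall>C0 C2. (\<forall>m\<in>M. m \<ge> 2) \<and> (\<forall>m\<in>M. \<delta> m \<le> C0 * \<gamma> m) \<and>
        (\<forall>m\<in>M. \<forall>j\<in>{1..m}. 0 < w m j \<and> w m j \<le> C2 * \<delta> m ^ d) \<longrightarrow>
        (\<forall>C3>0. \<exists>C''>0. \<forall>m\<in>M. \<forall>n::real. n \<ge> 1 \<and> n \<le> C3 * \<delta> m powr (- 1) \<longrightarrow>
           (\<forall>f. continuous_on (sphere 0 1) f \<longrightarrow>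
              Linf_norm (F m n f) \<le> ereal C'' * Linf_norm f)))"
proof -
  interpret harmonic_basis d Z Y by unfold_locales (fact assms)+
  have mpos: "m > 0" if "m \<in> M" for m using that assms(11) by blast
  have xs: "x m j \<in> sphere 0 1" if "m \<in> M" "j \<in> {1..m}" for m j using that assms(12) by blast
  have wpos: "w m j > 0" if "m \<in> M" "j \<in> {1..m}" for m j using that assms(13) by blast
  have r0: "r \<ge> 0" "r > 0" using \<open>r > d / 2\<close> d_pos by (auto intro: order_trans[of 0 "d/2"] le_less_trans[of 0 "d/2"])
  have sr: "s - r > d / 2" using \<open>s > d / 2 + r\<close> by simp
  have sr0: "s + r > 0" using r0 sr by (smt (verit) divide_nonneg_nonneg of_nat_0_le_iff)
  have qr: "q + r \<ge> 0" using r0 \<open>0 \<le> q\<close> by simp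
  have \<delta>: "0 \<le> \<delta> m" "\<delta> m \<le> pi" if "m \<in> M" for m
    unfolding \<delta>_def by (intro mesh_norm_bounds mpos xs that; assumption)+
  define K where "K = 2 powr (r / 2) * sqrt (\<Sum>l. (1 + lam l) powr (- (s - r)) * Z l)"
  define G where "G = sqrt (2 * max 1 (q + r) powr (q + r)) * K"
  have G0: "G \<ge> 0" unfolding G_def K_def
    by (intro mult_nonneg_nonneg real_sqrt_ge_zero suminf_nonneg multiplicity_powr_summable sr) auto
  \<comment> \<open>The absolute value allows for any sign of C1; sqrt 2 covers the smoothing error
    and the other summand the quadrature error.\<close>
  define C where "C = sqrt 2 + G * \<bar>C1\<bar>"
  have C: "C > 0" unfolding C_def using G0 by (intro add_pos_nonneg) auto
  have error: "dist_of_fun (\<lambda>y. f y - F m n f y) \<in> H q \<and>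
      nrm q (dist_of_fun (\<lambda>y. f y - F m n f y))
        \<le> C * (n powr (- (s - q)) + \<delta> m powr r * n powr (r + q)) * nrm s (dist_of_fun f)"
    if m: "m \<in> M" and n: "n \<ge> 1" and f: "continuous_on (sphere 0 1) f" "dist_of_fun f \<in> H s" for m n f
  proof -
    have nu: "sampling_error m (x m) (w m) \<in> sobolev_space d Z Y (- r)"
      "sobolev_norm d Z Y (- r) (sampling_error m (x m) (w m)) \<le> C1 * \<delta> m powr r"
      using assms(21) m by (auto simp: \<nu>_def H_def nrm_def)
    note E = hyperinterpolation_error[OF xs[OF m] nu(1) f(1) f(2)[unfolded H_def] r0(1) sr \<open>0 \<le> q\<close> \<open>0 < s - q\<close> \<open>s - q \<le> 2\<close> n]
    have Nf: "nrm s (dist_of_fun f) \<ge> 0"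
      using f(2) unfolding nrm_def H_def sobolev_space_def by (intro sobolev_norm_nonneg) simp
    have nu': "sobolev_norm d Z Y (- r) (sampling_error m (x m) (w m)) \<le> \<bar>C1\<bar> * \<delta> m powr r"
      using nu(2) mult_right_mono[OF abs_ge_self[of C1], of "\<delta> m powr r"] by simp
    have "sqrt 2 * n powr (- (s - q)) + G * (n powr (q + r) * sobolev_norm d Z Y (- r) (sampling_error m (x m) (w m)))
       \<le> sqrt 2 * n powr (- (s - q)) + G * (n powr (q + r) * (\<bar>C1\<bar> * \<delta> m powr r))"
      using G0 nu' by (intro add_left_mono mult_left_mono) auto
    also have "\<dots> \<le> C * n powr (- (s - q)) + C * (\<delta> m powr r * n powr (r + q))"
    proof (intro add_mono)
      show "sqrt 2 * n powr (- (s - q)) \<le> C * n powr (- (s - q))"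
        using G0 by (intro mult_right_mono) (auto simp: C_def)
      have "G * \<bar>C1\<bar> * (\<delta> m powr r * n powr (r + q)) \<le> C * (\<delta> m powr r * n powr (r + q))"
        by (intro mult_right_mono) (auto simp: C_def)
      then show "G * (n powr (q + r) * (\<bar>C1\<bar> * \<delta> m powr r)) \<le> C * (\<delta> m powr r * n powr (r + q))"
        by (simp add: ac_simps)
    qed
    finally have le: "sqrt 2 * n powr (- (s - q)) + G * (n powr (q + r) * sobolev_norm d Z Y (- r) (sampling_error m (x m) (w m)))
       \<le> C * (n powr (- (s - q)) + \<delta> m powr r * n powr (r + q))" by (simp add: distrib_left)
    have "nrm q (dist_of_fun (\<lambda>y. f y - F m n f y))
      \<le> (sqrt 2 * n powr (- (s - q)) + G * (n powr (q + r) * sobolev_norm d Z Y (- r) (sampling_error m (x m) (w m)))) * nrm s (dist_of_fun f)"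
      using E(2) by (simp only: nrm_def F_def G_def K_def)
    also have "\<dots> \<le> C * (n powr (- (s - q)) + \<delta> m powr r * n powr (r + q)) * nrm s (dist_of_fun f)"
      by (rule mult_right_mono[OF le Nf])
    finally show ?thesis using E(1) by (simp add: H_def F_def)
  qed
  have part1: "\<exists>C>0. \<forall>m\<in>M. \<forall>n::real. n \<ge> 1 \<longrightarrow>
        (\<forall>f. continuous_on (sphere 0 1) f \<and> dist_of_fun f \<in> H s \<longrightarrow>
           dist_of_fun (\<lambda>y. f y - F m n f y) \<in> H q \<and>
           nrm q (dist_of_fun (\<lambda>y. f y - F m n f y))
             \<le> C * (n powr (- (s - q)) + \<delta> m powr r * n powr (r + q)) * nrm s (dist_of_fun f))"
    using error C by blast
  have part2: "\<exists>C'>0. \<forall>m\<in>M. \<forall>f. continuous_on (sphere 0 1) f \<and> dist_of_fun f \<in> H s \<longrightarrow>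
           dist_of_fun (\<lambda>y. f y - F m (n m) f y) \<in> H q \<and>
           nrm q (dist_of_fun (\<lambda>y. f y - F m (n m) f y))
             \<le> C' * \<delta> m powr (r * (s - q) / (s + r)) * nrm s (dist_of_fun f)"
    if c1: "c1 > 0" and c2: "c2 > 0" and n: "\<forall>m\<in>M. n m \<ge> 1 \<and> c1 * \<delta> m powr (- r / (s + r)) \<le> n m
                       \<and> n m \<le> c2 * \<delta> m powr (- r / (s + r))" for n :: "nat \<Rightarrow> real" and c1 c2
  proof -
    define C' where "C' = C * (c1 powr (- (s - q)) + c2 powr (r + q))"
    have C': "C' > 0" unfolding C'_def using C c1 by (intro mult_pos_pos add_pos_nonneg) auto
    have "dist_of_fun (\<lambda>y. f y - F m (n m) f y) \<in> H q \<and>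
           nrm q (dist_of_fun (\<lambda>y. f y - F m (n m) f y))
             \<le> C' * \<delta> m powr (r * (s - q) / (s + r)) * nrm s (dist_of_fun f)"
      if m: "m \<in> M" and f: "continuous_on (sphere 0 1) f" "dist_of_fun f \<in> H s" for m f
    proof -
      \<comment> \<open>Exponent of the balanced scale n of order \<delta>^a: both -a (s - q) and r
        + a (r + q) equal e.\<close>
      define a where "a = - r / (s + r)"
      define e where "e = r * (s - q) / (s + r)"
      have nm: "n m \<ge> 1" "c1 * \<delta> m powr a \<le> n m" "n m \<le> c2 * \<delta> m powr a" using n m by (auto simp: a_def)
      \<comment> \<open>As \<open>0 powr a = 0\<close>, a vanishing mesh norm would force n m <= 0
        through the upper bound.\<close>
      have "\<delta> m \<noteq> 0" using nm c2 by auto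
      then have d0: "\<delta> m > 0" using \<delta>(1)[OF m] by simp
      have "n m powr (- (s - q)) \<le> (c1 * \<delta> m powr a) powr (- (s - q))"
        using nm c1 d0 \<open>0 < s - q\<close> by (intro powr_mono2') auto
      also have "\<dots> = c1 powr (- (s - q)) * \<delta> m powr (a * (- (s - q)))"
        using c1 by (simp add: powr_mult powr_powr)
      also have "a * (- (s - q)) = e" using sr0 by (simp add: a_def e_def field_simps)
      finally have 1: "n m powr (- (s - q)) \<le> c1 powr (- (s - q)) * \<delta> m powr e" .
      have "n m powr (r + q) \<le> (c2 * \<delta> m powr a) powr (r + q)"
        using nm qr by (intro powr_mono2) auto
      also have "\<dots> = c2 powr (r + q) * \<delta> m powr (a * (r + q))"
        using c2 by (simp add: powr_mult powr_powr)
      finally have "\<delta> m powr r * n m powr (r + q) \<le> \<delta> m powr r * (c2 powr (r + q) * \<delta> m powr (a * (r + q)))"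
        by (rule mult_left_mono) simp
      also have "\<dots> = c2 powr (r + q) * \<delta> m powr (r + a * (r + q))" by (simp add: powr_add)
      also have "r + a * (r + q) = e"
        using sr0 by (simp add: a_def e_def divide_simps) (simp add: algebra_simps)
      finally have 2: "\<delta> m powr r * n m powr (r + q) \<le> c2 powr (r + q) * \<delta> m powr e" .
      have Nf: "nrm s (dist_of_fun f) \<ge> 0"
        using f(2) unfolding nrm_def H_def sobolev_space_def by (intro sobolev_norm_nonneg) simp
      have "C * (n m powr (- (s - q)) + \<delta> m powr r * n m powr (r + q)) \<le> C * (c1 powr (- (s - q)) * \<delta> m powr e + c2 powr (r + q) * \<delta> m powr e)"
        using 1 2 C by (intro mult_left_mono add_mono) auto
      also have "\<dots> = C' * \<delta> m powr e" by (simp add: C'_def algebra_simps)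
      finally have "C * (n m powr (- (s - q)) + \<delta> m powr r * n m powr (r + q)) * nrm s (dist_of_fun f) \<le> C' * \<delta> m powr e * nrm s (dist_of_fun f)"
        using Nf by (rule mult_right_mono)
      then show ?thesis using error[OF m nm(1) f] unfolding e_def by linarith
    qed
    then show ?thesis using C' by blast
  qed
  have part3: "\<exists>C''>0. \<forall>m\<in>M. \<forall>n::real. n \<ge> 1 \<and> n \<le> C3 * \<delta> m powr (- 1) \<longrightarrow>
           (\<forall>f. continuous_on (sphere 0 1) f \<longrightarrow> Linf_norm (F m n f) \<le> ereal C'' * Linf_norm f)"
    if m2: "\<forall>m\<in>M. m \<ge> 2" and qu: "\<forall>m\<in>M. \<delta> m \<le> C0 * \<gamma> m"
      and w: "\<forall>m\<in>M. \<forall>j\<in>{1..m}. 0 < w m j \<and> w m j \<le> C2 * \<delta> m ^ d" and C3: "C3 > 0" for C0 C2 C3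
  proof -
    \<comment> \<open>Enlarged to meet the requirements C0 >= 1 and C2 > 0 of
      \<open>weighted_kernel_sum_bound\<close>.\<close>
    define C0' where "C0' = max 1 C0"
    define C2' where "C2' = max 1 C2"
    have C0': "C0' \<ge> 1" and C2': "C2' > 0" by (auto simp: C0'_def C2'_def)
    obtain C'' where C'': "C'' > 0" and bound: "\<forall>m x w n \<delta> y. n \<ge> 1 \<longrightarrow> 0 < \<delta> \<longrightarrow> \<delta> \<le> pi \<longrightarrow> n * \<delta> \<le> C3 \<longrightarrow>
     (\<forall>j\<in>{1..m}. x j \<in> sphere (0::'a) 1) \<longrightarrow> (\<forall>j\<in>{1..m}. 0 < w j \<and> w j \<le> C2' * \<delta> ^ d) \<longrightarrow>
     (\<forall>i\<in>{1..m}. \<forall>j\<in>{1..m}. i \<noteq> j \<longrightarrow> 2 * \<delta> / (3 * C0') \<le> norm (x i - x j)) \<longrightarrow> y \<in> sphere 0 1 \<longrightarrow>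
     (\<Sum>j=1..(m::nat). w j * heat (1 / n\<^sup>2) y (x j)) \<le> C''"
      using weighted_kernel_sum_bound[OF C0' C2' C3] by (elim exE conjE)
    have "Linf_norm (F m n f) \<le> ereal C'' * Linf_norm f"
      if m: "m \<in> M" and n: "n \<ge> 1" "n \<le> C3 * \<delta> m powr (- 1)" and f: "continuous_on (sphere 0 1) f" for m n f
    proof -
      have 1: "1 \<in> {1..m}" using mpos[OF m] by simp
      have w1: "0 < w m 1" "w m 1 \<le> C2 * \<delta> m ^ d" using w m 1 by blast+
      \<comment> \<open>Otherwise the upper bound C2 \<delta>^d would be 0, because d >= 1, against
        the positivity of the weight \<open>w m 1\<close>.\<close>
      have "\<delta> m \<noteq> 0"
      proof
        assume "\<delta> m = 0"
        then have "C2 * \<delta> m ^ d = 0" using d_pos by simp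
        then show False using w1 by linarith
      qed
      then have d0: "\<delta> m > 0" using \<delta>(1)[OF m] by simp
      have n\<delta>: "n * \<delta> m \<le> C3" using n(2) d0 by (simp add: powr_minus field_simps)
      have w': "0 < w m j \<and> w m j \<le> C2' * \<delta> m ^ d" if j: "j \<in> {1..m}" for j
      proof -
        have "C2 * \<delta> m ^ d \<le> C2' * \<delta> m ^ d" using d0 by (intro mult_right_mono) (auto simp: C2'_def)
        then show ?thesis using w m j by force
      qed
      have sep: "2 * \<delta> m / (3 * C0') \<le> norm (x m i - x m j)" if ij: "i \<in> {1..m}" "j \<in> {1..m}" "i \<noteq> j" for i j
      proof -
        have le: "2 * \<gamma> m \<le> 3 * norm (x m i - x m j)"
          unfolding \<gamma>_def using separation_radius_le[OF ij, of "x m"] geodesic_le_chord[OF xs[OF m ij(1)] xs[OF m ij(2)]] by linarith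
        have "\<delta> m \<le> C0 * \<gamma> m" using qu m by blast
        also have "\<dots> \<le> C0' * (3 * norm (x m i - x m j) / 2)"
        proof (cases "C0 \<ge> 0")
          case True
          have "C0 * \<gamma> m \<le> C0 * (3 * norm (x m i - x m j) / 2)" using le True by (intro mult_left_mono) auto
          also have "\<dots> \<le> C0' * (3 * norm (x m i - x m j) / 2)" by (intro mult_right_mono) (auto simp: C0'_def)
          finally show ?thesis .
        next
          \<comment> \<open>For negative C0 the product of C0 and \<gamma> is nonpositive because
            \<gamma> >= 0, so the comparison is trivial.\<close>
          case False
          have "\<gamma> m \<ge> 0"
          proof -
            let ?S = "{geodesic_dist (x m i) (x m j) | i j. i \<in> {1..m} \<and> j \<in> {1..m} \<and> i \<noteq> j}"
            have "?S \<subseteq> (\<lambda>(i, j). geodesic_dist (x m i) (x m j)) ` ({1..m} \<times> {1..m})" by auto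
            then have "finite ?S" by (rule finite_subset) simp
            moreover have "?S \<noteq> {}" using ij by auto
            moreover have "0 \<le> a" if "a \<in> ?S" for a
            proof -
              from that obtain i' j' where "a = geodesic_dist (x m i') (x m j')" "i' \<in> {1..m}" "j' \<in> {1..m}" by blast
              then show ?thesis using geodesic_dist_bounds(1)[OF xs[OF m] xs[OF m]] by simp
            qed
            ultimately have "0 \<le> Min ?S" by (subst Min_ge_iff) blast+
            then show ?thesis by (simp add: \<gamma>_def separation_radius_def)
          qed
          then have "C0 * \<gamma> m \<le> 0" using False by (simp add: mult_nonpos_nonneg)
          also have "0 \<le> C0' * (3 * norm (x m i - x m j) / 2)" by (simp add: C0'_def)
          finally show ?thesis .
        qed
        finally show ?thesis using C0' by (simp add: divide_le_eq ac_simps)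
      qed
      have sum_le: "(\<Sum>j=1..m. w m j * heat (1 / n\<^sup>2) y (x m j)) \<le> C''" if y: "y \<in> sphere 0 1" for y
      proof -
        have a: "\<forall>j\<in>{1..m}. x m j \<in> sphere 0 1" using xs[OF m] by blast
        have b: "\<forall>j\<in>{1..m}. 0 < w m j \<and> w m j \<le> C2' * \<delta> m ^ d" using w' by blast
        have c: "\<forall>i\<in>{1..m}. \<forall>j\<in>{1..m}. i \<noteq> j \<longrightarrow> 2 * \<delta> m / (3 * C0') \<le> norm (x m i - x m j)" using sep by blast
        show ?thesis
          by (rule bound[THEN spec[of _ m], THEN spec[of _ "x m"], THEN spec[of _ "w m"], THEN spec[of _ n],
                THEN spec[of _ "\<delta> m"], THEN spec[of _ y], THEN mp, OF n(1), THEN mp, OF d0, THEN mp, OF \<delta>(2)[OF m],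
                THEN mp, OF n\<delta>, THEN mp, OF a, THEN mp, OF b, THEN mp, OF c, THEN mp, OF y])
      qed
      show ?thesis
        unfolding F_def by (rule hyperinterpolation_Linf[OF n(1) xs[OF m] wpos[OF m] f sum_le])
    qed
    then show ?thesis using C'' by blast
  qed
  show ?thesis
    by (intro conjI, rule part1, (intro allI impI, elim conjE, rule part2; assumption),
      (intro allI impI, elim conjE, rule part3; assumption))
qed

end
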